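(* Let $\eta\in\{2,3,\dots\}\sqcup\{\infty\}$ and $\kappa\in\{0,1,2,\dots\}$. Assume that $\boldsymbol\tau=\{\tau_i\}_{i=1}^\eta$ is a sequence of positive Borel measures on $[0,1]$ such that $\sup_{i\in J_\eta}\tau_i([0,1])<\infty$. Let $\mathscr U_{\eta,\kappa}^{\boldsymbol\tau}$ be the set of all sequences $\boldsymbol t=\{t_i\}_{i=1}^\eta\subseteq(0,\infty)$ satisfying $$\sum_{i=1}^\eta t_i^2<\infty,$$ $$\sum_{i=1}^\eta t_i^2\ge1+\sum_{i=1}^\eta t_i^2\int_0^1\frac1s\,d\tau_i(s)\ \text{ if }\kappa=0,\qquad\sum_{i=1}^\eta t_i^2=1+\sum_{i=1}^\eta t_i^2\int_0^1\frac1s\,d\tau_i(s)\ \text{ if }\kappa>0,$$ $$\sum_{i=1}^\eta t_i^2>\sum_{i=1}^\eta t_i^2\int_0^1\Big(\frac1s+\dots+\frac1{s^{\kappa+1}}\Big)d\tau_i(s).$$ Let $\mathscr V_{\eta,\kappa}^{\boldsymbol\tau}$ be the set of all completely hyperexpansive weighted shifts $S_{\boldsymbol\lambda}\in\boldsymbol B(\ell^2(V_{\eta,\kappa}))$ on $\mathcal T_{\eta,\kappa}$ with positive weights $\boldsymbol\lambda=\{\lambda_v\}_{v\in V_{\eta,\kappa}^\circ}$ such that $\tau_{i,1}=\tau_i$ for all $i\in J_\eta$, and (for $\kappa\ge1$) let $\mathscr W_{\eta,\kappa}^{\boldsymbol\tau}$ be the set of all $S_{\boldsymbol\lambda}\in\mathscr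 V_{\eta,\kappa}^{\boldsymbol\tau}$ which are extremal. For $\kappa\ge1$ and $\boldsymbol t\in\mathscr U_{\eta,\kappa}^{\boldsymbol\tau}$ put $$\zeta_k=\sum_{i=1}^\eta t_i^2\Big(1-\int_0^1\sum_{j=1}^k\frac1{s^j}\,d\tau_i(s)\Big),\qquad k\in J_{\kappa+1}.$$ Consider the formulas $$\lambda_{i,j}=\begin{cases}t_i&\text{for }j=1,\\ \sqrt{1+\tau_i([0,1])}&\text{for }j=2,\\ \sqrt{\dfrac{1+\int_0^1(1+\dots+s^{j-2})\,d\tau_i(s)}{1+\int_0^1(1+\dots+s^{j-3})\,d\tau_i(s)}}&\text{for }j\ge3,\end{cases}\qquad i\in J_\eta,\qquad(1)$$ $$\lambda_{-k}=\begin{cases}\dfrac1{\sqrt{\zeta_2}}&\text{for }k=0,\\ \sqrt{\dfrac{\zeta_{k+1}}{\zeta_{k+2}}}&\text{for }k\in J_{\kappa-1}.\end{cases}\qquad(2)$$ If $\kappa=0$, then the mapping $\Phi_{\eta,0}\colon\mathscr U_{\eta,0}^{\boldsymbol\tau}\ni\boldsymbol t\mapsto S_{\boldsymbol\lambda}\in\mathscr V_{\eta,0}^{\boldsymbol\tau}$ defined by (1) is a bijection. If $\kappa\ge1$, then the mapping $\Phi_{\eta,\kappa}\colon\mathscr U_{\eta,\kappa}^{\boldsymbol\tau}\ni\boldsymbol t\mapsto S_{\boldsymbol\lambda}\in\mathscr W_{\eta,\kappa}^{\boldsymbol\tau}$ defined by (1) and (2) is a bijection. Moreover, for $\kappa\ge1$: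 if $S_{\boldsymbol\lambda}\in\mathscr V_{\eta,\kappa}^{\boldsymbol\tau}$, then $\boldsymbol t=\{t_i\}_{i=1}^\eta$ with $t_i:=\lambda_{i,1}$ belongs to $\mathscr U_{\eta,\kappa}^{\boldsymbol\tau}$, $\lambda_{-\kappa+1}\in\Big[\sqrt{\frac{\zeta_\kappa}{\zeta_{\kappa+1}}},\infty\Big)$ and $\lambda_v=\tilde\lambda_v$ for all $v\ne-\kappa+1$, where $S_{\tilde{\boldsymbol\lambda}}=\Phi_{\eta,\kappa}(\boldsymbol t)$. Conversely, if $\boldsymbol t\in\mathscr U_{\eta,\kappa}^{\boldsymbol\tau}$ and $S_{\boldsymbol\lambda}=\Phi_{\eta,\kappa}(\boldsymbol t)$, then for every $\vartheta\in\Big[\sqrt{\frac{\zeta_\kappa}{\zeta_{\kappa+1}}},\infty\Big)$, the weighted shift $S_{\tilde{\boldsymbol\lambda}}$ on $\mathcal T_{\eta,\kappa}$ with weights $\tilde{\boldsymbol\lambda}=\{\tilde\lambda_v\}_{v\in V_{\eta,\kappa}^\circ}$ given by $\tilde\lambda_v=\lambda_v$ for all $v\ne-\kappa+1$, and $\tilde\lambda_{-\kappa+1}=\vartheta$, is a member of $\mathscr V_{\eta,\kappa}^{\boldsymbol\tau}$.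
   Context: $\mathbb N=\{1,2,\dots\}$; $J_\iota=\{k\in\mathbb N:k\le\iota\}$ for $\iota\in\{0,1,2,\dots\}\sqcup\{\infty\}$ (so $J_0=\varnothing$, $J_\infty=\mathbb N$). For $\kappa<\infty$, the directed tree $\mathcal T_{\eta,\kappa}=(V_{\eta,\kappa},E_{\eta,\kappa})$ has vertex set $V_{\eta,\kappa}=\{-k:k\in J_\kappa\}\sqcup\{0\}\sqcup\{(i,j):i\in J_\eta,\ j\in\mathbb N\}$ and edge set $E_{\eta,\kappa}=\{(-k,-k+1):k\in J_\kappa\}\sqcup\{(0,(i,1)):i\in J_\eta\}\sqcup\{((i,j),(i,j+1)):i\in J_\eta,\ j\in\mathbb N\}$, an edge $(u,v)$ being directed from $u$ (the parent $\operatorname{par}(v)$ of $v$) to $v$. Its root (the vertex without parent) is $-\kappa$, and $V_{\eta,\kappa}^\circ=V_{\eta,\kappa}\setminus\{-\kappa\}$. We write $\lambda_{i,j}$, $e_{i,j}$, $\tau_{i,j}$ for $\lambda_{(i,j)}$, $e_{(i,j)}$, $\tau_{(i,j)}$. The weighted shift $S_{\boldsymbol\lambda}$ on $\mathcal T_{\eta,\kappa}$ with weights $\boldsymbol\lambda=\{\lambda_v\}_{v\in V_{\eta,\kappa}^\circ}$ is the operator in $\ell^2(V_{\eta,\kappa})$ given by $(S_{\boldsymbol\lambda}f)(v)=\lambda_vf(\operatorname{par}(v))$ for $v\in V_{\eta,\kappa}^\circ$ and $(S_{\boldsymbol\lambda}f)(-\kappa)=0$, with domain all $f\in\ell^2(V_{\eta,\kappa})$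 for which the function so defined is in $\ell^2(V_{\eta,\kappa})$. $\{e_u\}$ is the standard orthonormal basis. $\boldsymbol B(\mathcal H)$ denotes the bounded operators on $\mathcal H$ with domain $\mathcal H$. A real sequence $\{a_n\}_{n=0}^\infty$ is completely alternating if $\sum_{j=0}^n(-1)^j\binom nja_{m+j}\le0$ for all integers $m\ge0$, $n\ge1$; equivalently, there is a (unique, finite) positive Borel measure $\tau$ on $[0,1]$, called its representing measure, such that $a_n=a_0+\int_0^1(1+\dots+s^{n-1})\,d\tau(s)$ for $n=1,2,\dots$. $A\in\boldsymbol B(\mathcal H)$ is completely hyperexpansive if $\{\|A^nh\|^2\}_{n=0}^\infty$ is completely alternating for every $h\in\mathcal H$. For completely hyperexpansive $S_{\boldsymbol\lambda}$, $\tau_u$ denotes the representing measure of $\{\|S_{\boldsymbol\lambda}^ne_u\|^2\}_{n=0}^\infty$. For $\kappa\ge1$, a completely hyperexpansive weighted shift $S_{\boldsymbol\lambda}\in\boldsymbol B(\ell^2(V_{\eta,\kappa}))$ on $\mathcal T_{\eta,\kappa}$ with nonzero weights is extremal if $\|S_{\boldsymbol\lambda}e_{-\kappa}\|=\min\|S_{\tilde{\boldsymbol\lambda}}e_{-\kappa}\|$, the minimum being over all completely hyperexpansive weighted shifts $S_{\tilde{\boldsymbol\lambda}}\in\boldsymbol B(\ell^2(V_{\eta,\kappa}))$ on $\mathcal T_{\eta,\kappa}$ with nonzero weights such that $\tilde\lambda_v=\lambda_v$ for all $v\ne-\kappa+1$. Conventions: $\int_0^1$ means $\int_{[0,1]}$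 and $\frac10=\infty$. *)

theory Defs
  imports "HOL-Analysis.Analysis" "HOL-Library.Extended_Nat"
begin

definition J :: "enat \<Rightarrow> nat set" where
  "J \<iota> = {k. 1 \<le> k \<and> enat k \<le> \<iota>}"

(* Trunk m is the vertex m = -k of the trunk (in particular Trunk 0 is the vertex 0);
   Branch i j is the vertex (i,j). *)
datatype vertex = Trunk int | Branch nat nat

definition tree_vertices :: "enat \<Rightarrow> nat \<Rightarrow> vertex set" where
  "tree_vertices \<eta> \<kappa> =
     {Trunk (- int k) | k. k \<in> J (enat \<kappa>)} \<union> {Trunk 0} \<union> {Branch i j | i j. i \<in> J \<eta> \<and> 1 \<le> j}"

definition tree_edges :: "enat \<Rightarrow> nat \<Rightarrow> (vertex \<times> vertex) set" where
  "tree_edges \<eta> \<kappa> =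
     {(Trunk (- int k), Trunk (- int k + 1)) | k. k \<in> J (enat \<kappa>)}
     \<union> {(Trunk 0, Branch i 1) | i. i \<in> J \<eta>}
     \<union> {(Branch i j, Branch i (j + 1)) | i j. i \<in> J \<eta> \<and> 1 \<le> j}"

definition tree_root :: "nat \<Rightarrow> vertex" where
  "tree_root \<kappa> = Trunk (- int \<kappa>)"

definition nonroot_vertices :: "enat \<Rightarrow> nat \<Rightarrow> vertex set" where
  "nonroot_vertices \<eta> \<kappa> = tree_vertices \<eta> \<kappa> - {tree_root \<kappa>}"

(* only meaningful for non-root vertices *)
definition parent :: "enat \<Rightarrow> nat \<Rightarrow> vertex \<Rightarrow> vertex" where
  "parent \<eta> \<kappa> v = (THE u. (u, v) \<in> tree_edges \<eta> \<kappa>)"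

(* The elements of the complex Hilbert space l^2(V) are the square-summable functions on V,
   extended by zero to the whole index type so that equality in l^2(V) is equality of functions. *)
definition ell2 :: "'v set \<Rightarrow> ('v \<Rightarrow> complex) set" where
  "ell2 V = {f. (\<forall>v. v \<notin> V \<longrightarrow> f v = 0) \<and> (\<lambda>v. (cmod (f v))\<^sup>2) summable_on V}"

definition l2norm :: "'v set \<Rightarrow> ('v \<Rightarrow> complex) \<Rightarrow> real" where
  "l2norm V f = sqrt (\<Sum>\<^sub>\<infinity>v\<in>V. (cmod (f v))\<^sup>2)"

definition basis_vec :: "'v \<Rightarrow> 'v \<Rightarrow> complex" where
  "basis_vec u = (\<lambda>v. if v = u then 1 else 0)"

(* A not necessarily everywhere defined operator in l^2(V) is a partial map whose dom is the
   domain of the operator. *)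
type_synonym 'v operator = "('v \<Rightarrow> complex) \<rightharpoonup> ('v \<Rightarrow> complex)"

definition op_apply :: "'v operator \<Rightarrow> ('v \<Rightarrow> complex) \<Rightarrow> ('v \<Rightarrow> complex)" where
  "op_apply A f = the (A f)"

(* A^n h, used only for operators that map their whole domain l^2(V) into itself *)
definition op_pow_apply :: "'v operator \<Rightarrow> nat \<Rightarrow> ('v \<Rightarrow> complex) \<Rightarrow> ('v \<Rightarrow> complex)" where
  "op_pow_apply A n h = (op_apply A ^^ n) h"

definition bounded_operators :: "'v set \<Rightarrow> 'v operator set" where
  "bounded_operators V = {A.
     dom A = ell2 V \<and> ran A \<subseteq> ell2 V \<and>
     (\<forall>f\<in>ell2 V. \<forall>g\<in>ell2 V. op_apply A (\<lambda>v. f v + g v) = (\<lambda>v. op_apply A f v + op_apply A g v)) \<and>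
     (\<forall>c. \<forall>f\<in>ell2 V. op_apply A (\<lambda>v. c * f v) = (\<lambda>v. c * op_apply A f v)) \<and>
     (\<exists>C. \<forall>f\<in>ell2 V. l2norm V (op_apply A f) \<le> C * l2norm V f)}"

definition wshift_fun ::
  "enat \<Rightarrow> nat \<Rightarrow> (vertex \<Rightarrow> complex) \<Rightarrow> (vertex \<Rightarrow> complex) \<Rightarrow> (vertex \<Rightarrow> complex)" where
  "wshift_fun \<eta> \<kappa> lam f =
     (\<lambda>v. if v \<in> nonroot_vertices \<eta> \<kappa> then lam v * f (parent \<eta> \<kappa> v) else 0)"

(* The weights are the values of lam on nonroot_vertices; its other values are irrelevant. *)
definition weighted_shift :: "enat \<Rightarrow> nat \<Rightarrow> (vertex \<Rightarrow> complex) \<Rightarrow> vertex operator" where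
  "weighted_shift \<eta> \<kappa> lam =
     (\<lambda>f. if f \<in> ell2 (tree_vertices \<eta> \<kappa>) \<and> wshift_fun \<eta> \<kappa> lam f \<in> ell2 (tree_vertices \<eta> \<kappa>)
          then Some (wshift_fun \<eta> \<kappa> lam f) else None)"

definition weighted_shift_real :: "enat \<Rightarrow> nat \<Rightarrow> (vertex \<Rightarrow> real) \<Rightarrow> vertex operator" where
  "weighted_shift_real \<eta> \<kappa> lam = weighted_shift \<eta> \<kappa> (\<lambda>v. complex_of_real (lam v))"

definition completely_alternating :: "(nat \<Rightarrow> real) \<Rightarrow> bool" where
  "completely_alternating a \<longleftrightarrow>
     (\<forall>m n. 1 \<le> n \<longrightarrow> (\<Sum>j=0..n. (-1) ^ j * real (n choose j) * a (m + j)) \<le> 0)"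

definition borel_measure_on_unit :: "real measure \<Rightarrow> bool" where
  "borel_measure_on_unit M \<longleftrightarrow> sets M = sets (restrict_space borel {0..1})"

definition is_representing_measure :: "(nat \<Rightarrow> real) \<Rightarrow> real measure \<Rightarrow> bool" where
  "is_representing_measure a M \<longleftrightarrow>
     borel_measure_on_unit M \<and> finite_measure M \<and>
     (\<forall>n\<ge>1. a n = a 0 + (\<integral>s. (\<Sum>l<n. s ^ l) \<partial>M))"

definition representing_measure :: "(nat \<Rightarrow> real) \<Rightarrow> real measure" where
  "representing_measure a = (THE M. is_representing_measure a M)"

definition completely_hyperexpansive :: "'v set \<Rightarrow> 'v operator \<Rightarrow> bool" where
  "completely_hyperexpansive V A \<longleftrightarrow>
     A \<in> bounded_operators V \<and>
     (\<forall>h\<in>ell2 V. completely_alternating (\<lambda>n. (l2norm V (op_pow_apply A n h))\<^sup>2))"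

definition vertex_measure :: "'v set \<Rightarrow> 'v operator \<Rightarrow> 'v \<Rightarrow> real measure" where
  "vertex_measure V A u =
     representing_measure (\<lambda>n. (l2norm V (op_pow_apply A n (basis_vec u)))\<^sup>2)"

definition nonzero_weights :: "enat \<Rightarrow> nat \<Rightarrow> (vertex \<Rightarrow> complex) \<Rightarrow> bool" where
  "nonzero_weights \<eta> \<kappa> lam \<longleftrightarrow> (\<forall>v\<in>nonroot_vertices \<eta> \<kappa>. lam v \<noteq> 0)"

definition positive_weights :: "enat \<Rightarrow> nat \<Rightarrow> (vertex \<Rightarrow> real) \<Rightarrow> bool" where
  "positive_weights \<eta> \<kappa> lam \<longleftrightarrow> (\<forall>v\<in>nonroot_vertices \<eta> \<kappa>. 0 < lam v)"

definition root_norm :: "enat \<Rightarrow> nat \<Rightarrow> (vertex \<Rightarrow> complex) \<Rightarrow> real" where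
  "root_norm \<eta> \<kappa> lam =
     l2norm (tree_vertices \<eta> \<kappa>) (op_apply (weighted_shift \<eta> \<kappa> lam) (basis_vec (tree_root \<kappa>)))"

definition extremal_competitors :: "enat \<Rightarrow> nat \<Rightarrow> (vertex \<Rightarrow> complex) \<Rightarrow> (vertex \<Rightarrow> complex) set" where
  "extremal_competitors \<eta> \<kappa> lam = {lam'.
     nonzero_weights \<eta> \<kappa> lam' \<and>
     completely_hyperexpansive (tree_vertices \<eta> \<kappa>) (weighted_shift \<eta> \<kappa> lam') \<and>
     (\<forall>v\<in>nonroot_vertices \<eta> \<kappa>. v \<noteq> Trunk (- int \<kappa> + 1) \<longrightarrow> lam' v = lam v)}"

(* only meaningful for \<kappa> \<ge> 1 *)
definition extremal :: "enat \<Rightarrow> nat \<Rightarrow> vertex operator \<Rightarrow> bool" where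
  "extremal \<eta> \<kappa> A \<longleftrightarrow> (\<exists>lam.
     A = weighted_shift \<eta> \<kappa> lam \<and>
     nonzero_weights \<eta> \<kappa> lam \<and>
     completely_hyperexpansive (tree_vertices \<eta> \<kappa>) A \<and>
     (\<forall>lam'\<in>extremal_competitors \<eta> \<kappa> lam. root_norm \<eta> \<kappa> lam \<le> root_norm \<eta> \<kappa> lam'))"

(* The integral of 1/s + ... + 1/s^k over [0,1], possibly infinite; the division is that of
   ennreal, where 1/0 = \<infinity>. *)
definition inv_moment :: "real measure \<Rightarrow> nat \<Rightarrow> ennreal" where
  "inv_moment M k = (\<integral>\<^sup>+ s. (\<Sum>j=1..k. 1 / ennreal s ^ j) \<partial>M)"

(* The families t indexed by J \<eta> are functions that are undefined outside J \<eta>. *)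
definition U_set :: "enat \<Rightarrow> nat \<Rightarrow> (nat \<Rightarrow> real measure) \<Rightarrow> (nat \<Rightarrow> real) set" where
  "U_set \<eta> \<kappa> \<tau> = {t \<in> (\<Pi>\<^sub>E i\<in>J \<eta>. {0<..}).
     (\<Sum>\<^sub>\<infinity>i\<in>J \<eta>. ennreal ((t i)\<^sup>2)) < \<infinity> \<and>
     (if \<kappa> = 0
      then (\<Sum>\<^sub>\<infinity>i\<in>J \<eta>. ennreal ((t i)\<^sup>2)) \<ge> 1 + (\<Sum>\<^sub>\<infinity>i\<in>J \<eta>. ennreal ((t i)\<^sup>2) * inv_moment (\<tau> i) 1)
      else (\<Sum>\<^sub>\<infinity>i\<in>J \<eta>. ennreal ((t i)\<^sup>2)) = 1 + (\<Sum>\<^sub>\<infinity>i\<in>J \<eta>. ennreal ((t i)\<^sup>2) * inv_moment (\<tau> i) 1)) \<and>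
     (\<Sum>\<^sub>\<infinity>i\<in>J \<eta>. ennreal ((t i)\<^sup>2)) > (\<Sum>\<^sub>\<infinity>i\<in>J \<eta>. ennreal ((t i)\<^sup>2) * inv_moment (\<tau> i) (\<kappa> + 1))}"

definition V_set :: "enat \<Rightarrow> nat \<Rightarrow> (nat \<Rightarrow> real measure) \<Rightarrow> vertex operator set" where
  "V_set \<eta> \<kappa> \<tau> = {A.
     (\<exists>lam. positive_weights \<eta> \<kappa> lam \<and> A = weighted_shift_real \<eta> \<kappa> lam) \<and>
     completely_hyperexpansive (tree_vertices \<eta> \<kappa>) A \<and>
     (\<forall>i\<in>J \<eta>. vertex_measure (tree_vertices \<eta> \<kappa>) A (Branch i 1) = \<tau> i)}"

definition W_set :: "enat \<Rightarrow> nat \<Rightarrow> (nat \<Rightarrow> real measure) \<Rightarrow> vertex operator set" where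
  "W_set \<eta> \<kappa> \<tau> = {A \<in> V_set \<eta> \<kappa> \<tau>. extremal \<eta> \<kappa> A}"

(* Used for t in U_set \<eta> \<kappa> \<tau> and 1 \<le> k \<le> \<kappa> + 1; there inv_moment (\<tau> i) k is finite, so that
   enn2real does not truncate. *)
definition zeta :: "enat \<Rightarrow> (nat \<Rightarrow> real measure) \<Rightarrow> (nat \<Rightarrow> real) \<Rightarrow> nat \<Rightarrow> real" where
  "zeta \<eta> \<tau> t k = (\<Sum>\<^sub>\<infinity>i\<in>J \<eta>. (t i)\<^sup>2 * (1 - enn2real (inv_moment (\<tau> i) k)))"

definition branch_weight :: "(nat \<Rightarrow> real measure) \<Rightarrow> (nat \<Rightarrow> real) \<Rightarrow> nat \<Rightarrow> nat \<Rightarrow> real" where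
  "branch_weight \<tau> t i j =
     (if j = 1 then t i
      else if j = 2 then sqrt (1 + measure (\<tau> i) {0..1})
      else sqrt ((1 + (\<integral>s. (\<Sum>l=0..j-2. s ^ l) \<partial>\<tau> i)) / (1 + (\<integral>s. (\<Sum>l=0..j-3. s ^ l) \<partial>\<tau> i))))"

definition trunk_weight :: "enat \<Rightarrow> (nat \<Rightarrow> real measure) \<Rightarrow> (nat \<Rightarrow> real) \<Rightarrow> nat \<Rightarrow> real" where
  "trunk_weight \<eta> \<tau> t k =
     (if k = 0 then 1 / sqrt (zeta \<eta> \<tau> t 2)
      else sqrt (zeta \<eta> \<tau> t (k + 1) / zeta \<eta> \<tau> t (k + 2)))"

(* For \<kappa> = 0 no trunk vertex is a non-root vertex, so the trunk clause plays no role. *)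
definition Phi_weights ::
  "enat \<Rightarrow> (nat \<Rightarrow> real measure) \<Rightarrow> (nat \<Rightarrow> real) \<Rightarrow> vertex \<Rightarrow> real" where
  "Phi_weights \<eta> \<tau> t v =
     (case v of Branch i j \<Rightarrow> branch_weight \<tau> t i j | Trunk m \<Rightarrow> trunk_weight \<eta> \<tau> t (nat (- m)))"

definition Phi ::
  "enat \<Rightarrow> nat \<Rightarrow> (nat \<Rightarrow> real measure) \<Rightarrow> (nat \<Rightarrow> real) \<Rightarrow> vertex operator" where
  "Phi \<eta> \<kappa> \<tau> t = weighted_shift_real \<eta> \<kappa> (Phi_weights \<eta> \<tau> t)"

end

theory Submission
  imports Defs "HOL-Probability.Probability"
begin

text \<open>
  A completely alternating sequence is recovered from its representing measure, and conversely the
  solution of the Hausdorff moment problem for its first differences supplies that measure. If \<open>\<tau>\<close>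
  represents \<open>b\<close> and \<open>\<sigma>\<close> represents the sequence \<open>c, b 0, b 1, ...\<close>, then \<open>d\<tau> = s d\<sigma>\<close>; comparing masses,
  the longer sequence is completely alternating iff \<open>\<integral> 1/s d\<tau> + c \<le> b 0\<close>, with equality iff \<open>\<sigma>\<close> has
  no atom at \<open>0\<close>. A further term can only be put in front if \<open>\<integral> 1/s d\<sigma>\<close> is finite, which excludes the atom.
  Hence prepending \<open>\<kappa> + 1\<close> terms gives \<open>\<kappa>\<close> equations and one final inequality in the integrals of
  \<open>1/s + ... + 1/s^j\<close>.

  A weighted shift on the tree is completely hyperexpansive iff it is bounded and the sequence
  \<open>\<parallel>S^n e_u\<parallel>^2\<close> is completely alternating at every vertex \<open>u\<close>. On the branches this says that the weights are given
  by the measures \<open>\<tau>_i\<close>. At the vertex \<open>-\<kappa>\<close> the sequence is, up to a factor, obtained by prepending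
  the reciprocals of the squared products of trunk weights to \<open>b n = \<Sum>i. t_i^2 (1 + \<integral> (1 + ... + s^(n-1)) d\<tau>_i)\<close>,
  which is represented by \<open>\<Sum>i. t_i^2 \<tau>_i\<close>. The \<open>\<kappa>\<close> equations determine all trunk weights except the one
  next to the root, and the inequality is its lower bound, attained exactly by the extremal shifts.
\<close>

section \<open>Completely alternating sequences and moments\<close>

text \<open>Images of different basis vectors under S^n have disjoint supports, so the squared norm
  of S^n f is the sum of |f u|^2 times that of S^n e_u; complete alternation survives such sums, and
  testing basis vectors is enough. It also passes to tails and positive multiples, so on the trunk
  only the root has to be tested. The terms put in front of b at the root are c_j, the reciprocal of
  the product of the squared weights at -l over l < j, and the j-th equation says c_j =
  \<zeta>_(j+1). Since c_0 = 1, this yields \<zeta>_1 = 1, the equation in \<open>U_set\<close>;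
  quotients of consecutive equations yield the weights; and 0 < c_\<kappa> \<le>
  \<zeta>_(\<kappa>+1) yields both the strict inequality in \<open>U_set\<close> and the bound next
  to the root. Two obstacles shape the details. Integrals of 1/s^j and sums over infinitely many
  branches may diverge, so the criteria live in \<open>ennreal\<close> and become identities for
  \<open>zeta\<close> only once finiteness is known. Competitors in \<open>extremal\<close> have
  complex weights, so the criterion is proved for moduli of complex weights and then specialised to
  positive ones.\<close>

fun backdiff :: "nat \<Rightarrow> (nat \<Rightarrow> real) \<Rightarrow> nat \<Rightarrow> real" where
  "backdiff 0 a m = a m"
| "backdiff (Suc n) a m = backdiff n a m - backdiff n a (Suc m)"

text \<open>Pascal's rule. The recursive form turns later facts about these differences into
  inductions on the order.\<close>

lemma alternating_sum_eq_backdiff: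
  "(\<Sum>j=0..n. (-1) ^ j * real (n choose j) * a (m + j)) = backdiff n a m"
proof (induction n arbitrary: m)
  case 0
  show ?case by simp
next
  case (Suc n)
  have "(\<Sum>j=0..Suc n. (-1) ^ j * real (Suc n choose j) * a (m + j)) =
     a m + (\<Sum>j=0..n. (-1) ^ Suc j * real (Suc n choose Suc j) * a (m + Suc j))"
    by (subst sum.atLeast0_atMost_Suc_shift) simp
  also have "\<dots> = a m + (\<Sum>j=0..n. (-1) ^ Suc j * real (n choose Suc j) * a (m + Suc j))
     + (\<Sum>j=0..n. (-1) ^ Suc j * real (n choose j) * a (m + Suc j))"
    by (simp add: algebra_simps sum.distrib sum_subtractf sum_negf)
  also have "a m + (\<Sum>j=0..n. (-1) ^ Suc j * real (n choose Suc j) * a (m + Suc j)) =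
     (\<Sum>j=0..Suc n. (-1) ^ j * real (n choose j) * a (m + j))"
    by (subst sum.atLeast0_atMost_Suc_shift) simp
  also have "\<dots> = (\<Sum>j=0..n. (-1) ^ j * real (n choose j) * a (m + j))"
    by simp
  also have "(\<Sum>j=0..n. (-1) ^ Suc j * real (n choose j) * a (m + Suc j)) =
     - (\<Sum>j=0..n. (-1) ^ j * real (n choose j) * a (Suc m + j))"
    by (simp add: sum_negf)
  finally show ?case
    using Suc.IH[of m] Suc.IH[of "Suc m"] by simp
qed

lemma backdiff_difference: "backdiff (Suc n) a m = - backdiff n (\<lambda>k. a (Suc k) - a k) m"
  by (induction n arbitrary: m) auto

lemma completely_alternating_iff_backdiff:
  "completely_alternating a \<longleftrightarrow> (\<forall>n m. backdiff (Suc n) a m \<le> 0)"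
  unfolding completely_alternating_def alternating_sum_eq_backdiff
  by (metis One_nat_def Suc_le_D le_add1 plus_1_eq_Suc)

text \<open>The order drops by one and the sign flips: the increments satisfy exactly the hypothesis
  of the Hausdorff moment problem.\<close>

lemma completely_alternating_iff_difference:
  "completely_alternating a \<longleftrightarrow> (\<forall>n m. 0 \<le> backdiff n (\<lambda>k. a (Suc k) - a k) m)"
  by (simp only: completely_alternating_iff_backdiff backdiff_difference neg_le_0_iff_le)

text \<open>The moment form of \<open>(\<Sum>k\<le>n. (n choose k) x^k (1 - x)^(n - k)) = 1\<close>.\<close>

lemma sum_binomial_backdiff: "(\<Sum>k\<le>n. real (n choose k) * backdiff (n - k) b (j + k)) = b j"
proof (induction n arbitrary: j)
  case 0
  show ?case by simp
next
  case (Suc n)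
  let ?g = "\<lambda>n k. backdiff (n - k) b (j + k)"
  have "(\<Sum>k\<le>Suc n. real (Suc n choose k) * ?g (Suc n) k) =
      ?g (Suc n) 0 + (\<Sum>k\<le>n. real (Suc n choose Suc k) * ?g (Suc n) (Suc k))"
    by (subst sum.atMost_Suc_shift) simp
  also have "\<dots> = ?g (Suc n) 0 + (\<Sum>k\<le>n. real (n choose Suc k) * ?g (Suc n) (Suc k))
      + (\<Sum>k\<le>n. real (n choose k) * ?g (Suc n) (Suc k))"
    by (simp add: algebra_simps sum.distrib)
  also have "?g (Suc n) 0 + (\<Sum>k\<le>n. real (n choose Suc k) * ?g (Suc n) (Suc k)) =
      (\<Sum>k\<le>Suc n. real (n choose k) * ?g (Suc n) k)"
    by (subst sum.atMost_Suc_shift) simp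
  also have "\<dots> = (\<Sum>k\<le>n. real (n choose k) * ?g (Suc n) k)"
    by simp
  also have "\<dots> + (\<Sum>k\<le>n. real (n choose k) * ?g (Suc n) (Suc k)) =
      (\<Sum>k\<le>n. real (n choose k) * ?g n k)"
    unfolding sum.distrib[symmetric]
    by (intro sum.cong refl) (simp add: Suc_diff_le flip: distrib_left)
  finally show ?case
    using Suc.IH[of j] by simp
qed

text \<open>Since \<open>(n choose k) * (k choose j) = (n choose j) * ((n - j) choose (k -
  j))\<close>, the sum reduces to the preceding identity for n - j. The masses
  \<open>(n choose k) * backdiff (n - k) b k\<close> thus have exact moments when k^j / n^j is
  replaced by a ratio of binomials.\<close>

lemma sum_binomial_moment:
  assumes "j \<le> n"
  shows "(\<Sum>k\<le>n. real (k choose j) / real (n choose j) * (real (n choose k) * backdiff (n - k) b k)) = b j"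
proof -
  have pos: "real (n choose j) > 0" using assms by simp
  have "(\<Sum>k\<le>n. real (k choose j) / real (n choose j) * (real (n choose k) * backdiff (n - k) b k)) =
     (\<Sum>k=j..n. real (k choose j) / real (n choose j) * (real (n choose k) * backdiff (n - k) b k))"
    by (rule sum.mono_neutral_right) (auto simp: not_le)
  also have "\<dots> = (\<Sum>k=j..n. real ((n - j) choose (k - j)) * backdiff (n - k) b k)"
  proof (rule sum.cong[OF refl])
    fix k assume k: "k \<in> {j..n}"
    have "(n choose k) * (k choose j) = (n choose j) * ((n - j) choose (k - j))"
      using k by (intro choose_mult) auto
    hence "real (n choose k) * real (k choose j) = real (n choose j) * real ((n - j) choose (k - j))"
      by (metis of_nat_mult)
    thus "real (k choose j) / real (n choose j) * (real (n choose k) * backdiff (n - k) b k) =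
       real ((n - j) choose (k - j)) * backdiff (n - k) b k"
      using pos by (simp add: field_simps)
  qed
  also have "\<dots> = (\<Sum>k\<le>n - j. real ((n - j) choose k) * backdiff (n - j - k) b (j + k))"
    by (rule sum.reindex_bij_witness[where i="\<lambda>k. j + k" and j="\<lambda>k. k - j"]) (use assms in auto)
  also have "\<dots> = b j" by (rule sum_binomial_backdiff)
  finally show ?thesis .
qed

text \<open>Both terms are products of j factors of modulus at most 1, so they differ by at most the
  sum of the differences of the factors. The condition \<open>2 * j < n\<close> keeps n - i positive
  and gives |k - i| \<le> n - i even when k < i.\<close>

lemma binomial_ratio_approx:
  assumes "2 * j < n" "k \<le> n"
  shows "\<bar>(real k / real n) ^ j - real (k choose j) / real (n choose j)\<bar> \<le> real j * (real j / (real n - real j))"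
proof -
  have eq: "real (k choose j) / real (n choose j) = (\<Prod>i<j. (real k - real i) / (real n - real i))"
  proof -
    have "real (k choose j) = (\<Prod>i<j. real k - real i) / fact j" for k
      by (metis atLeast0LessThan binomial_gbinomial gbinomial_prod_rev)
    moreover have "(\<Prod>i<j. real n - real i) \<noteq> 0"
      using assms by auto
    ultimately show ?thesis by (simp add: prod_dividef)
  qed
  have b: "\<bar>real k / real n - (real k - real i) / (real n - real i)\<bar> \<le> real j / (real n - real j)"
    and c: "\<bar>(real k - real i) / (real n - real i)\<bar> \<le> 1" if "i < j" for i
  proof -
    have p: "real n - real i > 0" "real n - real j > 0" "real n > 0" using that assms by auto
    have "real k / real n - (real k - real i) / (real n - real i) = real i * (real n - real k) / (real n * (real n - real i))"
      using p by (simp add: field_simps)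
    hence "\<bar>real k / real n - (real k - real i) / (real n - real i)\<bar> = real i * (real n - real k) / (real n * (real n - real i))"
      using p assms by simp
    also have "\<dots> = real i / (real n - real i) * ((real n - real k) / real n)" by simp
    also have "\<dots> \<le> real j / (real n - real j) * 1"
      using p assms that by (intro mult_mono frac_le) auto
    finally show "\<bar>real k / real n - (real k - real i) / (real n - real i)\<bar> \<le> real j / (real n - real j)" by simp
    have "\<bar>real k - real i\<bar> \<le> real n - real i" using assms that by (auto simp: abs_le_iff)
    thus "\<bar>(real k - real i) / (real n - real i)\<bar> \<le> 1" using p by (simp add: abs_divide)
  qed
  have "\<bar>(\<Prod>i<j. real k / real n) - (\<Prod>i<j. (real k - real i) / (real n - real i))\<bar> \<le>
      (\<Sum>i<j. \<bar>real k / real n - (real k - real i) / (real n - real i)\<bar>)"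
    using norm_prod_diff[of "{..<j}" "\<lambda>_. real k / real n" "\<lambda>i. (real k - real i) / (real n - real i)"] c assms
    by (simp add: divide_le_eq_1)
  also have "\<dots> \<le> (\<Sum>i<j. real j / (real n - real j))"
    using b by (intro sum_mono) auto
  finally show ?thesis using eq by simp
qed

text \<open>The retraction of the line onto the unit interval. It makes powers bounded and
  continuous on the whole line, as weak convergence demands, and carries the limit law to the unit
  interval without a study of its support.\<close>

definition clamp_unit :: "real \<Rightarrow> real" where
  "clamp_unit x = max 0 (min 1 x)"

lemma continuous_clamp_unit [continuous_intros]: "continuous_on A clamp_unit"
  unfolding clamp_unit_def by (intro continuous_intros)

lemma clamp_unit_measurable [measurable]: "clamp_unit \<in> borel \<rightarrow>\<^sub>M restrict_space borel {0..1}"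
  by (intro measurable_restrict_space2 borel_measurable_continuous_onI continuous_clamp_unit)
     (auto simp: clamp_unit_def)

text \<open>The law with mass \<open>w n k\<close> at k/n has j-th moments tending to
  \<open>b j / b 0\<close>. By tightness a subsequence converges weakly; the push-forward of its
  limit under \<open>clamp_unit\<close>, scaled by \<open>b 0\<close>, has the required
  moments.\<close>

theorem hausdorff_moment:
  assumes nonneg: "\<And>n m. 0 \<le> backdiff n b m"
  shows "\<exists>M. borel_measure_on_unit M \<and> finite_measure M \<and> (\<forall>n. b n = (\<integral>s. s ^ n \<partial>M))"
proof (cases "b 0 = 0")
  case True
  \<comment> \<open>Normalising by \<open>b 0\<close> is impossible here, but a nonnegative
    decreasing sequence starting at 0 vanishes and the zero measure serves.\<close>
  have "b (Suc n) \<le> b n" "0 \<le> b n" for n using nonneg[of 1 n] nonneg[of 0 n] by auto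
  hence "b n = 0" for n
    by (induction n) (use True in \<open>simp, metis order_antisym\<close>)
  thus ?thesis
    by (intro exI[of _ "null_measure (restrict_space borel {0..1})"])
       (auto simp: borel_measure_on_unit_def intro!: finite_measureI)
next
  case False
  hence b0: "b 0 > 0" using nonneg[of 0 0] by simp
  \<comment> \<open>Up to normalisation this is the integral of (n choose k) s^k (1 - s)^(n - k)
    against the measure sought, written without that measure.\<close>
  define w where "w n k = (if k \<le> n then real (n choose k) * backdiff (n - k) b k / b 0 else 0)" for n k
  have w_nonneg: "w n k \<ge> 0" for n k using nonneg b0 by (simp add: w_def)
  have w_sum: "(\<Sum>k\<le>n. w n k) = 1" for n
    using sum_binomial_backdiff[of n b 0] b0 by (simp add: w_def flip: sum_divide_distrib)
  define p where "p n = embed_pmf (w n)" for n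
  have pmf_p: "pmf (p n) k = w n k" for n k
    unfolding p_def
  proof (rule pmf_embed_pmf)
    have "(\<integral>\<^sup>+ x. ennreal (w n x) \<partial>count_space UNIV) = (\<Sum>k\<le>n. ennreal (w n k))"
      by (rule nn_integral_count_space'[of "{..n}"]) (auto simp: w_def)
    also have "\<dots> = 1" by (simp add: sum_ennreal w_nonneg w_sum)
    finally show "(\<integral>\<^sup>+ x. ennreal (w n x) \<partial>count_space UNIV) = 1" .
  qed (rule w_nonneg)
  have set_p: "set_pmf (p n) \<subseteq> {..n}" for n
    by (auto simp: set_pmf_iff pmf_p w_def split: if_splits)
  define \<mu> where "\<mu> n = distr (measure_pmf (p n)) borel (\<lambda>k. real k / real n)" for n
  have rd: "real_distribution (\<mu> n)" for n
    unfolding \<mu>_def real_distribution_def real_distribution_axioms_def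
    by (auto intro!: measure_pmf.prob_space_distr)
  have int_\<mu>: "(\<integral>x. f x \<partial>\<mu> n) = (\<Sum>k\<le>n. f (real k / real n) * w n k)"
    if "f \<in> borel_measurable borel" for f :: "real \<Rightarrow> real" and n
  proof -
    have "(\<integral>x. f x \<partial>\<mu> n) = measure_pmf.expectation (p n) (\<lambda>k. f (real k / real n))"
      unfolding \<mu>_def using that by (subst integral_distr) auto
    also have "\<dots> = (\<Sum>k\<le>n. f (real k / real n) * pmf (p n) k)"
      using set_p[of n] by (intro integral_measure_pmf_real) auto
    finally show ?thesis by (simp add: pmf_p)
  qed
  have "tight \<mu>"
    unfolding tight_def
  proof (intro conjI allI impI rd)
    fix e :: real assume "e > 0"
    show "\<exists>a b. a < b \<and> (\<forall>n. measure (\<mu> n) {a<..b} > 1 - e)"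
    \<comment> \<open>All laws live on points of [0,1]; the left end -1 keeps the point 0 inside the
      half-open interval.\<close>
    proof (rule exI[of _ "-1"], rule exI[of _ 1], intro conjI allI)
      fix n
      interpret real_distribution "\<mu> n" by (rule rd)
      have "measure (\<mu> n) {-1<..1} = (\<integral>x. indicator {-1<..1} x \<partial>\<mu> n)" by simp
      also have "\<dots> = (\<Sum>k\<le>n. indicator {-1<..1} (real k / real n) * w n k)"
        by (rule int_\<mu>) simp
      also have "\<dots> = (\<Sum>k\<le>n. w n k)"
      proof (intro sum.cong refl)
        fix k assume "k \<in> {..n}"
        hence "real k / real n \<in> {-1<..1}"
          by (auto simp: divide_le_eq_1 intro: less_le_trans[of "-1" 0])
        thus "indicator {-1<..1} (real k / real n) * w n k = w n k" by simp
      qed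
      finally show "measure (\<mu> n) {-1<..1} > 1 - e" using w_sum \<open>e > 0\<close> by simp
    qed simp
  qed
  from tight_imp_convergent_subsubsequence[OF this strict_mono_id]
  obtain r M where r: "strict_mono r" and M: "real_distribution M" and conv: "weak_conv_m (\<mu> \<circ> id \<circ> r) M"
    by blast
  interpret M: real_distribution M by (rule M)
  have moment: "(\<integral>x. clamp_unit x ^ j \<partial>M) = b j / b 0" for j
  proof -
    have "(\<lambda>n. integral\<^sup>L ((\<mu> \<circ> id \<circ> r) n) (\<lambda>x. clamp_unit x ^ j)) \<longlonglongrightarrow> (\<integral>x. clamp_unit x ^ j \<partial>M)"
    proof (rule weak_conv_imp_integral_bdd_continuous_conv[OF _ M conv, where B=1])
      show "real_distribution ((\<mu> \<circ> id \<circ> r) n)" for n by (simp add: rd)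
      show "isCont (\<lambda>x. clamp_unit x ^ j) x" for x
        by (intro continuous_on_interior[of UNIV]) (auto intro!: continuous_intros)
      show "norm (clamp_unit x ^ j) \<le> 1" for x
        by (auto simp: clamp_unit_def intro!: power_le_one)
    qed
    moreover have "(\<lambda>n. integral\<^sup>L (\<mu> n) (\<lambda>x. clamp_unit x ^ j)) \<longlonglongrightarrow> b j / b 0"
    proof (rule Lim_transform_eventually[OF _ eventually_mono[OF eventually_gt_at_top]])
      show "(\<lambda>n. (\<Sum>k\<le>n. (real k / real n) ^ j * w n k)) \<longlonglongrightarrow> b j / b 0"
      proof (rule LIM_zero_cancel, rule Lim_null_comparison)
        \<comment> \<open>The error of replacing (k/n)^j by the ratio of binomials is uniform in k,
          and the weights sum to 1.\<close>
        show "\<forall>\<^sub>F n in sequentially. norm ((\<Sum>k\<le>n. (real k / real n) ^ j * w n k) - b j / b 0) \<le> real j * (real j / (real n - real j))"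
          using eventually_gt_at_top[of "2 * j"]
        proof eventually_elim
          case (elim n)
          have "b j / b 0 = (\<Sum>k\<le>n. real (k choose j) / real (n choose j) * w n k)"
            using sum_binomial_moment[of j n b, symmetric] elim by (simp add: w_def flip: sum_divide_distrib)
          hence "norm ((\<Sum>k\<le>n. (real k / real n) ^ j * w n k) - b j / b 0) =
             \<bar>\<Sum>k\<le>n. ((real k / real n) ^ j - real (k choose j) / real (n choose j)) * w n k\<bar>"
            by (simp add: sum_subtractf left_diff_distrib)
          also have "\<dots> \<le> (\<Sum>k\<le>n. (real j * (real j / (real n - real j))) * w n k)"
            using binomial_ratio_approx[of j n] elim w_nonneg[of n]
            by (intro order.trans[OF sum_abs] sum_mono)
               (simp only: abs_mult abs_of_nonneg mult_right_mono atMost_iff)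
          also have "\<dots> = real j * (real j / (real n - real j))"
            by (simp only: w_sum mult_1_right flip: sum_distrib_left)
          finally show ?case .
        qed
        show "(\<lambda>n. real j * (real j / (real n - real j))) \<longlonglongrightarrow> 0"
          by real_asymp
      qed
      show "(\<Sum>k\<le>n. (real k / real n) ^ j * w n k) = integral\<^sup>L (\<mu> n) (\<lambda>x. clamp_unit x ^ j)"
        if "n > 0" for n
        using that by (subst int_\<mu>)
          (auto intro!: sum.cong borel_measurable_continuous_onI continuous_intros
                simp: clamp_unit_def min_def max_def divide_le_eq_1)
    qed
    hence "(\<lambda>n. integral\<^sup>L ((\<mu> \<circ> id \<circ> r) n) (\<lambda>x. clamp_unit x ^ j)) \<longlonglongrightarrow> b j / b 0"
      using LIMSEQ_subseq_LIMSEQ[OF _ r] by (fastforce simp: o_def)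
    ultimately show ?thesis by (rule LIMSEQ_unique)
  qed
  let ?N = "density (distr M (restrict_space borel {0..1}) clamp_unit) (\<lambda>_. ennreal (b 0))"
  have cm [measurable]: "clamp_unit \<in> M \<rightarrow>\<^sub>M restrict_space borel {0..1}" by simp
  have "prob_space (distr M (restrict_space borel {0..1}) clamp_unit)"
    by (rule M.prob_space_distr) simp
  then interpret D: prob_space "distr M (restrict_space borel {0..1}) clamp_unit" .
  have pm [measurable]: "(\<lambda>s. s ^ n) \<in> borel_measurable (restrict_space borel {0..1::real})" for n
    by (rule measurable_restrict_space1) simp
  show ?thesis
  proof (intro exI[of _ ?N] conjI allI)
    show "borel_measure_on_unit ?N" by (simp add: borel_measure_on_unit_def)
    show "finite_measure ?N"
      by (rule finite_measureI)
         (simp only: space_density emeasure_density_const[OF sets.top] D.emeasure_space_1, simp)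
    fix n
    have "(\<integral>s. s ^ n \<partial>?N) = b 0 * (\<integral>x. clamp_unit x ^ n \<partial>M)"
      using b0 by (subst integral_real_density) (auto simp: integral_distr)
    thus "b n = (\<integral>s. s ^ n \<partial>?N)" using moment b0 by simp
  qed
qed

section \<open>Finite measures on the unit interval are determined by their moments\<close>

lemma space_unit_measure: "borel_measure_on_unit M \<Longrightarrow> space M = {0..1}"
  using sets_eq_imp_space_eq[of M "restrict_space borel {0..1}"]
  by (simp add: borel_measure_on_unit_def space_restrict_space)

lemma borel_measurable_unit_measure:
  assumes "borel_measure_on_unit M" "f \<in> measurable borel N"
  shows "f \<in> measurable M N"
  using measurable_restrict_space1[OF assms(2), of "{0..1}"] assms(1)
  by (simp add: borel_measure_on_unit_def cong: measurable_cong_sets)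

lemma integrable_unit_measure:
  fixes f :: "real \<Rightarrow> real"
  assumes "borel_measure_on_unit M" "finite_measure M" "f \<in> borel_measurable borel"
    and "\<And>s. s \<in> {0..1} \<Longrightarrow> \<bar>f s\<bar> \<le> B"
  shows "integrable M f"
  using assms by (intro finite_measure.integrable_const_bound[where B=B] AE_I2)
    (auto simp: space_unit_measure borel_measurable_unit_measure)

lemma integrable_power_unit_measure:
  assumes "borel_measure_on_unit M" "finite_measure M"
  shows "integrable M (\<lambda>s. s ^ n)"
  using assms by (intro integrable_unit_measure[where B=1]) (auto simp: power_le_one)

text \<open>Weierstrass: a polynomial uniformly within e of f has equal integrals, so the integrals
  of f differ by at most e times the sum of the two masses.\<close>

lemma integral_continuous_eq_if_moments_eq:
  fixes f :: "real \<Rightarrow> real"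
  assumes M: "borel_measure_on_unit M" "finite_measure M"
    and N: "borel_measure_on_unit N" "finite_measure N"
    and eq: "\<And>n. (\<integral>s. s ^ n \<partial>M) = (\<integral>s. s ^ n \<partial>N)"
    and f: "continuous_on UNIV f"
  shows "(\<integral>s. f s \<partial>M) = (\<integral>s. f s \<partial>N)"
proof -
  have fm: "f \<in> borel_measurable borel" using f by (rule borel_measurable_continuous_onI)
  have f': "continuous_on {0..1} f" using f by (rule continuous_on_subset) simp
  have "compact (f ` {0..1})" using f' by (intro compact_continuous_image) auto
  then obtain B where B: "\<And>s. s \<in> {0..1} \<Longrightarrow> \<bar>f s\<bar> \<le> B"
    by (auto dest!: compact_imp_bounded simp: bounded_iff) (metis atLeastAtMost_iff)
  have close: "\<bar>(\<integral>s. f s \<partial>M) - (\<integral>s. f s \<partial>N)\<bar> \<le> e * (measure M {0..1} + measure N {0..1})"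
    if "e > 0" for e
  proof -
    obtain g where "real_polynomial_function g" and g: "\<And>x. x \<in> {0..1} \<Longrightarrow> \<bar>f x - g x\<bar> < e"
      using Stone_Weierstrass_real_polynomial_function[OF compact_Icc f' \<open>e > 0\<close>] by blast
    then obtain a n where ga: "g = (\<lambda>x. \<Sum>i\<le>n. a i * x ^ i)"
      unfolding real_polynomial_function_iff_sum by blast
    have gm: "g \<in> borel_measurable borel" unfolding ga by measurable
    have g_int: "(\<integral>s. g s \<partial>K) = (\<Sum>i\<le>n. a i * (\<integral>s. s ^ i \<partial>K))" and g_i: "integrable K g"
      if "borel_measure_on_unit K" "finite_measure K" for K
      unfolding ga by (simp_all add: integrable_power_unit_measure[OF that])
    have bound: "\<bar>(\<integral>s. f s \<partial>K) - (\<integral>s. g s \<partial>K)\<bar> \<le> e * measure K {0..1}"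
      if K: "borel_measure_on_unit K" "finite_measure K" for K
    proof -
      have f_i: "integrable K f" using K fm B by (rule integrable_unit_measure)
      have "\<bar>(\<integral>s. f s \<partial>K) - (\<integral>s. g s \<partial>K)\<bar> = \<bar>\<integral>s. f s - g s \<partial>K\<bar>"
        using f_i g_i[OF K] by simp
      also have "\<dots> \<le> (\<integral>s. \<bar>f s - g s\<bar> \<partial>K)" by (rule integral_abs_bound)
      also have "\<dots> \<le> (\<integral>s. e \<partial>K)"
        using f_i g_i[OF K] g K
        by (intro integral_mono finite_measure.integrable_const)
           (auto simp: space_unit_measure less_imp_le)
      finally show ?thesis by (simp add: space_unit_measure[OF K(1)] mult.commute)
    qed
    have "(\<integral>s. g s \<partial>M) = (\<integral>s. g s \<partial>N)" by (simp add: g_int M N eq)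
    thus ?thesis using bound[OF M] bound[OF N] by (simp add: algebra_simps)
  qed
  let ?c = "measure M {0..1} + measure N {0..1}"
  have "\<bar>(\<integral>s. f s \<partial>M) - (\<integral>s. f s \<partial>N)\<bar> \<le> 0"
  proof (rule field_le_epsilon)
    fix e :: real assume "e > 0"
    have c: "?c \<ge> 0" by simp
    \<comment> \<open>The added 1 avoids dividing by zero when both masses vanish.\<close>
    have "\<bar>(\<integral>s. f s \<partial>M) - (\<integral>s. f s \<partial>N)\<bar> \<le> e / (?c + 1) * ?c"
      using \<open>e > 0\<close> c by (intro close divide_pos_pos) linarith+
    also have "e / (x + 1) * x \<le> e" if "x \<ge> 0" for x
      using \<open>e > 0\<close> that by (simp add: field_simps)
    from this[OF c] have "e / (?c + 1) * ?c \<le> e" .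
    finally show "\<bar>(\<integral>s. f s \<partial>M) - (\<integral>s. f s \<partial>N)\<bar> \<le> 0 + e" by simp
  qed
  thus ?thesis by simp
qed

text \<open>Integrals of continuous functions determine the distribution function by dominated
  convergence. Pushing both measures forward to \<open>borel\<close> makes the uniqueness theorem
  for distribution functions applicable.\<close>

theorem unit_measure_eqI_moments:
  assumes M: "borel_measure_on_unit M" "finite_measure M"
    and N: "borel_measure_on_unit N" "finite_measure N"
    and eq: "\<And>n. (\<integral>s. s ^ n \<partial>M) = (\<integral>s. s ^ n \<partial>N)"
  shows "M = N"
proof -
  \<comment> \<open>Equal to 1 up to x, then falling to 0 with slope -n: continuous functions
    tending to the indicator of {..x}.\<close>
  define g where "g x n s = max 0 (min 1 (1 - real n * (s - x)))" for x :: real and n :: nat and s :: real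
  have g_cont: "continuous_on UNIV (g x n)" for x n
    unfolding g_def by (intro continuous_intros)
  have g_lim: "(\<lambda>n. g x n s) \<longlonglongrightarrow> indicator {..x} s" for x s
  proof (cases "s \<le> x")
    case True
    hence "real n * (s - x) \<le> 0" for n by (simp add: mult_nonneg_nonpos)
    hence "g x n s = 1" for n by (simp add: g_def)
    thus ?thesis using True by simp
  next
    case False
    obtain m :: nat where m: "real m > 1 / (s - x)" using reals_Archimedean2 by blast
    have "g x n s = 0" if "n \<ge> m" for n
    proof -
      have "1 < real m * (s - x)" using m False by (simp add: field_simps)
      also have "\<dots> \<le> real n * (s - x)" using that False by (intro mult_right_mono) auto
      finally show ?thesis by (simp add: g_def)
    qed
    thus ?thesis using False by (auto intro!: tendsto_eventually eventually_sequentiallyI)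
  qed
  have lim: "(\<lambda>n. \<integral>s. g x n s \<partial>K) \<longlonglongrightarrow> measure K ({..x} \<inter> {0..1})"
    if K: "borel_measure_on_unit K" "finite_measure K" for K x
  proof -
    have "(\<lambda>n. \<integral>s. g x n s \<partial>K) \<longlonglongrightarrow> (\<integral>s. indicator {..x} s \<partial>K)"
    proof (rule integral_dominated_convergence[where w="\<lambda>_. 1"])
      show "integrable K (\<lambda>_. 1 :: real)" using K(2) by (rule finite_measure.integrable_const)
      show "g x n \<in> borel_measurable K" for n
        using K(1) borel_measurable_continuous_onI[OF g_cont] by (rule borel_measurable_unit_measure)
      show "indicator {..x} \<in> borel_measurable K"
        using K(1) by (rule borel_measurable_unit_measure) simp
      show "AE s in K. (\<lambda>n. g x n s) \<longlonglongrightarrow> indicator {..x} s" by (simp add: g_lim)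
      show "AE s in K. norm (g x n s) \<le> 1" for n by (simp add: g_def)
    qed
    moreover have "(\<integral>s. indicator {..x} s \<partial>K) = measure K ({..x} \<inter> {0..1})"
      by (simp add: space_unit_measure[OF K(1)])
    ultimately show ?thesis by simp
  qed
  have cdf: "measure M ({..x} \<inter> {0..1}) = measure N ({..x} \<inter> {0..1})" for x
    using lim[OF M] lim[OF N] integral_continuous_eq_if_moments_eq[OF M N eq g_cont]
    by (intro LIMSEQ_unique[where X="\<lambda>n. \<integral>s. g x n s \<partial>M"]) auto
  have id: "(\<lambda>s. s) \<in> measurable K borel" if "borel_measure_on_unit K" for K
    using that by (rule borel_measurable_unit_measure) simp
  have "distr M borel (\<lambda>s. s) = distr N borel (\<lambda>s. s)"
  proof (rule cdf_unique')
    show "finite_borel_measure (distr M borel (\<lambda>s. s))" "finite_borel_measure (distr N borel (\<lambda>s. s))"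
      using M N id by (auto simp: finite_borel_measure_def finite_borel_measure_axioms_def
          intro!: finite_measure.finite_measure_distr)
    show "cdf (distr M borel (\<lambda>s. s)) = cdf (distr N borel (\<lambda>s. s))"
      using M N id cdf by (auto simp: cdf_def measure_distr space_unit_measure vimage_def Collect_conj_eq
          atMost_def[symmetric] Int_def[symmetric])
  qed
  show "M = N"
  proof (rule measure_eqI)
    show "sets M = sets N" using M N by (simp add: borel_measure_on_unit_def)
    fix A assume A: "A \<in> sets M"
    hence A': "A \<in> sets borel" "A \<subseteq> {0..1}"
      using M by (auto simp: borel_measure_on_unit_def sets_restrict_space)
    have "emeasure K A = emeasure (distr K borel (\<lambda>s. s)) A" if "borel_measure_on_unit K" for K
      using A' id[OF that] by (subst emeasure_distr)
        (auto simp: space_unit_measure[OF that] Int_absorb2)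
    thus "emeasure M A = emeasure N A"
      using M N \<open>distr M borel (\<lambda>s. s) = distr N borel (\<lambda>s. s)\<close> by metis
  qed
qed

text \<open>The geometric sums telescope, so representation by M says that the increments are the
  moments of M. Later arguments mostly use this form.\<close>

lemma is_representing_measure_iff_moments:
  "is_representing_measure a M \<longleftrightarrow>
     borel_measure_on_unit M \<and> finite_measure M \<and> (\<forall>n. a (Suc n) - a n = (\<integral>s. s ^ n \<partial>M))"
proof (cases "borel_measure_on_unit M \<and> finite_measure M")
  case True
  hence int: "(\<integral>s. (\<Sum>l<n. s ^ l) \<partial>M) = (\<Sum>l<n. \<integral>s. s ^ l \<partial>M)" for n
    by (intro Bochner_Integration.integral_sum integrable_power_unit_measure) auto
  have "(\<forall>n\<ge>1. a n = a 0 + (\<Sum>l<n. \<integral>s. s ^ l \<partial>M)) \<longleftrightarrow> (\<forall>n. a (Suc n) - a n = (\<integral>s. s ^ n \<partial>M))"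
    (is "?l \<longleftrightarrow> ?r")
  proof
    assume ?l
    hence "a n = a 0 + (\<Sum>l<n. \<integral>s. s ^ l \<partial>M)" for n by (cases "n = 0") auto
    thus ?r by (metis (no_types) add_diff_cancel_left' add.assoc sum.lessThan_Suc)
  next
    assume ?r
    hence step: "a (Suc n) = a n + (\<integral>s. s ^ n \<partial>M)" for n by (metis diff_add_cancel add.commute)
    have "a n = a 0 + (\<Sum>l<n. \<integral>s. s ^ l \<partial>M)" for n by (induction n) (simp_all add: step)
    thus ?l by blast
  qed
  with True show ?thesis by (simp add: is_representing_measure_def int)
qed (auto simp: is_representing_measure_def)

lemma representing_measure_eqI:
  assumes "is_representing_measure a M"
  shows "representing_measure a = M"
  unfolding representing_measure_def
proof (rule the_equality, rule assms)
  fix N assume "is_representing_measure a N"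
  with assms show "N = M"
    unfolding is_representing_measure_iff_moments by (intro unit_measure_eqI_moments) auto
qed

text \<open>Each difference multiplies the integrand by 1 - s, which makes nonnegativity on the unit
  interval visible.\<close>

lemma backdiff_moments:
  assumes "borel_measure_on_unit M" "finite_measure M" "\<And>n. b n = (\<integral>s. s ^ n \<partial>M)"
  shows "backdiff n b m = (\<integral>s. s ^ m * (1 - s) ^ n \<partial>M)"
proof (induction n arbitrary: m)
  case 0
  show ?case by (simp add: assms(3))
next
  case (Suc n)
  have i: "integrable M (\<lambda>s. s ^ m * (1 - s) ^ n)" for m
    using assms(1,2) by (intro integrable_unit_measure[where B=1])
      (auto simp: abs_mult power_abs intro!: mult_le_one power_le_one)
  have "(\<integral>s. s ^ m * (1 - s) ^ Suc n \<partial>M) = (\<integral>s. s ^ m * (1 - s) ^ n - s ^ Suc m * (1 - s) ^ n \<partial>M)"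
    by (rule arg_cong[where f="integral\<^sup>L M"]) (auto simp: algebra_simps)
  also have "\<dots> = backdiff n b m - backdiff n b (Suc m)"
    by (simp only: Bochner_Integration.integral_diff[OF i i] Suc.IH)
  finally show ?case by simp
qed

theorem completely_alternating_iff_representing_measure:
  "completely_alternating a \<longleftrightarrow> (\<exists>M. is_representing_measure a M)"
proof
  assume "completely_alternating a"
  thus "\<exists>M. is_representing_measure a M"
    unfolding completely_alternating_iff_difference is_representing_measure_iff_moments
    by (intro hausdorff_moment) auto
next
  assume "\<exists>M. is_representing_measure a M"
  then obtain M where M: "borel_measure_on_unit M" "finite_measure M"
      "\<And>n. a (Suc n) - a n = (\<integral>s. s ^ n \<partial>M)"
    by (auto simp: is_representing_measure_iff_moments)
  have "0 \<le> (\<integral>s. s ^ m * (1 - s) ^ n \<partial>M)" for n m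
    by (rule Bochner_Integration.integral_nonneg_AE, rule AE_I2) (simp add: space_unit_measure[OF M(1)])
  thus "completely_alternating a"
    unfolding completely_alternating_iff_difference backdiff_moments[OF M] by blast
qed

lemma is_representing_measure_representing_measure:
  "completely_alternating a \<Longrightarrow> is_representing_measure a (representing_measure a)"
  using completely_alternating_iff_representing_measure representing_measure_eqI by blast

text \<open>From index 1 on, the increments of \<open>case_nat c b\<close> are those of b, so s
  d\<sigma> and \<tau> have the same moments. The density function \<open>ennreal\<close> is s
  itself.\<close>

lemma representing_measure_case_nat:
  assumes \<tau>: "is_representing_measure b \<tau>" and \<sigma>: "is_representing_measure (case_nat c b) \<sigma>"
  shows "\<tau> = density \<sigma> ennreal"
proof -
  have M: "borel_measure_on_unit \<sigma>" "finite_measure \<sigma>" using \<sigma> by (auto simp: is_representing_measure_def)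
  have meas: "ennreal \<in> borel_measurable \<sigma>" using M(1) by (rule borel_measurable_unit_measure) simp
  interpret finite_measure \<sigma> by fact
  have unit: "borel_measure_on_unit (density \<sigma> ennreal)"
    using M by (simp add: borel_measure_on_unit_def)
  have fin: "finite_measure (density \<sigma> ennreal)"
  proof (rule finite_measureI)
    have "emeasure (density \<sigma> ennreal) (space (density \<sigma> ennreal)) = (\<integral>\<^sup>+s. ennreal s \<partial>\<sigma>)"
      using meas by (simp add: emeasure_density cong: nn_integral_cong)
    also have "\<dots> \<le> (\<integral>\<^sup>+s. 1 \<partial>\<sigma>)"
      by (rule nn_integral_mono) (simp add: space_unit_measure[OF M(1)] ennreal_le_1)
    also have "\<dots> < \<infinity>" by (simp add: emeasure_eq_measure)
    finally show "emeasure (density \<sigma> ennreal) (space (density \<sigma> ennreal)) \<noteq> \<infinity>" by simp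
  qed
  have mom: "(\<integral>s. s ^ n \<partial>density \<sigma> ennreal) = (\<integral>s. s ^ Suc n \<partial>\<sigma>)" for n
    by (subst integral_real_density)
       (auto intro!: borel_measurable_unit_measure[OF M(1)] AE_I2 simp: space_unit_measure[OF M(1)])
  have "(\<integral>s. s ^ Suc n \<partial>\<sigma>) = b (Suc n) - b n" for n
    using \<sigma> unfolding is_representing_measure_iff_moments by (auto dest!: spec[of _ "Suc n"])
  thus ?thesis
    using \<tau> mom unit fin unfolding is_representing_measure_iff_moments
    by (intro unit_measure_eqI_moments) auto
qed

text \<open>With the division of \<open>ennreal\<close>, the integrand at s = 0 is infinite for j
  \<ge> 1 but equal to 1 for j = 0, so order 0 gives the total mass.\<close>

definition neg_moment :: "real measure \<Rightarrow> nat \<Rightarrow> ennreal" where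
  "neg_moment M j = (\<integral>\<^sup>+ s. 1 / ennreal s ^ j \<partial>M)"

lemma inv_moment_eq_sum:
  assumes "borel_measure_on_unit M"
  shows "inv_moment M k = (\<Sum>j=1..k. neg_moment M j)"
  unfolding inv_moment_def neg_moment_def
  by (rule nn_integral_sum) (auto intro!: borel_measurable_unit_measure[OF assms])

text \<open>At s = 0 the density 0 meets the value infinity, and their product in
  \<open>ennreal\<close> is 0. An atom of M at 0 is therefore lost, which the indicator
  records.\<close>

lemma neg_moment_density:
  assumes "borel_measure_on_unit M"
  shows "neg_moment (density M ennreal) (Suc j) = (\<integral>\<^sup>+ s. 1 / ennreal s ^ j * indicator {0<..} s \<partial>M)"
  unfolding neg_moment_def
proof (subst nn_integral_density)
  show "(\<integral>\<^sup>+ s. ennreal s * (1 / ennreal s ^ Suc j) \<partial>M) = (\<integral>\<^sup>+ s. 1 / ennreal s ^ j * indicator {0<..} s \<partial>M)"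
  proof (rule nn_integral_cong)
    fix s
    show "ennreal s * (1 / ennreal s ^ Suc j) = 1 / ennreal s ^ j * indicator {0<..} s"
    proof (cases "s > 0")
      case True
      have "1 / ennreal s ^ k = ennreal (1 / s ^ k)" for k
        using True by (simp add: ennreal_power divide_ennreal flip: ennreal_1)
      thus ?thesis using True by (subst \<open>\<And>k. 1 / ennreal s ^ k = ennreal (1 / s ^ k)\<close>)+ (simp flip: ennreal_mult)
    next
      case False
      thus ?thesis by (simp add: ennreal_neg)
    qed
  qed
qed (auto intro!: borel_measurable_unit_measure[OF assms])

section \<open>Backward extensions\<close>

lemma backdiff_add: "backdiff n (\<lambda>k. a k + b k) m = backdiff n a m + backdiff n b m"
  by (induction n arbitrary: m) auto

text \<open>These are the moments of an atom of mass d at 0; the corresponding integrand s^m (1 -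
  s)^n is nonzero at 0 only for m = 0.\<close>

lemma backdiff_single: "backdiff n (\<lambda>k. if k = 0 then d else 0) m = (if m = 0 then d else 0)"
  by (induction n arbitrary: m) auto

lemma backdiff_shift: "backdiff n (\<lambda>k. a (Suc k)) m = backdiff n a (Suc m)"
  by (induction n arbitrary: m) auto

lemma completely_alternating_tail:
  "completely_alternating (case_nat c b) \<Longrightarrow> completely_alternating b"
  using backdiff_shift[of _ "case_nat c b"] by (simp add: completely_alternating_iff_backdiff)

text \<open>By \<open>neg_moment_density\<close> with j = 0, the first summand is the mass of
  \<sigma> on (0,1]; the total mass of \<sigma> is the first increment
  \<open>b 0 - c\<close>.\<close>

lemma representing_measure_case_nat_mass:
  assumes \<tau>: "is_representing_measure b \<tau>" and \<sigma>: "is_representing_measure (case_nat c b) \<sigma>" and "0 \<le> c"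
  shows "neg_moment \<tau> 1 + emeasure \<sigma> {0} + ennreal c = ennreal (b 0)"
proof -
  have M: "borel_measure_on_unit \<sigma>" "finite_measure \<sigma>" using \<sigma> by (auto simp: is_representing_measure_def)
  interpret finite_measure \<sigma> by fact
  have sets: "{0<..} \<inter> {0..1} \<in> sets \<sigma>" "{0} \<in> sets \<sigma>"
    using M(1) by (auto simp: borel_measure_on_unit_def sets_restrict_space_iff)
  have "neg_moment \<tau> 1 = (\<integral>\<^sup>+ s. indicator {0<..} s \<partial>\<sigma>)"
    using neg_moment_density[OF M(1), of 0] by (simp add: representing_measure_case_nat[OF \<tau> \<sigma>])
  also have "\<dots> = (\<integral>\<^sup>+ s. indicator ({0<..} \<inter> {0..1}) s \<partial>\<sigma>)"
    by (rule nn_integral_cong) (auto simp: space_unit_measure[OF M(1)] split: split_indicator)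
  also have "\<dots> = emeasure \<sigma> ({0<..} \<inter> {0..1})" using sets by simp
  finally have "neg_moment \<tau> 1 + emeasure \<sigma> {0} = emeasure \<sigma> (({0<..} \<inter> {0..1}) \<union> {0})"
    using sets by (subst plus_emeasure[symmetric]) auto
  also have "({0<..} \<inter> {0..1}) \<union> {0} = {0..1::real}" by auto
  also have "emeasure \<sigma> {0..1} = ennreal (b 0 - c)"
  proof -
    have "case_nat c b (Suc 0) - case_nat c b 0 = (\<integral>s. s ^ 0 \<partial>\<sigma>)"
      using \<sigma> unfolding is_representing_measure_iff_moments by blast
    thus ?thesis by (simp add: emeasure_eq_measure space_unit_measure[OF M(1)])
  qed
  finally have eq: "neg_moment \<tau> 1 + emeasure \<sigma> {0} = ennreal (b 0 - c)" .
  have "case_nat c b (Suc 0) - case_nat c b 0 = (\<integral>s. s ^ 0 \<partial>\<sigma>)"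
    using \<sigma> unfolding is_representing_measure_iff_moments by blast
  hence "b 0 - c \<ge> 0" by simp
  thus ?thesis unfolding eq using \<open>0 \<le> c\<close> by (simp flip: ennreal_plus)
qed

lemma AE_pos_if_neg_moment_finite:
  assumes "borel_measure_on_unit M" "neg_moment M 1 \<noteq> \<infinity>"
  shows "AE s in M. s > 0"
proof -
  have "AE s in M. 1 / ennreal s ^ 1 \<noteq> \<infinity>"
    using assms unfolding neg_moment_def
    by (intro nn_integral_PInf_AE borel_measurable_unit_measure[OF assms(1)]) auto
  thus ?thesis
  proof (rule AE_mp, intro AE_I2 impI)
    fix s assume "1 / ennreal s ^ 1 \<noteq> \<infinity>"
    thus "s > 0" by (cases "s > 0") (auto simp: ennreal_neg)
  qed
qed

lemma emeasure_zero_if_neg_moment_finite: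
  assumes "borel_measure_on_unit M" "neg_moment M 1 \<noteq> \<infinity>"
  shows "emeasure M {0} = 0"
proof -
  have "AE s in M. s \<notin> {0}" using AE_pos_if_neg_moment_finite[OF assms] by eventually_elim auto
  moreover have "{0} \<in> sets M" using assms by (auto simp: borel_measure_on_unit_def sets_restrict_space_iff)
  ultimately show ?thesis by (simp add: AE_iff_null_sets null_setsD1)
qed

text \<open>Without an atom at 0 the relation d\<tau> = s d\<sigma> can be inverted, and negative
  moments drop by one order.\<close>

lemma neg_moment_case_nat:
  assumes \<tau>: "is_representing_measure b \<tau>" and \<sigma>: "is_representing_measure (case_nat c b) \<sigma>"
    and "emeasure \<sigma> {0} = 0"
  shows "neg_moment \<tau> (Suc j) = neg_moment \<sigma> j"
proof -
  have M: "borel_measure_on_unit \<sigma>" using \<sigma> by (auto simp: is_representing_measure_def)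
  have "{0} \<in> sets \<sigma>" using M by (auto simp: borel_measure_on_unit_def sets_restrict_space_iff)
  hence "AE s in \<sigma>. s \<notin> {0}" using assms(3) by (intro AE_not_in) (auto simp: null_sets_def)
  hence "AE s in \<sigma>. 1 / ennreal s ^ j * indicator {0<..} s = 1 / ennreal s ^ j"
    by (rule AE_mp, intro AE_I2 impI) (auto simp: space_unit_measure[OF M])
  thus ?thesis
    unfolding representing_measure_case_nat[OF \<tau> \<sigma>] neg_moment_density[OF M]
    by (simp only: neg_moment_def) (rule nn_integral_cong_AE)
qed

text \<open>Necessity is the mass balance. For sufficiency the representing measure would be \<rho>
  = (1/s) d\<tau> plus an atom at 0 whose mass d takes up the slack; the atom enters only as an
  extra term in the zeroth increment.\<close>

lemma completely_alternating_case_nat_iff: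
  assumes \<tau>: "is_representing_measure b \<tau>" and "0 < c"
  shows "completely_alternating (case_nat c b) \<longleftrightarrow> neg_moment \<tau> 1 + ennreal c \<le> ennreal (b 0)"
proof
  assume "completely_alternating (case_nat c b)"
  then obtain \<sigma> where \<sigma>: "is_representing_measure (case_nat c b) \<sigma>"
    by (auto simp: completely_alternating_iff_representing_measure)
  have "neg_moment \<tau> 1 + ennreal c \<le> neg_moment \<tau> 1 + emeasure \<sigma> {0} + ennreal c"
    by (intro add_mono) auto
  thus "neg_moment \<tau> 1 + ennreal c \<le> ennreal (b 0)"
    using representing_measure_case_nat_mass[OF \<tau> \<sigma>] \<open>0 < c\<close> by (simp del: One_nat_def)
next
  assume le: "neg_moment \<tau> 1 + ennreal c \<le> ennreal (b 0)"
  have M: "borel_measure_on_unit \<tau>" "finite_measure \<tau>" using \<tau> by (auto simp: is_representing_measure_def)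
  have fin: "neg_moment \<tau> 1 \<noteq> \<infinity>" using le by (auto simp: top_unique)
  note pos = AE_pos_if_neg_moment_finite[OF M(1) fin]
  define \<rho> where "\<rho> = density \<tau> (\<lambda>s. ennreal (1 / s))"
  have meas: "(\<lambda>s. ennreal (1 / s)) \<in> borel_measurable \<tau>"
    using M(1) by (rule borel_measurable_unit_measure) simp
  have mass: "emeasure \<rho> (space \<rho>) = neg_moment \<tau> 1"
  proof -
    have "emeasure \<rho> (space \<rho>) = (\<integral>\<^sup>+ s. ennreal (1 / s) \<partial>\<tau>)"
      unfolding \<rho>_def using meas by (simp add: emeasure_density cong: nn_integral_cong)
    also have "\<dots> = neg_moment \<tau> 1"
      unfolding neg_moment_def
      by (rule nn_integral_cong_AE, use pos in eventually_elim) (simp add: divide_ennreal[of 1, simplified])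
    finally show ?thesis .
  qed
  have R: "borel_measure_on_unit \<rho>" "finite_measure \<rho>"
    using M mass fin by (auto simp: \<rho>_def borel_measure_on_unit_def intro!: finite_measureI)
  define d where "d = b 0 - c - measure \<rho> (space \<rho>)"
  interpret R: finite_measure \<rho> by fact
  have "ennreal (measure \<rho> (space \<rho>) + c) \<le> ennreal (b 0)"
    using le mass \<open>0 < c\<close> by (simp add: R.emeasure_eq_measure ennreal_plus)
  moreover from this have "b 0 \<ge> 0"
    using \<open>0 < c\<close> by (cases "b 0 \<ge> 0") (auto simp: ennreal_neg add_nonneg_pos not_le measure_nonneg)
  ultimately have d: "d \<ge> 0" by (simp add: d_def)
  have mom: "case_nat c b (Suc k) - case_nat c b k = (\<integral>s. s ^ k \<partial>\<rho>) + (if k = 0 then d else 0)" for k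
  proof (cases k)
    case 0
    thus ?thesis by (simp add: d_def)
  next
    case (Suc i)
    have "(\<integral>s. s ^ Suc i \<partial>\<rho>) = (\<integral>s. 1 / s * s ^ Suc i \<partial>\<tau>)"
      unfolding \<rho>_def by (subst integral_real_density)
        (auto intro!: borel_measurable_unit_measure[OF M(1)] AE_I2 simp: space_unit_measure[OF M(1)])
    also have "\<dots> = (\<integral>s. s ^ i \<partial>\<tau>)"
      by (rule integral_cong_AE, (intro borel_measurable_unit_measure[OF M(1)]; simp)+)
         (use pos in \<open>eventually_elim; simp\<close>)
    also have "\<dots> = b (Suc i) - b i"
      using \<tau> unfolding is_representing_measure_iff_moments by simp
    finally show ?thesis using Suc by simp
  qed
  have "0 \<le> backdiff n (\<lambda>k. \<integral>s. s ^ k \<partial>\<rho>) m" for n m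
    unfolding backdiff_moments[OF R refl]
    by (rule Bochner_Integration.integral_nonneg_AE, rule AE_I2) (simp add: space_unit_measure[OF R(1)])
  thus "completely_alternating (case_nat c b)"
    unfolding completely_alternating_iff_difference mom backdiff_add backdiff_single using d by simp
qed

text \<open>The sequence \<open>c (k - 1), ..., c 0, b 0, b 1, ...\<close>: indices of c count
  outward from b, so the next term in front is \<open>c k\<close>.\<close>

fun prepend :: "(nat \<Rightarrow> real) \<Rightarrow> (nat \<Rightarrow> real) \<Rightarrow> nat \<Rightarrow> nat \<Rightarrow> real" where
  "prepend c b 0 = b"
| "prepend c b (Suc k) = case_nat (c k) (prepend c b k)"

text \<open>Absorbs the innermost term into the base sequence. The induction below peels from this
  side, because the representing measure changes with the base.\<close>

lemma prepend_Suc_inner: "prepend c b (Suc k) = prepend (\<lambda>j. c (Suc j)) (case_nat (c 0) b) k"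
  by (induction k) simp_all

lemma completely_alternating_prepend_mono:
  "completely_alternating (prepend c b k) \<Longrightarrow> i \<le> k \<Longrightarrow> completely_alternating (prepend c b i)"
  by (induction k) (auto simp: le_Suc_eq dest: completely_alternating_tail)

text \<open>Induction passing from \<tau> to a measure \<sigma> for \<open>case_nat (c 0) b\<close>.
  Without an atom at 0, \<open>inv_moment \<tau> (Suc j) = neg_moment \<tau> 1 + inv_moment \<sigma>
  j\<close>. The conditions for \<sigma> have right-hand side \<open>c 0\<close>; adding
  \<open>neg_moment \<tau> 1\<close> turns them into those for \<tau>, since
  \<open>neg_moment \<tau> 1 + c 0 = b 0\<close>.\<close>

theorem completely_alternating_prepend_iff:
  assumes "is_representing_measure b \<tau>" "\<And>j. j \<le> k \<Longrightarrow> 0 < c j"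
  shows "completely_alternating (prepend c b (Suc k)) \<longleftrightarrow>
     (\<forall>j<k. inv_moment \<tau> (Suc j) + ennreal (c j) = ennreal (b 0)) \<and>
     inv_moment \<tau> (Suc k) + ennreal (c k) \<le> ennreal (b 0)"
  using assms
proof (induction k arbitrary: b c \<tau>)
  case 0
  have "borel_measure_on_unit \<tau>" using 0 by (auto simp: is_representing_measure_def)
  thus ?case using completely_alternating_case_nat_iff[OF 0(1) 0(2)[OF le0]] by (simp add: inv_moment_eq_sum)
next
  case (Suc k b c \<tau>)
  have M\<tau>: "borel_measure_on_unit \<tau>" using Suc by (auto simp: is_representing_measure_def)
  let ?b = "case_nat (c 0) b" and ?c = "\<lambda>j. c (Suc j)"
  have inv\<tau>: "inv_moment \<tau> (Suc j) = neg_moment \<tau> 1 + inv_moment \<sigma> j"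
    if "is_representing_measure ?b \<sigma>" "emeasure \<sigma> {0} = 0" for \<sigma> j
  proof -
    have M\<sigma>: "borel_measure_on_unit \<sigma>" using that by (auto simp: is_representing_measure_def)
    have "inv_moment \<tau> (Suc j) = neg_moment \<tau> 1 + (\<Sum>i=1..j. neg_moment \<tau> (Suc i))"
      unfolding inv_moment_eq_sum[OF M\<tau>] by (induction j) (auto simp: add.assoc)
    also have "(\<Sum>i=1..j. neg_moment \<tau> (Suc i)) = inv_moment \<sigma> j"
      unfolding inv_moment_eq_sum[OF M\<sigma>] neg_moment_case_nat[OF Suc.prems(1) that] ..
    finally show ?thesis .
  qed
  show ?case (is "?L \<longleftrightarrow> ?R")
  proof
    assume L: ?L
    hence "completely_alternating (prepend c b (Suc 0))"
      by (rule completely_alternating_prepend_mono) simp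
    then obtain \<sigma> where \<sigma>: "is_representing_measure ?b \<sigma>"
      by (auto simp: completely_alternating_iff_representing_measure)
    have M\<sigma>: "borel_measure_on_unit \<sigma>" using \<sigma> by (auto simp: is_representing_measure_def)
    from L have IH: "\<And>j. j < k \<Longrightarrow> inv_moment \<sigma> (Suc j) + ennreal (?c j) = ennreal (?b 0)"
       "inv_moment \<sigma> (Suc k) + ennreal (?c k) \<le> ennreal (?b 0)"
      using Suc.IH[OF \<sigma>, of ?c] Suc.prems(2) unfolding prepend_Suc_inner[of c b "Suc k"] by auto
    \<comment> \<open>The condition for the outermost term bounds the first negative moment of
      \<sigma>, so \<sigma> has no atom at 0 and the mass balance becomes an equation.\<close>
    have "neg_moment \<sigma> 1 \<le> inv_moment \<sigma> (Suc k)"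
      unfolding inv_moment_eq_sum[OF M\<sigma>] by (rule member_le_sum) auto
    also have "\<dots> \<le> ennreal (?b 0)" by (rule order_trans[OF _ IH(2)]) simp
    finally have "neg_moment \<sigma> 1 \<noteq> \<infinity>" by (auto simp: top_unique)
    hence z: "emeasure \<sigma> {0} = 0" by (rule emeasure_zero_if_neg_moment_finite[OF M\<sigma>])
    have base: "neg_moment \<tau> 1 + ennreal (c 0) = ennreal (b 0)"
      using representing_measure_case_nat_mass[OF Suc.prems(1) \<sigma>] Suc.prems(2)[OF le0] z by simp
    show ?R
    proof (intro conjI allI impI)
      fix j assume "j < Suc k"
      show "inv_moment \<tau> (Suc j) + ennreal (c j) = ennreal (b 0)"
      proof (cases j)
        case 0
        thus ?thesis using base by (simp add: inv_moment_eq_sum[OF M\<tau>])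
      next
        case (Suc i)
        thus ?thesis using IH(1)[of i] base \<open>j < Suc k\<close> inv\<tau>[OF \<sigma> z, of j] by (simp add: add.assoc)
      qed
    next
      have "inv_moment \<tau> (Suc (Suc k)) + ennreal (c (Suc k)) = neg_moment \<tau> 1 + (inv_moment \<sigma> (Suc k) + ennreal (?c k))"
        by (simp add: inv\<tau>[OF \<sigma> z] add.assoc)
      also have "\<dots> \<le> neg_moment \<tau> 1 + ennreal (c 0)" using IH(2) by (intro add_left_mono) simp
      finally show "inv_moment \<tau> (Suc (Suc k)) + ennreal (c (Suc k)) \<le> ennreal (b 0)" using base by simp
    qed
  next
    assume R: ?R
    hence "inv_moment \<tau> (Suc 0) + ennreal (c 0) = ennreal (b 0)" by blast
    hence base: "neg_moment \<tau> 1 + ennreal (c 0) = ennreal (b 0)"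
      using inv_moment_eq_sum[OF M\<tau>, of "Suc 0"] by simp
    hence fin: "neg_moment \<tau> 1 \<noteq> \<top>" by auto
    have "completely_alternating ?b"
      using completely_alternating_case_nat_iff[OF Suc.prems(1) Suc.prems(2)[OF le0]] base by simp
    then obtain \<sigma> where \<sigma>: "is_representing_measure ?b \<sigma>"
      by (auto simp: completely_alternating_iff_representing_measure)
    \<comment> \<open>In this direction the atom is excluded by the mass balance: the equation for
      index 0 already exhausts \<open>b 0\<close>.\<close>
    have "neg_moment \<tau> 1 + ennreal (c 0) + emeasure \<sigma> {0} = neg_moment \<tau> 1 + ennreal (c 0) + 0"
      using representing_measure_case_nat_mass[OF Suc.prems(1) \<sigma> less_imp_le[OF Suc.prems(2)[OF le0]]] base
      by (metis add.assoc add.commute add_0_right)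
    hence z: "emeasure \<sigma> {0} = 0" using base by (subst (asm) ennreal_add_left_cancel) auto
    have "inv_moment \<sigma> (Suc j) + ennreal (?c j) = ennreal (?b 0)" if "j < k" for j
    proof -
      have "neg_moment \<tau> 1 + (inv_moment \<sigma> (Suc j) + ennreal (?c j)) = neg_moment \<tau> 1 + ennreal (c 0)"
        using R[THEN conjunct1, rule_format, of "Suc j"] that base inv\<tau>[OF \<sigma> z, of "Suc j"]
        by (simp add: add.assoc)
      thus ?thesis using fin by (subst (asm) ennreal_add_left_cancel) auto
    qed
    moreover have "inv_moment \<sigma> (Suc k) + ennreal (?c k) \<le> ennreal (?b 0)"
    proof -
      have "neg_moment \<tau> 1 + (inv_moment \<sigma> (Suc k) + ennreal (?c k)) \<le> neg_moment \<tau> 1 + ennreal (c 0)"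
        using R[THEN conjunct2] base inv\<tau>[OF \<sigma> z, of "Suc k"] by (simp add: add.assoc)
      thus ?thesis using fin by (subst (asm) ennreal_add_left_cancel_le) auto
    qed
    ultimately show ?L
      using Suc.IH[OF \<sigma>, of ?c] Suc.prems(2) unfolding prepend_Suc_inner[of c b "Suc k"] by auto
  qed
qed

section \<open>Weighted sums of measures\<close>

text \<open>The sum of the measures w_i \<tau>_i. Weights in \<open>ennreal\<close> and integration
  against the counting measure allow infinite I before any summability is known.\<close>

definition weighted_sum_measure :: "nat set \<Rightarrow> (nat \<Rightarrow> ennreal) \<Rightarrow> (nat \<Rightarrow> real measure) \<Rightarrow> real measure" where
  "weighted_sum_measure I w \<tau> = measure_of {0..1} (sets (restrict_space borel {0..1}))
     (\<lambda>A. \<integral>\<^sup>+ i. w i * emeasure (\<tau> i) A \<partial>count_space I)"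

lemma borel_measure_on_unit_weighted_sum: "borel_measure_on_unit (weighted_sum_measure I w \<tau>)"
proof -
  have "sigma_algebra {0..1} (sets (restrict_space borel {0..1::real}))"
    using sets.sigma_algebra_axioms[of "restrict_space borel {0..1::real}"] by (simp add: space_restrict_space)
  thus ?thesis
    unfolding borel_measure_on_unit_def weighted_sum_measure_def
    by (simp add: sigma_algebra.sets_measure_of_eq)
qed

lemma sets_weighted_sum [simp]:
  "sets (weighted_sum_measure I w \<tau>) = sets (restrict_space borel {0..1})"
  using borel_measure_on_unit_weighted_sum by (simp add: borel_measure_on_unit_def)

lemma emeasure_weighted_sum:
  assumes "\<And>i. i \<in> I \<Longrightarrow> borel_measure_on_unit (\<tau> i)" "A \<in> sets (restrict_space borel {0..1})"
  shows "emeasure (weighted_sum_measure I w \<tau>) A = (\<integral>\<^sup>+ i. w i * emeasure (\<tau> i) A \<partial>count_space I)"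
proof (rule emeasure_measure_of[OF weighted_sum_measure_def])
  show "sets (restrict_space borel {0..1::real}) \<subseteq> Pow {0..1}"
    by (auto simp: sets_restrict_space)
  show "A \<in> sets (weighted_sum_measure I w \<tau>)" using assms(2) by simp
  show "positive (sets (weighted_sum_measure I w \<tau>)) (\<lambda>A. \<integral>\<^sup>+ i. w i * emeasure (\<tau> i) A \<partial>count_space I)"
    by (simp add: positive_def)
  show "countably_additive (sets (weighted_sum_measure I w \<tau>)) (\<lambda>A. \<integral>\<^sup>+ i. w i * emeasure (\<tau> i) A \<partial>count_space I)"
  proof (rule countably_additiveI)
    fix F :: "nat \<Rightarrow> real set"
    assume F: "range F \<subseteq> sets (weighted_sum_measure I w \<tau>)" "disjoint_family F"
    have "(\<Sum>n. \<integral>\<^sup>+ i. w i * emeasure (\<tau> i) (F n) \<partial>count_space I) =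
        (\<integral>\<^sup>+ i. (\<Sum>n. w i * emeasure (\<tau> i) (F n)) \<partial>count_space I)"
      by (rule nn_integral_suminf[symmetric]) simp
    also have "\<dots> = (\<integral>\<^sup>+ i. w i * emeasure (\<tau> i) (\<Union>n. F n) \<partial>count_space I)"
    proof (rule nn_integral_cong)
      fix i assume "i \<in> space (count_space I)"
      hence "range F \<subseteq> sets (\<tau> i)" using F assms(1)[of i] by (simp add: borel_measure_on_unit_def)
      thus "(\<Sum>n. w i * emeasure (\<tau> i) (F n)) = w i * emeasure (\<tau> i) (\<Union>n. F n)"
        using F(2) by (simp add: suminf_emeasure)
    qed
    finally show "(\<Sum>n. \<integral>\<^sup>+ i. w i * emeasure (\<tau> i) (F n) \<partial>count_space I) =
        (\<integral>\<^sup>+ i. w i * emeasure (\<tau> i) (\<Union>n. F n) \<partial>count_space I)" .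
  qed
qed

lemma nn_integral_weighted_sum:
  assumes \<tau>: "\<And>i. i \<in> I \<Longrightarrow> borel_measure_on_unit (\<tau> i)" and f: "f \<in> borel_measurable borel"
  shows "(\<integral>\<^sup>+ s. f s \<partial>weighted_sum_measure I w \<tau>) = (\<integral>\<^sup>+ i. w i * (\<integral>\<^sup>+ s. f s \<partial>\<tau> i) \<partial>count_space I)"
proof -
  let ?W = "weighted_sum_measure I w \<tau>"
  have meas: "g \<in> borel_measurable (\<tau> i)" if "g \<in> borel_measurable ?W" "i \<in> I" for g :: "real \<Rightarrow> ennreal" and i
    using that \<tau>[of i] by (simp add: borel_measure_on_unit_def cong: measurable_cong_sets)
  have "f \<in> borel_measurable ?W"
    using borel_measure_on_unit_weighted_sum f by (rule borel_measurable_unit_measure)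
  thus ?thesis
  proof (induction rule: borel_measurable_induct)
    case (cong f g)
    have "(\<integral>\<^sup>+ s. f s \<partial>\<tau> i) = (\<integral>\<^sup>+ s. g s \<partial>\<tau> i)" if "i \<in> I" for i
      using cong(3) \<tau>[OF that]
      by (intro nn_integral_cong) (simp add: space_unit_measure borel_measure_on_unit_weighted_sum)
    moreover have "(\<integral>\<^sup>+ s. f s \<partial>?W) = (\<integral>\<^sup>+ s. g s \<partial>?W)"
      using cong(3) by (intro nn_integral_cong)
    moreover from calculation(1) have "(\<integral>\<^sup>+ i. w i * (\<integral>\<^sup>+ s. f s \<partial>\<tau> i) \<partial>count_space I) =
        (\<integral>\<^sup>+ i. w i * (\<integral>\<^sup>+ s. g s \<partial>\<tau> i) \<partial>count_space I)"
      by (intro nn_integral_cong) simp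
    ultimately show ?case using cong(4) by simp
  next
    case (set A)
    have "A \<in> sets (\<tau> i)" if "i \<in> I" for i
      using set \<tau>[OF that] by (simp add: borel_measure_on_unit_def)
    hence "(\<integral>\<^sup>+ i. w i * emeasure (\<tau> i) A \<partial>count_space I) =
        (\<integral>\<^sup>+ i. w i * (\<integral>\<^sup>+ s. indicator A s \<partial>\<tau> i) \<partial>count_space I)"
      by (intro nn_integral_cong) simp
    thus ?case using set by (simp add: emeasure_weighted_sum[OF \<tau>])
  next
    case (mult u c)
    have "(\<integral>\<^sup>+ i. w i * (\<integral>\<^sup>+ s. c * u s \<partial>\<tau> i) \<partial>count_space I) =
        (\<integral>\<^sup>+ i. c * (w i * (\<integral>\<^sup>+ s. u s \<partial>\<tau> i)) \<partial>count_space I)"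
      by (rule nn_integral_cong) (simp add: nn_integral_cmult meas mult ac_simps)
    thus ?case using mult by (simp add: nn_integral_cmult)
  next
    case (add u v)
    have "(\<integral>\<^sup>+ i. w i * (\<integral>\<^sup>+ s. v s + u s \<partial>\<tau> i) \<partial>count_space I) =
        (\<integral>\<^sup>+ i. w i * (\<integral>\<^sup>+ s. v s \<partial>\<tau> i) + w i * (\<integral>\<^sup>+ s. u s \<partial>\<tau> i) \<partial>count_space I)"
      by (rule nn_integral_cong) (simp add: nn_integral_add meas add distrib_left)
    thus ?case using add by (simp add: nn_integral_add)
  next
    case (seq U)
    have U: "incseq U" using seq by simp
    have "(\<integral>\<^sup>+ s. (SUP n. U n) s \<partial>?W) = (SUP n. \<integral>\<^sup>+ i. w i * (\<integral>\<^sup>+ s. U n s \<partial>\<tau> i) \<partial>count_space I)"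
      using seq by (simp add: nn_integral_monotone_convergence_SUP image_comp)
    also have "\<dots> = (\<integral>\<^sup>+ i. (SUP n. w i * (\<integral>\<^sup>+ s. U n s \<partial>\<tau> i)) \<partial>count_space I)"
      using U by (intro nn_integral_monotone_convergence_SUP[symmetric])
        (auto simp: incseq_def le_fun_def intro!: mult_left_mono nn_integral_mono)
    also have "\<dots> = (\<integral>\<^sup>+ i. w i * (\<integral>\<^sup>+ s. (SUP n. U n) s \<partial>\<tau> i) \<partial>count_space I)"
      by (rule nn_integral_cong)
         (simp add: nn_integral_monotone_convergence_SUP[OF U] meas seq image_comp SUP_mult_left_ennreal)
    finally show ?case by (simp add: image_comp)
  qed
qed

lemma inv_moment_weighted_sum:
  assumes "\<And>i. i \<in> I \<Longrightarrow> borel_measure_on_unit (\<tau> i)"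
  shows "inv_moment (weighted_sum_measure I w \<tau>) k = (\<integral>\<^sup>+ i. w i * inv_moment (\<tau> i) k \<partial>count_space I)"
  unfolding inv_moment_def using assms by (rule nn_integral_weighted_sum) measurable

text \<open>Links the infinite sums in \<open>U_set\<close> to integrals against the counting
  measure, where monotone convergence and interchange of sums are at hand.\<close>

lemma nn_integral_count_space_nat_eq_infsum:
  fixes f :: "nat \<Rightarrow> ennreal"
  shows "(\<integral>\<^sup>+ i. f i \<partial>count_space A) = (\<Sum>\<^sub>\<infinity>i\<in>A. f i)"
proof (rule antisym)
  have "(\<integral>\<^sup>+ i. f i \<partial>count_space A) = (\<Sum>i. f i * indicator A i)"
    by (simp add: nn_integral_count_space_indicator[of A] nn_integral_count_space_nat)
  also have "\<dots> = (SUP n. \<Sum>i<n. f i * indicator A i)"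
    by (rule suminf_eq_SUP)
  also have "\<dots> \<le> (\<Sum>\<^sub>\<infinity>i\<in>A. f i)"
  proof (rule SUP_least)
    fix n
    have "(\<Sum>i<n. f i * indicator A i) = (\<Sum>i\<in>A \<inter> {..<n}. f i)"
      by (simp add: sum.inter_restrict Int_commute[of A] indicator_def if_distrib cong: if_cong)
    also have "\<dots> = (\<Sum>\<^sub>\<infinity>i\<in>A \<inter> {..<n}. f i)" by simp
    also have "\<dots> \<le> (\<Sum>\<^sub>\<infinity>i\<in>A. f i)"
      by (rule infsum_mono_neutral) (auto intro: nonneg_summable_on_complete)
    finally show "(\<Sum>i<n. f i * indicator A i) \<le> (\<Sum>\<^sub>\<infinity>i\<in>A. f i)" .
  qed
  finally show "(\<integral>\<^sup>+ i. f i \<partial>count_space A) \<le> (\<Sum>\<^sub>\<infinity>i\<in>A. f i)" .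
  show "(\<Sum>\<^sub>\<infinity>i\<in>A. f i) \<le> (\<integral>\<^sup>+ i. f i \<partial>count_space A)"
  proof (subst nonneg_infsum_complete, simp_all, rule SUP_least)
    fix F assume "F \<in> {F. finite F \<and> F \<subseteq> A}"
    hence F: "finite F" "F \<subseteq> A" by auto
    have "sum f F = (\<integral>\<^sup>+ i. f i \<partial>count_space F)" using F by (simp add: nn_integral_count_space_finite)
    also have "\<dots> = (\<integral>\<^sup>+ i. f i * indicator F i \<partial>count_space A)"
      using F by (simp add: nn_integral_count_space_indicator[of F] nn_integral_count_space_indicator[of A])
         (intro nn_integral_cong, auto split: split_indicator)
    also have "\<dots> \<le> (\<integral>\<^sup>+ i. f i \<partial>count_space A)"
      by (rule nn_integral_mono) (auto split: split_indicator)
    finally show "sum f F \<le> (\<integral>\<^sup>+ i. f i \<partial>count_space A)" .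
  qed
qed

lemma summable_on_iff_nn_integral_finite:
  fixes f :: "'a \<Rightarrow> real"
  assumes "\<And>x. 0 \<le> f x"
  shows "f summable_on A \<longleftrightarrow> (\<integral>\<^sup>+ x. ennreal (f x) \<partial>count_space A) < \<infinity>"
proof -
  have "f summable_on A \<longleftrightarrow> Infinite_Set_Sum.abs_summable_on f A"
    using assms by (simp flip: abs_summable_equivalent)
  also have "\<dots> \<longleftrightarrow> (\<integral>\<^sup>+ x. ennreal (f x) \<partial>count_space A) < \<infinity>"
    using assms by (simp add: Infinite_Set_Sum.abs_summable_on_def integrable_iff_bounded)
  finally show ?thesis .
qed

lemma ennreal_infsum_eq_nn_integral:
  fixes f :: "'a \<Rightarrow> real"
  assumes "\<And>x. 0 \<le> f x" "f summable_on A"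
  shows "ennreal (\<Sum>\<^sub>\<infinity>x\<in>A. f x) = (\<integral>\<^sup>+ x. ennreal (f x) \<partial>count_space A)"
proof -
  have "Infinite_Set_Sum.abs_summable_on f A"
    using assms by (simp flip: abs_summable_equivalent)
  thus ?thesis using assms nn_integral_conv_infsetsum[of f A] by (simp add: infsetsum_infsum)
qed

section \<open>Powers of weighted shifts\<close>

lemma ell2_iff_nn_integral:
  "f \<in> ell2 V \<longleftrightarrow> (\<forall>v. v \<notin> V \<longrightarrow> f v = 0) \<and> (\<integral>\<^sup>+ v. ennreal ((cmod (f v))\<^sup>2) \<partial>count_space UNIV) < \<infinity>"
proof -
  have "(\<integral>\<^sup>+ v. ennreal ((cmod (f v))\<^sup>2) \<partial>count_space V) = (\<integral>\<^sup>+ v. ennreal ((cmod (f v))\<^sup>2) \<partial>count_space UNIV)"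
    if "\<forall>v. v \<notin> V \<longrightarrow> f v = 0"
    using that by (intro nn_integral_count_space_eq) auto
  thus ?thesis by (auto simp: ell2_def summable_on_iff_nn_integral_finite)
qed

lemma l2norm_nonneg: "0 \<le> l2norm V f"
  by (simp add: l2norm_def infsum_nonneg)

lemma ennreal_l2norm_squared:
  assumes "f \<in> ell2 V"
  shows "ennreal ((l2norm V f)\<^sup>2) = (\<integral>\<^sup>+ v. ennreal ((cmod (f v))\<^sup>2) \<partial>count_space UNIV)"
proof -
  have "ennreal ((l2norm V f)\<^sup>2) = (\<integral>\<^sup>+ v. ennreal ((cmod (f v))\<^sup>2) \<partial>count_space V)"
    using assms by (simp add: l2norm_def infsum_nonneg ell2_def ennreal_infsum_eq_nn_integral)
  also have "\<dots> = (\<integral>\<^sup>+ v. ennreal ((cmod (f v))\<^sup>2) \<partial>count_space UNIV)"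
    using assms by (intro nn_integral_count_space_eq) (auto simp: ell2_def)
  finally show ?thesis .
qed

lemma nn_integral_basis_vec:
  "(\<integral>\<^sup>+ v. ennreal ((cmod (basis_vec u v))\<^sup>2) * g v \<partial>count_space UNIV) = g u"
proof -
  have "(\<integral>\<^sup>+ v. ennreal ((cmod (basis_vec u v))\<^sup>2) * g v \<partial>count_space UNIV) =
      (\<integral>\<^sup>+ v. g v * indicator {u} v \<partial>count_space UNIV)"
    by (rule nn_integral_cong) (simp add: basis_vec_def indicator_def)
  thus ?thesis by (simp add: nn_integral_indicator_singleton)
qed

lemma basis_vec_ell2: "u \<in> V \<Longrightarrow> basis_vec u \<in> ell2 V"
  using nn_integral_basis_vec[of u "\<lambda>_. 1"] by (auto simp: ell2_iff_nn_integral basis_vec_def)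

lemma l2norm_basis_vec: "u \<in> V \<Longrightarrow> l2norm V (basis_vec u) = 1"
  using ennreal_l2norm_squared[OF basis_vec_ell2, of u V] nn_integral_basis_vec[of u "\<lambda>_. 1"] l2norm_nonneg[of V "basis_vec u"]
  by (simp add: power2_eq_1_iff)

definition children :: "enat \<Rightarrow> nat \<Rightarrow> vertex \<Rightarrow> vertex set" where
  "children \<eta> \<kappa> u = {v \<in> nonroot_vertices \<eta> \<kappa>. parent \<eta> \<kappa> v = u}"

text \<open>\<open>power_mass \<eta> \<kappa> lam n u\<close> is the squared norm of the \<open>n\<close>-th power of the shift at the basis vector of \<open>u\<close>.\<close>

fun power_mass :: "enat \<Rightarrow> nat \<Rightarrow> (vertex \<Rightarrow> complex) \<Rightarrow> nat \<Rightarrow> vertex \<Rightarrow> ennreal" where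
  "power_mass \<eta> \<kappa> lam 0 u = 1"
| "power_mass \<eta> \<kappa> lam (Suc n) u =
     (\<integral>\<^sup>+ v. ennreal ((cmod (lam v))\<^sup>2) * power_mass \<eta> \<kappa> lam n v \<partial>count_space (children \<eta> \<kappa> u))"

text \<open>Tonelli for the sum over pairs of a parent u and a child v, each nonroot v having just
  one parent. The free weight g is there so that \<open>power_mass\<close> can take its
  place.\<close>

lemma nn_integral_wshift_fun:
  "(\<integral>\<^sup>+ v. ennreal ((cmod (wshift_fun \<eta> \<kappa> lam f v))\<^sup>2) * g v \<partial>count_space UNIV) =
   (\<integral>\<^sup>+ u. ennreal ((cmod (f u))\<^sup>2) *
      (\<integral>\<^sup>+ v. ennreal ((cmod (lam v))\<^sup>2) * g v \<partial>count_space (children \<eta> \<kappa> u)) \<partial>count_space UNIV)"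
proof -
  define h where "h = (\<lambda>(u, v). ennreal ((cmod (f u))\<^sup>2) *
     (ennreal ((cmod (lam v))\<^sup>2) * g v * indicator (children \<eta> \<kappa> u) v))"
  have "ennreal ((cmod (wshift_fun \<eta> \<kappa> lam f v))\<^sup>2) * g v = (\<integral>\<^sup>+ u. h (u, v) \<partial>count_space UNIV)" for v
  proof (cases "v \<in> nonroot_vertices \<eta> \<kappa>")
    case True
    have "(\<integral>\<^sup>+ u. h (u, v) \<partial>count_space UNIV) = (\<integral>\<^sup>+ u. (ennreal ((cmod (f u))\<^sup>2) *
        (ennreal ((cmod (lam v))\<^sup>2) * g v)) * indicator {parent \<eta> \<kappa> v} u \<partial>count_space UNIV)"
      using True by (intro nn_integral_cong) (auto simp: h_def children_def split: split_indicator)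
    also have "\<dots> = ennreal ((cmod (f (parent \<eta> \<kappa> v)))\<^sup>2) * (ennreal ((cmod (lam v))\<^sup>2) * g v)"
      by (subst nn_integral_indicator_singleton) auto
    finally show ?thesis
      using True by (simp add: wshift_fun_def norm_mult power_mult_distrib ennreal_mult ac_simps)
  next
    case False
    thus ?thesis by (simp add: wshift_fun_def h_def children_def)
  qed
  hence "(\<integral>\<^sup>+ v. ennreal ((cmod (wshift_fun \<eta> \<kappa> lam f v))\<^sup>2) * g v \<partial>count_space UNIV) =
      (\<integral>\<^sup>+ v. \<integral>\<^sup>+ u. h (u, v) \<partial>count_space UNIV \<partial>count_space UNIV)" by simp
  also have "\<dots> = (\<integral>\<^sup>+ u. \<integral>\<^sup>+ v. h (u, v) \<partial>count_space UNIV \<partial>count_space UNIV)"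
    by (simp add: nn_integral_fst_count_space nn_integral_snd_count_space)
  also have "\<dots> = (\<integral>\<^sup>+ u. ennreal ((cmod (f u))\<^sup>2) *
      (\<integral>\<^sup>+ v. ennreal ((cmod (lam v))\<^sup>2) * g v \<partial>count_space (children \<eta> \<kappa> u)) \<partial>count_space UNIV)"
    by (rule nn_integral_cong)
       (simp add: h_def nn_integral_cmult nn_integral_count_space_indicator[of "children _ _ _"])
  finally show ?thesis .
qed

text \<open>The preceding identity with g = \<open>power_mass\<close> moves one application of the
  shift from f into the weight. The result expresses the orthogonality of the images of the basis
  vectors.\<close>

lemma nn_integral_wshift_fun_power:
  "(\<integral>\<^sup>+ v. ennreal ((cmod ((wshift_fun \<eta> \<kappa> lam ^^ n) f v))\<^sup>2) \<partial>count_space UNIV) =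
   (\<integral>\<^sup>+ u. ennreal ((cmod (f u))\<^sup>2) * power_mass \<eta> \<kappa> lam n u \<partial>count_space UNIV)"
proof (induction n arbitrary: f)
  case 0
  show ?case by simp
next
  case (Suc n)
  show ?case
    by (simp only: funpow_Suc_right o_apply Suc.IH nn_integral_wshift_fun power_mass.simps)
qed

lemma wshift_fun_support: "v \<notin> tree_vertices \<eta> \<kappa> \<Longrightarrow> wshift_fun \<eta> \<kappa> lam f v = 0"
  by (simp add: wshift_fun_def nonroot_vertices_def)

text \<open>The squared norm of the image of f is the sum of |f u|^2 times the mass at u. Basis
  vectors give one direction, termwise comparison the other.\<close>

lemma weighted_shift_bounded_iff:
  "weighted_shift \<eta> \<kappa> lam \<in> bounded_operators (tree_vertices \<eta> \<kappa>) \<longleftrightarrow>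
     (\<exists>C::real. \<forall>u\<in>tree_vertices \<eta> \<kappa>. power_mass \<eta> \<kappa> lam 1 u \<le> ennreal C)"
  (is "?L \<longleftrightarrow> ?R")
proof -
  let ?V = "tree_vertices \<eta> \<kappa>" and ?T = "wshift_fun \<eta> \<kappa> lam"
  have mass: "(\<integral>\<^sup>+ v. ennreal ((cmod (?T f v))\<^sup>2) \<partial>count_space UNIV) =
      (\<integral>\<^sup>+ u. ennreal ((cmod (f u))\<^sup>2) * power_mass \<eta> \<kappa> lam 1 u \<partial>count_space UNIV)" for f
    using nn_integral_wshift_fun_power[where n=1 and f=f] by (simp del: power_mass.simps)
  show ?thesis
  proof
    assume ?L
    then obtain C where dom: "dom (weighted_shift \<eta> \<kappa> lam) = ell2 ?V"
      and C: "\<forall>f\<in>ell2 ?V. l2norm ?V (op_apply (weighted_shift \<eta> \<kappa> lam) f) \<le> C * l2norm ?V f"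
      unfolding bounded_operators_def by blast
    have "power_mass \<eta> \<kappa> lam 1 u \<le> ennreal (C\<^sup>2)" if u: "u \<in> ?V" for u
    proof -
      have e: "basis_vec u \<in> ell2 ?V" using u by (rule basis_vec_ell2)
      hence Te: "?T (basis_vec u) \<in> ell2 ?V" "op_apply (weighted_shift \<eta> \<kappa> lam) (basis_vec u) = ?T (basis_vec u)"
        using dom by (auto simp: weighted_shift_def dom_def op_apply_def split: if_splits)
      have "l2norm ?V (?T (basis_vec u)) \<le> C" using bspec[OF C e] Te by (simp add: l2norm_basis_vec[OF u])
      hence "(l2norm ?V (?T (basis_vec u)))\<^sup>2 \<le> C\<^sup>2" by (intro power_mono l2norm_nonneg)
      moreover have "power_mass \<eta> \<kappa> lam 1 u = ennreal ((l2norm ?V (?T (basis_vec u)))\<^sup>2)"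
        by (simp only: ennreal_l2norm_squared[OF Te(1)] mass nn_integral_basis_vec)
      ultimately show ?thesis by (simp add: ennreal_leI del: power_mass.simps)
    qed
    thus ?R by blast
  next
    assume ?R
    then obtain C0 :: real where C0: "\<And>u. u \<in> ?V \<Longrightarrow> power_mass \<eta> \<kappa> lam 1 u \<le> ennreal C0" by blast
    \<comment> \<open>\<open>ennreal\<close> sends negative reals to 0, so the nonnegative part is
      still a bound, and it has a square root.\<close>
    define C where "C = max C0 0"
    have C: "power_mass \<eta> \<kappa> lam 1 u \<le> ennreal C" if "u \<in> ?V" for u
      using C0[OF that] by (rule order_trans) (simp add: C_def ennreal_leI)
    have C_nonneg: "C \<ge> 0" by (simp add: C_def)
    have le: "(\<integral>\<^sup>+ v. ennreal ((cmod (?T f v))\<^sup>2) \<partial>count_space UNIV) \<le>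
        ennreal C * (\<integral>\<^sup>+ v. ennreal ((cmod (f v))\<^sup>2) \<partial>count_space UNIV)" if "f \<in> ell2 ?V" for f
    proof -
      have "ennreal ((cmod (f u))\<^sup>2) * power_mass \<eta> \<kappa> lam 1 u \<le> ennreal C * ennreal ((cmod (f u))\<^sup>2)" for u
        using that C[of u] by (cases "u \<in> ?V") (auto simp: ell2_def mult.commute intro!: mult_right_mono simp del: power_mass.simps)
      hence "(\<integral>\<^sup>+ v. ennreal ((cmod (?T f v))\<^sup>2) \<partial>count_space UNIV) \<le>
          (\<integral>\<^sup>+ u. ennreal C * ennreal ((cmod (f u))\<^sup>2) \<partial>count_space UNIV)"
        unfolding mass by (intro nn_integral_mono)
      thus ?thesis by (simp add: nn_integral_cmult)
    qed
    have Tf: "?T f \<in> ell2 ?V" if "f \<in> ell2 ?V" for f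
    proof -
      have "(\<integral>\<^sup>+ v. ennreal ((cmod (f v))\<^sup>2) \<partial>count_space UNIV) < \<infinity>"
        using that by (simp add: ell2_iff_nn_integral)
      hence "ennreal C * (\<integral>\<^sup>+ v. ennreal ((cmod (f v))\<^sup>2) \<partial>count_space UNIV) < \<infinity>"
        by (simp add: ennreal_mult_less_top)
      thus ?thesis using le[OF that] by (auto simp: ell2_iff_nn_integral wshift_fun_support)
    qed
    have ap: "op_apply (weighted_shift \<eta> \<kappa> lam) f = ?T f" if "f \<in> ell2 ?V" for f
      using that Tf by (simp add: weighted_shift_def op_apply_def)
    have add: "(\<lambda>v. f v + g v) \<in> ell2 ?V" if "f \<in> ell2 ?V" "g \<in> ell2 ?V" for f g
    proof -
      have le: "(cmod (f v + g v))\<^sup>2 \<le> 2 * (cmod (f v))\<^sup>2 + 2 * (cmod (g v))\<^sup>2" for v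
      proof -
        have "(cmod (f v + g v))\<^sup>2 \<le> (cmod (f v) + cmod (g v))\<^sup>2"
          by (intro power_mono norm_triangle_ineq) auto
        also have "\<dots> \<le> 2 * (cmod (f v))\<^sup>2 + 2 * (cmod (g v))\<^sup>2"
          using sum_squares_bound[of "cmod (f v)" "cmod (g v)"] by (simp add: power2_sum)
        finally show ?thesis .
      qed
      have sum: "(\<lambda>v. 2 * (cmod (f v))\<^sup>2 + 2 * (cmod (g v))\<^sup>2) summable_on ?V"
        using that by (intro summable_on_add summable_on_cmult_right) (simp_all add: ell2_def)
      have "(\<lambda>v. (cmod (f v + g v))\<^sup>2) summable_on ?V"
        by (rule summable_on_comparison_test[OF sum le zero_le_power2])
      thus ?thesis using that by (simp add: ell2_def)
    qed
    have cmult: "(\<lambda>v. c * f v) \<in> ell2 ?V" if "f \<in> ell2 ?V" for c f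
      using that by (auto simp: ell2_def norm_mult power_mult_distrib intro!: summable_on_cmult_right)
    have "l2norm ?V (?T f) \<le> sqrt C * l2norm ?V f" if f: "f \<in> ell2 ?V" for f
    proof -
      have "ennreal ((l2norm ?V (?T f))\<^sup>2) \<le> ennreal C * ennreal ((l2norm ?V f)\<^sup>2)"
        using le[OF f] by (simp add: ennreal_l2norm_squared f Tf)
      hence "(l2norm ?V (?T f))\<^sup>2 \<le> C * (l2norm ?V f)\<^sup>2"
        using C_nonneg by (simp flip: ennreal_mult)
      also have "\<dots> = (sqrt C * l2norm ?V f)\<^sup>2" using C_nonneg by (simp add: power_mult_distrib)
      finally show ?thesis
        by (rule power2_le_imp_le) (simp add: C_nonneg l2norm_nonneg)
    qed
    moreover have "dom (weighted_shift \<eta> \<kappa> lam) = ell2 ?V" "ran (weighted_shift \<eta> \<kappa> lam) \<subseteq> ell2 ?V"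
      using Tf by (auto simp: weighted_shift_def dom_def ran_def split: if_splits)
    ultimately show ?L
      unfolding bounded_operators_def
      by (auto simp: ap add cmult)
         (auto simp: wshift_fun_def algebra_simps fun_eq_iff)
  qed
qed

lemma wshift_fun_ell2:
  assumes "weighted_shift \<eta> \<kappa> lam \<in> bounded_operators (tree_vertices \<eta> \<kappa>)" "f \<in> ell2 (tree_vertices \<eta> \<kappa>)"
  shows "wshift_fun \<eta> \<kappa> lam f \<in> ell2 (tree_vertices \<eta> \<kappa>)"
    and "op_apply (weighted_shift \<eta> \<kappa> lam) f = wshift_fun \<eta> \<kappa> lam f"
  using assms by (auto simp: bounded_operators_def weighted_shift_def dom_def op_apply_def split: if_splits)

lemma op_pow_apply_weighted_shift:
  assumes S: "weighted_shift \<eta> \<kappa> lam \<in> bounded_operators (tree_vertices \<eta> \<kappa>)" and f: "f \<in> ell2 (tree_vertices \<eta> \<kappa>)"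
  shows "op_pow_apply (weighted_shift \<eta> \<kappa> lam) n f = (wshift_fun \<eta> \<kappa> lam ^^ n) f"
    and "(wshift_fun \<eta> \<kappa> lam ^^ n) f \<in> ell2 (tree_vertices \<eta> \<kappa>)"
proof -
  have "op_pow_apply (weighted_shift \<eta> \<kappa> lam) n f = (wshift_fun \<eta> \<kappa> lam ^^ n) f \<and>
     (wshift_fun \<eta> \<kappa> lam ^^ n) f \<in> ell2 (tree_vertices \<eta> \<kappa>)"
    using f by (induction n) (auto simp: op_pow_apply_def wshift_fun_ell2[OF S])
  thus "op_pow_apply (weighted_shift \<eta> \<kappa> lam) n f = (wshift_fun \<eta> \<kappa> lam ^^ n) f"
    "(wshift_fun \<eta> \<kappa> lam ^^ n) f \<in> ell2 (tree_vertices \<eta> \<kappa>)" by auto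
qed

lemma ennreal_l2norm_op_pow_apply:
  assumes S: "weighted_shift \<eta> \<kappa> lam \<in> bounded_operators (tree_vertices \<eta> \<kappa>)" and f: "f \<in> ell2 (tree_vertices \<eta> \<kappa>)"
  shows "ennreal ((l2norm (tree_vertices \<eta> \<kappa>) (op_pow_apply (weighted_shift \<eta> \<kappa> lam) n f))\<^sup>2) =
     (\<integral>\<^sup>+ u. ennreal ((cmod (f u))\<^sup>2) * power_mass \<eta> \<kappa> lam n u \<partial>count_space UNIV)"
  by (simp add: op_pow_apply_weighted_shift[OF assms] ennreal_l2norm_squared nn_integral_wshift_fun_power)

lemma ennreal_l2norm_op_pow_basis_vec:
  assumes "weighted_shift \<eta> \<kappa> lam \<in> bounded_operators (tree_vertices \<eta> \<kappa>)" "u \<in> tree_vertices \<eta> \<kappa>"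
  shows "ennreal ((l2norm (tree_vertices \<eta> \<kappa>) (op_pow_apply (weighted_shift \<eta> \<kappa> lam) n (basis_vec u)))\<^sup>2) =
     power_mass \<eta> \<kappa> lam n u"
  by (simp only: ennreal_l2norm_op_pow_apply[OF assms(1) basis_vec_ell2[OF assms(2)]] nn_integral_basis_vec)

lemma l2norm_op_pow_basis_vec:
  assumes "weighted_shift \<eta> \<kappa> lam \<in> bounded_operators (tree_vertices \<eta> \<kappa>)" "u \<in> tree_vertices \<eta> \<kappa>"
  shows "(l2norm (tree_vertices \<eta> \<kappa>) (op_pow_apply (weighted_shift \<eta> \<kappa> lam) n (basis_vec u)))\<^sup>2 =
     enn2real (power_mass \<eta> \<kappa> lam n u)"
  by (simp flip: ennreal_l2norm_op_pow_basis_vec[OF assms])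

lemma backdiff_infsum:
  fixes f :: "nat \<Rightarrow> 'a \<Rightarrow> real"
  assumes "\<And>k. f k summable_on V"
  shows "(\<lambda>u. backdiff n (\<lambda>k. f k u) m) summable_on V"
    and "(\<Sum>\<^sub>\<infinity>u\<in>V. backdiff n (\<lambda>k. f k u) m) = backdiff n (\<lambda>k. \<Sum>\<^sub>\<infinity>u\<in>V. f k u) m"
proof -
  have "(\<lambda>u. backdiff n (\<lambda>k. f k u) m) summable_on V \<and>
    (\<Sum>\<^sub>\<infinity>u\<in>V. backdiff n (\<lambda>k. f k u) m) = backdiff n (\<lambda>k. \<Sum>\<^sub>\<infinity>u\<in>V. f k u) m"
  proof (induction n arbitrary: m)
    case 0
    show ?case using assms by simp
  next
    case (Suc n)
    let ?g = "\<lambda>m u. backdiff n (\<lambda>k. f k u) m"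
    have neg: "(\<lambda>u. - ?g (Suc m) u) summable_on V"
      using Suc.IH[of "Suc m"] by (simp add: summable_on_uminus)
    have "(\<lambda>u. ?g m u + - ?g (Suc m) u) summable_on V"
      using Suc.IH[of m] neg by (intro summable_on_add) auto
    moreover have "(\<Sum>\<^sub>\<infinity>u\<in>V. ?g m u + - ?g (Suc m) u) = (\<Sum>\<^sub>\<infinity>u\<in>V. ?g m u) + (\<Sum>\<^sub>\<infinity>u\<in>V. - ?g (Suc m) u)"
      using Suc.IH[of m] neg by (intro infsum_add) auto
    ultimately show ?case using Suc.IH[of m] Suc.IH[of "Suc m"] by (simp add: infsum_uminus)
  qed
  thus "(\<lambda>u. backdiff n (\<lambda>k. f k u) m) summable_on V"
    and "(\<Sum>\<^sub>\<infinity>u\<in>V. backdiff n (\<lambda>k. f k u) m) = backdiff n (\<lambda>k. \<Sum>\<^sub>\<infinity>u\<in>V. f k u) m" by auto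
qed

lemma backdiff_cmult: "backdiff n (\<lambda>k. c * a k) m = c * backdiff n a m"
  by (induction n arbitrary: m) (auto simp: right_diff_distrib)

text \<open>For general h the sequence is the sum of |h u|^2 times the sequences at the vertices u;
  backward differences pass through the convergent series and keep their sign.\<close>

theorem completely_hyperexpansive_weighted_shift_iff:
  "completely_hyperexpansive (tree_vertices \<eta> \<kappa>) (weighted_shift \<eta> \<kappa> lam) \<longleftrightarrow>
     (\<exists>C::real. \<forall>u\<in>tree_vertices \<eta> \<kappa>. power_mass \<eta> \<kappa> lam 1 u \<le> ennreal C) \<and>
     (\<forall>u\<in>tree_vertices \<eta> \<kappa>. completely_alternating (\<lambda>n. enn2real (power_mass \<eta> \<kappa> lam n u)))"
proof -
  let ?V = "tree_vertices \<eta> \<kappa>" and ?S = "weighted_shift \<eta> \<kappa> lam"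
  let ?a = "\<lambda>u n. enn2real (power_mass \<eta> \<kappa> lam n u)"
  have "(\<forall>h\<in>ell2 ?V. completely_alternating (\<lambda>n. (l2norm ?V (op_pow_apply ?S n h))\<^sup>2)) \<longleftrightarrow>
     (\<forall>u\<in>?V. completely_alternating (?a u))" (is "?l \<longleftrightarrow> ?r")
    if S: "?S \<in> bounded_operators ?V"
  proof
    assume ?l
    thus ?r using basis_vec_ell2[of _ ?V] by (metis (no_types, lifting) l2norm_op_pow_basis_vec[OF S] ext)
  next
    assume r: ?r
    show ?l
    proof
      fix h assume h: "h \<in> ell2 ?V"
      let ?f = "\<lambda>n u. (cmod (h u))\<^sup>2 * ?a u n"
      have eq: "ennreal (?f n u) = ennreal ((cmod (h u))\<^sup>2) * power_mass \<eta> \<kappa> lam n u" if "u \<in> ?V" for n u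
        by (simp add: ennreal_mult flip: ennreal_l2norm_op_pow_basis_vec[OF S that])
      have int: "(\<integral>\<^sup>+ u. ennreal (?f n u) \<partial>count_space ?V) = ennreal ((l2norm ?V (op_pow_apply ?S n h))\<^sup>2)" for n
      proof -
        have "(\<integral>\<^sup>+ u. ennreal (?f n u) \<partial>count_space ?V) =
            (\<integral>\<^sup>+ u. ennreal ((cmod (h u))\<^sup>2) * power_mass \<eta> \<kappa> lam n u \<partial>count_space ?V)"
          by (rule nn_integral_cong) (simp add: eq)
        also have "\<dots> = (\<integral>\<^sup>+ u. ennreal ((cmod (h u))\<^sup>2) * power_mass \<eta> \<kappa> lam n u \<partial>count_space UNIV)"
          using h by (intro nn_integral_count_space_eq) (auto simp: ell2_def)
        finally show ?thesis by (simp add: ennreal_l2norm_op_pow_apply[OF S h])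
      qed
      have sum: "?f n summable_on ?V" for n
        by (subst summable_on_iff_nn_integral_finite) (simp_all add: int)
      have "ennreal ((l2norm ?V (op_pow_apply ?S n h))\<^sup>2) = ennreal (\<Sum>\<^sub>\<infinity>u\<in>?V. ?f n u)" for n
        using ennreal_infsum_eq_nn_integral[OF _ sum] int by simp
      hence norm: "(l2norm ?V (op_pow_apply ?S n h))\<^sup>2 = (\<Sum>\<^sub>\<infinity>u\<in>?V. ?f n u)" for n
        by (simp add: infsum_nonneg)
      show "completely_alternating (\<lambda>n. (l2norm ?V (op_pow_apply ?S n h))\<^sup>2)"
        unfolding completely_alternating_iff_backdiff norm
      proof (intro allI)
        fix n m
        have "backdiff (Suc n) (\<lambda>n. \<Sum>\<^sub>\<infinity>u\<in>?V. ?f n u) m = (\<Sum>\<^sub>\<infinity>u\<in>?V. backdiff (Suc n) (\<lambda>k. ?f k u) m)"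
          by (rule backdiff_infsum(2)[OF sum, symmetric])
        also have "\<dots> \<le> 0"
        proof -
          have "backdiff (Suc n) (\<lambda>k. ?f k u) m \<le> 0" if "u \<in> ?V" for u
          proof -
            have "backdiff (Suc n) (?a u) m \<le> 0" using r that by (simp only: completely_alternating_iff_backdiff)
            thus ?thesis by (simp only: backdiff_cmult mult_nonneg_nonpos zero_le_power2)
          qed
          hence "0 \<le> (\<Sum>\<^sub>\<infinity>u\<in>?V. - backdiff (Suc n) (\<lambda>k. ?f k u) m)"
            by (intro infsum_nonneg) simp
          thus ?thesis by (simp only: infsum_uminus neg_0_le_iff_le)
        qed
        finally show "backdiff (Suc n) (\<lambda>n. \<Sum>\<^sub>\<infinity>u\<in>?V. ?f n u) m \<le> 0" .
      qed
    qed
  qed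
  thus ?thesis
    unfolding completely_hyperexpansive_def weighted_shift_bounded_iff[symmetric] by blast
qed

lemma vertex_measure_weighted_shift:
  assumes "weighted_shift \<eta> \<kappa> lam \<in> bounded_operators (tree_vertices \<eta> \<kappa>)" "u \<in> tree_vertices \<eta> \<kappa>"
  shows "vertex_measure (tree_vertices \<eta> \<kappa>) (weighted_shift \<eta> \<kappa> lam) u =
     representing_measure (\<lambda>n. enn2real (power_mass \<eta> \<kappa> lam n u))"
  by (simp add: vertex_measure_def l2norm_op_pow_basis_vec[OF assms])

section \<open>The tree with one branching vertex\<close>

lemma Trunk_nonroot_iff: "Trunk m \<in> nonroot_vertices \<eta> \<kappa> \<longleftrightarrow> - int \<kappa> < m \<and> m \<le> 0"
proof
  assume "Trunk m \<in> nonroot_vertices \<eta> \<kappa>"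
  thus "- int \<kappa> < m \<and> m \<le> 0"
    by (auto simp: nonroot_vertices_def tree_vertices_def tree_root_def J_def)
next
  assume m: "- int \<kappa> < m \<and> m \<le> 0"
  then obtain k where "m = - int k" by (metis nonpos_int_cases)
  hence "m = 0 \<or> (\<exists>k. m = - int k \<and> k \<in> J (enat \<kappa>))"
    using m by (cases "k = 0") (auto simp: J_def)
  thus "Trunk m \<in> nonroot_vertices \<eta> \<kappa>"
    using m by (auto simp: nonroot_vertices_def tree_vertices_def tree_root_def)
qed

lemma Branch_nonroot_iff: "Branch i j \<in> nonroot_vertices \<eta> \<kappa> \<longleftrightarrow> i \<in> J \<eta> \<and> 1 \<le> j"
  by (auto simp: nonroot_vertices_def tree_vertices_def tree_root_def)

lemma Trunk_tree_iff: "Trunk m \<in> tree_vertices \<eta> \<kappa> \<longleftrightarrow> - int \<kappa> \<le> m \<and> m \<le> 0"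
proof -
  have "tree_root \<kappa> \<in> tree_vertices \<eta> \<kappa>"
    by (cases "\<kappa> = 0") (auto simp: tree_vertices_def tree_root_def J_def)
  thus ?thesis
    using Trunk_nonroot_iff[of m \<eta> \<kappa>] by (auto simp: nonroot_vertices_def tree_root_def)
qed

lemma Branch_tree_iff: "Branch i j \<in> tree_vertices \<eta> \<kappa> \<longleftrightarrow> i \<in> J \<eta> \<and> 1 \<le> j"
  by (auto simp: tree_vertices_def)

lemma tree_vertex_cases:
  assumes "u \<in> tree_vertices \<eta> \<kappa>"
  obtains (trunk) k where "k \<le> \<kappa>" "u = Trunk (- int k)"
    | (branch) i j where "i \<in> J \<eta>" "u = Branch i (Suc j)"
proof (cases u)
  case (Trunk m)
  hence m: "- int \<kappa> \<le> m" "m \<le> 0" using assms by (auto simp: Trunk_tree_iff)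
  then obtain k where "m = - int k" by (metis nonpos_int_cases)
  thus ?thesis using Trunk m trunk[of k] by simp
next
  case (Branch i j)
  thus ?thesis using assms branch[of i "j - 1"] by (simp add: Branch_tree_iff)
qed

lemma parent_Trunk:
  assumes "- int \<kappa> < m" "m \<le> 0"
  shows "parent \<eta> \<kappa> (Trunk m) = Trunk (m - 1)"
  unfolding parent_def
proof (rule the_equality)
  show "(Trunk (m - 1), Trunk m) \<in> tree_edges \<eta> \<kappa>"
    using assms by (auto simp: tree_edges_def J_def intro!: exI[of _ "nat (1 - m)"])
qed (auto simp: tree_edges_def)

lemma parent_Branch:
  assumes "i \<in> J \<eta>"
  shows "parent \<eta> \<kappa> (Branch i (Suc 0)) = Trunk 0"
    and "parent \<eta> \<kappa> (Branch i (Suc (Suc j))) = Branch i (Suc j)"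
  unfolding parent_def using assms by (auto simp: tree_edges_def intro!: the_equality)

lemma parent_cases:
  assumes "v \<in> nonroot_vertices \<eta> \<kappa>"
  obtains (trunk) k where "k < \<kappa>" "v = Trunk (- int k)" "parent \<eta> \<kappa> v = Trunk (- int (Suc k))"
    | (first) i where "i \<in> J \<eta>" "v = Branch i (Suc 0)" "parent \<eta> \<kappa> v = Trunk 0"
    | (branch) i j where "i \<in> J \<eta>" "v = Branch i (Suc (Suc j))" "parent \<eta> \<kappa> v = Branch i (Suc j)"
proof (cases v)
  case (Trunk m)
  hence m: "- int \<kappa> < m" "m \<le> 0" using assms by (auto simp: Trunk_nonroot_iff)
  then obtain k where "m = - int k" by (metis nonpos_int_cases)
  thus ?thesis using Trunk m trunk[of k] parent_Trunk[OF m, of \<eta>] by simp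
next
  case (Branch i j)
  hence i: "i \<in> J \<eta>" "1 \<le> j" using assms by (auto simp: Branch_nonroot_iff)
  show ?thesis
  proof (cases "j = 1")
    case True
    thus ?thesis using Branch i first[of i] parent_Branch(1)[of i \<eta>] by simp
  next
    case False
    then obtain l where "j = Suc (Suc l)" using i by (metis One_nat_def Suc_le_D old.nat.exhaust)
    thus ?thesis using Branch i branch[of i l] parent_Branch(2)[of i \<eta>] by simp
  qed
qed

lemma children_Branch: "i \<in> J \<eta> \<Longrightarrow> children \<eta> \<kappa> (Branch i (Suc j)) = {Branch i (Suc (Suc j))}"
  by (auto simp: children_def Branch_nonroot_iff parent_Branch elim: parent_cases)

lemma children_Trunk_0: "children \<eta> \<kappa> (Trunk 0) = (\<lambda>i. Branch i (Suc 0)) ` J \<eta>"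
  by (auto simp: children_def Branch_nonroot_iff parent_Branch elim: parent_cases)

lemma children_Trunk_Suc:
  "k < \<kappa> \<Longrightarrow> children \<eta> \<kappa> (Trunk (- int (Suc k))) = {Trunk (- int k)}"
  by (auto simp: children_def Trunk_nonroot_iff parent_Trunk elim: parent_cases)

section \<open>Squared norms of powers as products of squared weights\<close>

definition sqmod :: "(vertex \<Rightarrow> complex) \<Rightarrow> vertex \<Rightarrow> real" where
  "sqmod lam v = (cmod (lam v))\<^sup>2"

text \<open>The squared norm of the n-th power at \<open>Branch i 1\<close>. Factors start at the
  weight of \<open>Branch i 2\<close>, since the weight of \<open>Branch i 1\<close> belongs to the
  edge from the vertex 0.\<close>

definition branch_prod :: "(vertex \<Rightarrow> complex) \<Rightarrow> nat \<Rightarrow> nat \<Rightarrow> real" where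
  "branch_prod lam i n = (\<Prod>l<n. sqmod lam (Branch i (Suc (Suc l))))"

text \<open>The product along the path from -k to 0. A weight sits at the end of its edge, so the
  indices are 0, ..., -k + 1.\<close>

definition trunk_prod :: "(vertex \<Rightarrow> complex) \<Rightarrow> nat \<Rightarrow> real" where
  "trunk_prod lam k = (\<Prod>l<k. sqmod lam (Trunk (- int l)))"

lemma sqmod_nonneg [simp]: "0 \<le> sqmod lam v" by (simp add: sqmod_def)

lemma branch_prod_nonneg [simp]: "0 \<le> branch_prod lam i n"
  by (simp add: branch_prod_def prod_nonneg)

lemma trunk_prod_nonneg [simp]: "0 \<le> trunk_prod lam k"
  by (simp add: trunk_prod_def prod_nonneg)

lemma branch_prod_pos:
  "nonzero_weights \<eta> \<kappa> lam \<Longrightarrow> i \<in> J \<eta> \<Longrightarrow> 0 < branch_prod lam i n"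
  by (auto simp: branch_prod_def sqmod_def nonzero_weights_def Branch_nonroot_iff intro!: prod_pos)

lemma trunk_prod_pos:
  "nonzero_weights \<eta> \<kappa> lam \<Longrightarrow> k \<le> \<kappa> \<Longrightarrow> 0 < trunk_prod lam k"
  by (auto simp: trunk_prod_def sqmod_def nonzero_weights_def Trunk_nonroot_iff intro!: prod_pos)

text \<open>The mass is a quotient of two products; clearing the denominator keeps the induction in
  \<open>ennreal\<close> free of division.\<close>

lemma power_mass_Branch:
  assumes "i \<in> J \<eta>"
  shows "ennreal (branch_prod lam i j) * power_mass \<eta> \<kappa> lam n (Branch i (Suc j)) = ennreal (branch_prod lam i (n + j))"
proof (induction n arbitrary: j)
  case (Suc n)
  have "ennreal (branch_prod lam i j) * power_mass \<eta> \<kappa> lam (Suc n) (Branch i (Suc j)) =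
     ennreal (branch_prod lam i (Suc j)) * power_mass \<eta> \<kappa> lam n (Branch i (Suc (Suc j)))"
    by (simp add: children_Branch[OF assms] nn_integral_count_space_finite branch_prod_def
        prod_nonneg ennreal_mult mult.assoc flip: sqmod_def)
  thus ?case using Suc.IH[of "Suc j"] by simp
qed simp

lemma power_mass_Branch_1:
  "i \<in> J \<eta> \<Longrightarrow> power_mass \<eta> \<kappa> lam n (Branch i (Suc 0)) = ennreal (branch_prod lam i n)"
  using power_mass_Branch[where j=0] by (simp add: branch_prod_def)

lemma power_mass_Trunk_0:
  "power_mass \<eta> \<kappa> lam (Suc n) (Trunk 0) =
     (\<integral>\<^sup>+ i. ennreal (sqmod lam (Branch i (Suc 0))) * ennreal (branch_prod lam i n) \<partial>count_space (J \<eta>))"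
proof -
  have bij: "bij_betw (\<lambda>i. Branch i (Suc 0)) (J \<eta>) ((\<lambda>i. Branch i (Suc 0)) ` J \<eta>)"
    by (intro inj_on_imp_bij_betw) (auto simp: inj_on_def)
  show ?thesis
    by (simp add: children_Trunk_0 nn_integral_bij_count_space[OF bij, symmetric] flip: sqmod_def)
       (rule nn_integral_cong, simp add: power_mass_Branch_1)
qed

lemma power_mass_Trunk_Suc:
  "k < \<kappa> \<Longrightarrow> power_mass \<eta> \<kappa> lam (Suc n) (Trunk (- int (Suc k))) =
     ennreal (sqmod lam (Trunk (- int k))) * power_mass \<eta> \<kappa> lam n (Trunk (- int k))"
  by (simp add: children_Trunk_Suc nn_integral_count_space_finite flip: sqmod_def del: of_nat_Suc)

text \<open>Up to n = k the image of the basis vector of -k is a multiple of one basis vector, with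
  squared norm \<open>trunk_prod lam k / trunk_prod lam (k - n)\<close>. Later powers follow the
  sequence at the vertex 0 from its index 1 on; its index 0 is the prepended term with j = 0, which
  equals 1.\<close>

lemma power_mass_Trunk:
  assumes nz: "nonzero_weights \<eta> \<kappa> lam" and "k \<le> \<kappa>"
  shows "enn2real (power_mass \<eta> \<kappa> lam n (Trunk (- int k))) =
     trunk_prod lam k * prepend (\<lambda>j. 1 / trunk_prod lam j)
       (\<lambda>n. enn2real (power_mass \<eta> \<kappa> lam (Suc n) (Trunk 0))) (Suc k) n"
  using \<open>k \<le> \<kappa>\<close>
proof (induction k arbitrary: n)
  case 0
  show ?case by (cases n) (simp_all add: trunk_prod_def)
next
  case (Suc k)
  have pos: "0 < trunk_prod lam (Suc k)" using nz Suc.prems by (rule trunk_prod_pos)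
  show ?case
  proof (cases n)
    case 0
    thus ?thesis using pos by simp
  next
    case (Suc m)
    have "enn2real (power_mass \<eta> \<kappa> lam (Suc m) (Trunk (- int (Suc k)))) =
       sqmod lam (Trunk (- int k)) * enn2real (power_mass \<eta> \<kappa> lam m (Trunk (- int k)))"
      using Suc.prems by (subst power_mass_Trunk_Suc) (simp_all add: enn2real_mult)
    thus ?thesis
      using Suc.IH[of m] Suc.prems Suc by (simp add: trunk_prod_def ac_simps)
  qed
qed

lemma completely_alternating_cmult:
  assumes "completely_alternating a" "0 \<le> c"
  shows "completely_alternating (\<lambda>n. c * a n)"
  using assms by (simp only: completely_alternating_iff_backdiff backdiff_cmult) (simp add: mult_nonneg_nonpos)

lemma completely_alternating_cmult_iff:
  assumes "0 < c"
  shows "completely_alternating (\<lambda>n. c * a n) \<longleftrightarrow> completely_alternating a"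
  using completely_alternating_cmult[of "\<lambda>n. c * a n" "1 / c"] completely_alternating_cmult[of a c] assms
  by auto

lemma completely_alternating_shift:
  assumes "completely_alternating a"
  shows "completely_alternating (\<lambda>n. a (n + j))"
proof -
  have "backdiff n (\<lambda>k. a (k + j)) m = backdiff n a (m + j)" for n m
    by (induction n arbitrary: m) simp_all
  thus ?thesis using assms by (simp only: completely_alternating_iff_backdiff) blast
qed

text \<open>The sequence starting at 1 that M represents; for M = \<tau>_i these are to be the
  squared norms at \<open>Branch i 1\<close>.\<close>

definition unit_sequence :: "real measure \<Rightarrow> nat \<Rightarrow> real" where
  "unit_sequence M n = 1 + (\<integral>s. (\<Sum>l<n. s ^ l) \<partial>M)"

lemma is_representing_measure_unit_sequence:
  "borel_measure_on_unit M \<Longrightarrow> finite_measure M \<Longrightarrow> is_representing_measure (unit_sequence M) M"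
  by (simp add: is_representing_measure_def unit_sequence_def)

lemma unit_sequence_Suc:
  assumes "borel_measure_on_unit M" "finite_measure M"
  shows "unit_sequence M (Suc n) = unit_sequence M n + (\<integral>s. s ^ n \<partial>M)"
  using is_representing_measure_unit_sequence[OF assms] unfolding is_representing_measure_iff_moments
  by (metis add.commute diff_add_cancel)

lemma integral_power_bounds:
  assumes "borel_measure_on_unit M" "finite_measure M"
  shows "0 \<le> (\<integral>s. s ^ n \<partial>M)" "(\<integral>s. s ^ n \<partial>M) \<le> measure M {0..1}"
proof -
  show "0 \<le> (\<integral>s. s ^ n \<partial>M)"
    by (rule Bochner_Integration.integral_nonneg_AE, rule AE_I2) (simp add: space_unit_measure[OF assms(1)])
  have "(\<integral>s. s ^ n \<partial>M) \<le> (\<integral>s. 1 \<partial>M)"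
    using assms integrable_power_unit_measure[OF assms]
    by (intro integral_mono finite_measure.integrable_const) (auto simp: space_unit_measure power_le_one)
  thus "(\<integral>s. s ^ n \<partial>M) \<le> measure M {0..1}" by (simp add: space_unit_measure[OF assms(1)])
qed

lemma unit_sequence_ge_1:
  assumes "borel_measure_on_unit M" "finite_measure M"
  shows "1 \<le> unit_sequence M n"
proof (induction n)
  case (Suc n)
  thus ?case using unit_sequence_Suc[OF assms, of n] integral_power_bounds(1)[OF assms, of n] by simp
qed (simp add: unit_sequence_def)

text \<open>Sums and integrals commute in \<open>ennreal\<close>, so each increment of b is a moment
  of the weighted sum; the common bound C makes its total mass, and with it every
  \<open>b n\<close>, finite.\<close>

lemma is_representing_measure_weighted_sum:
  assumes \<tau>: "\<And>i. i \<in> I \<Longrightarrow> borel_measure_on_unit (\<tau> i)"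
    and C: "\<And>i. i \<in> I \<Longrightarrow> emeasure (\<tau> i) {0..1} \<le> ennreal C"
    and w: "(\<integral>\<^sup>+ i. w i \<partial>count_space I) < \<infinity>"
  defines "b \<equiv> \<lambda>n. \<integral>\<^sup>+ i. w i * ennreal (unit_sequence (\<tau> i) n) \<partial>count_space I"
  shows "b n < \<infinity>"
    and "is_representing_measure (\<lambda>n. enn2real (b n)) (weighted_sum_measure I w \<tau>)"
proof -
  let ?W = "weighted_sum_measure I w \<tau>"
  have fin\<tau>: "finite_measure (\<tau> i)" if "i \<in> I" for i
    using C[OF that] \<tau>[OF that] by (intro finite_measureI) (auto simp: space_unit_measure top_unique)
  note W = borel_measure_on_unit_weighted_sum[of I w \<tau>]
  have "emeasure ?W {0..1} = (\<integral>\<^sup>+ i. w i * emeasure (\<tau> i) {0..1} \<partial>count_space I)"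
    using \<tau> by (rule emeasure_weighted_sum) (auto simp: sets_restrict_space_iff)
  also have "\<dots> \<le> (\<integral>\<^sup>+ i. w i * ennreal C \<partial>count_space I)"
    using C by (intro nn_integral_mono mult_left_mono) auto
  also have "\<dots> < \<infinity>" using w by (simp add: nn_integral_multc ennreal_mult_less_top)
  finally have "finite_measure ?W"
    by (intro finite_measureI) (simp add: space_unit_measure[OF W])
  then interpret W: finite_measure ?W .
  have mom: "(\<integral>\<^sup>+ s. ennreal (s ^ n) \<partial>M) = ennreal (\<integral>s. s ^ n \<partial>M)"
    if "borel_measure_on_unit M" "finite_measure M" for M n
    using integrable_power_unit_measure[OF that]
    by (rule nn_integral_eq_integral, intro AE_I2) (simp add: space_unit_measure[OF that(1)])
  have step: "b (Suc n) = b n + ennreal (\<integral>s. s ^ n \<partial>?W)" for n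
  proof -
    have "b (Suc n) = (\<integral>\<^sup>+ i. w i * ennreal (unit_sequence (\<tau> i) n) + w i * (\<integral>\<^sup>+ s. ennreal (s ^ n) \<partial>\<tau> i) \<partial>count_space I)"
      unfolding b_def
    proof (rule nn_integral_cong)
      fix i assume "i \<in> space (count_space I)"
      hence i: "borel_measure_on_unit (\<tau> i)" "finite_measure (\<tau> i)" using \<tau> fin\<tau> by auto
      have "ennreal (unit_sequence (\<tau> i) (Suc n)) = ennreal (unit_sequence (\<tau> i) n) + (\<integral>\<^sup>+ s. ennreal (s ^ n) \<partial>\<tau> i)"
        using unit_sequence_ge_1[OF i, of n] integral_power_bounds(1)[OF i, of n]
        by (simp add: unit_sequence_Suc[OF i] mom[OF i] ennreal_plus)
      thus "w i * ennreal (unit_sequence (\<tau> i) (Suc n)) =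
          w i * ennreal (unit_sequence (\<tau> i) n) + w i * (\<integral>\<^sup>+ s. ennreal (s ^ n) \<partial>\<tau> i)"
        by (simp add: distrib_left)
    qed
    also have "\<dots> = b n + (\<integral>\<^sup>+ s. ennreal (s ^ n) \<partial>?W)"
      by (simp add: nn_integral_add b_def nn_integral_weighted_sum[OF \<tau>])
    finally show ?thesis by (simp add: mom[OF W W.finite_measure_axioms])
  qed
  have "b 0 < \<infinity>" using w by (simp add: b_def unit_sequence_def)
  thus fin: "b n < \<infinity>" for n by (induction n) (simp_all add: step)
  have "enn2real (b (Suc n)) - enn2real (b n) = (\<integral>s. s ^ n \<partial>?W)" for n
    using fin[of n] integral_power_bounds(1)[OF W W.finite_measure_axioms, of n]
    by (simp add: step enn2real_plus)
  thus "is_representing_measure (\<lambda>n. enn2real (b n)) ?W"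
    by (simp add: is_representing_measure_iff_moments W W.finite_measure_axioms)
qed

definition weight_mass :: "enat \<Rightarrow> (nat \<Rightarrow> real) \<Rightarrow> ennreal" where
  "weight_mass \<eta> t = (\<integral>\<^sup>+ i. ennreal ((t i)\<^sup>2) \<partial>count_space (J \<eta>))"

definition weight_inv_moment :: "enat \<Rightarrow> (nat \<Rightarrow> real measure) \<Rightarrow> (nat \<Rightarrow> real) \<Rightarrow> nat \<Rightarrow> ennreal" where
  "weight_inv_moment \<eta> \<tau> t k = (\<integral>\<^sup>+ i. ennreal ((t i)\<^sup>2) * inv_moment (\<tau> i) k \<partial>count_space (J \<eta>))"

text \<open>Moduli, because weights may be complex; restricted, because members of
  \<open>U_set\<close> are undefined outside \<open>J \<eta>\<close>.\<close>

definition first_weights :: "enat \<Rightarrow> (vertex \<Rightarrow> complex) \<Rightarrow> nat \<Rightarrow> real" where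
  "first_weights \<eta> lam = restrict (\<lambda>i. cmod (lam (Branch i 1))) (J \<eta>)"

text \<open>The conditions of \<open>V_set\<close> for complex weights, as needed for the
  competitors in \<open>extremal\<close>.\<close>

definition has_vertex_measures :: "enat \<Rightarrow> nat \<Rightarrow> (nat \<Rightarrow> real measure) \<Rightarrow> (vertex \<Rightarrow> complex) \<Rightarrow> bool" where
  "has_vertex_measures \<eta> \<kappa> \<tau> lam \<longleftrightarrow>
     completely_hyperexpansive (tree_vertices \<eta> \<kappa>) (weighted_shift \<eta> \<kappa> lam) \<and>
     (\<forall>i\<in>J \<eta>. vertex_measure (tree_vertices \<eta> \<kappa>) (weighted_shift \<eta> \<kappa> lam) (Branch i 1) = \<tau> i)"

lemma finite_measure_if_bounded:
  assumes "borel_measure_on_unit M" "emeasure M {0..1} \<le> ennreal C"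
  shows "finite_measure M"
  using assms by (intro finite_measureI) (auto simp: space_unit_measure top_unique)

lemma power_mass_Trunk_0_eq_weighted_sum:
  assumes "\<forall>i\<in>J \<eta>. \<forall>n. branch_prod lam i n = unit_sequence (\<tau> i) n"
  shows "power_mass \<eta> \<kappa> lam (Suc n) (Trunk 0) =
     (\<integral>\<^sup>+ i. ennreal ((first_weights \<eta> lam i)\<^sup>2) * ennreal (unit_sequence (\<tau> i) n) \<partial>count_space (J \<eta>))"
  unfolding power_mass_Trunk_0 using assms
  by (intro nn_integral_cong) (simp add: first_weights_def sqmod_def)

lemma weight_mass_eq_power_mass: "power_mass \<eta> \<kappa> lam 1 (Trunk 0) = weight_mass \<eta> (first_weights \<eta> lam)"
proof -
  have "power_mass \<eta> \<kappa> lam (Suc 0) (Trunk 0) = weight_mass \<eta> (first_weights \<eta> lam)"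
    unfolding power_mass_Trunk_0 weight_mass_def
    by (intro nn_integral_cong) (simp add: first_weights_def sqmod_def branch_prod_def)
  thus ?thesis by simp
qed

text \<open>Up to a positive factor the sequence at the root is \<open>prepend\<close> over the
  sequence represented by the sum of t_i^2 \<tau>_i, whose inverse moments are
  \<open>weight_inv_moment\<close>.\<close>

lemma completely_alternating_trunk_end_iff:
  assumes nz: "nonzero_weights \<eta> \<kappa> lam"
    and \<tau>: "\<And>i. i \<in> J \<eta> \<Longrightarrow> borel_measure_on_unit (\<tau> i)"
    and C: "\<And>i. i \<in> J \<eta> \<Longrightarrow> emeasure (\<tau> i) {0..1} \<le> ennreal C"
    and br: "\<forall>i\<in>J \<eta>. \<forall>n. branch_prod lam i n = unit_sequence (\<tau> i) n"
    and fin: "weight_mass \<eta> (first_weights \<eta> lam) < \<infinity>"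
  defines "t \<equiv> first_weights \<eta> lam"
  shows "completely_alternating (\<lambda>n. enn2real (power_mass \<eta> \<kappa> lam n (Trunk (- int \<kappa>)))) \<longleftrightarrow>
     (\<forall>j<\<kappa>. weight_inv_moment \<eta> \<tau> t (Suc j) + ennreal (1 / trunk_prod lam j) = weight_mass \<eta> t) \<and>
     weight_inv_moment \<eta> \<tau> t (Suc \<kappa>) + ennreal (1 / trunk_prod lam \<kappa>) \<le> weight_mass \<eta> t"
proof -
  let ?w = "\<lambda>i. ennreal ((t i)\<^sup>2)" and ?c = "\<lambda>j. 1 / trunk_prod lam j"
  let ?b = "\<lambda>n. enn2real (power_mass \<eta> \<kappa> lam (Suc n) (Trunk 0))"
  have w: "(\<integral>\<^sup>+ i. ?w i \<partial>count_space (J \<eta>)) < \<infinity>"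
    using fin by (simp add: weight_mass_def t_def)
  have rep: "is_representing_measure ?b (weighted_sum_measure (J \<eta>) ?w \<tau>)"
    unfolding power_mass_Trunk_0_eq_weighted_sum[OF br] t_def[symmetric]
    using is_representing_measure_weighted_sum(2)[OF \<tau> C w] .
  have b0: "ennreal (?b 0) = weight_mass \<eta> t"
    using fin weight_mass_eq_power_mass[of \<eta> \<kappa> lam] by (simp add: t_def ennreal_enn2real)
  have K: "inv_moment (weighted_sum_measure (J \<eta>) ?w \<tau>) k = weight_inv_moment \<eta> \<tau> t k" for k
    using inv_moment_weighted_sum[OF \<tau>] by (simp add: weight_inv_moment_def)
  have "completely_alternating (\<lambda>n. enn2real (power_mass \<eta> \<kappa> lam n (Trunk (- int \<kappa>)))) \<longleftrightarrow>
      completely_alternating (prepend ?c ?b (Suc \<kappa>))"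
    by (simp only: power_mass_Trunk[OF nz le_refl] completely_alternating_cmult_iff[OF trunk_prod_pos[OF nz le_refl]])
  also have "\<dots> \<longleftrightarrow> (\<forall>j<\<kappa>. weight_inv_moment \<eta> \<tau> t (Suc j) + ennreal (?c j) = weight_mass \<eta> t) \<and>
      weight_inv_moment \<eta> \<tau> t (Suc \<kappa>) + ennreal (?c \<kappa>) \<le> weight_mass \<eta> t"
    unfolding K[symmetric] b0[symmetric]
    by (rule completely_alternating_prepend_iff[OF rep]) (simp add: trunk_prod_pos[OF nz])
  finally show ?thesis .
qed

text \<open>Complete alternation at the root contains that at the other trunk vertices, whose
  sequences are inner stages of the same \<open>prepend\<close>; at a branch vertex the sequence is
  a rescaled tail of \<open>branch_prod\<close>.\<close>

theorem has_vertex_measures_iff: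
  assumes nz: "nonzero_weights \<eta> \<kappa> lam"
    and \<tau>: "\<And>i. i \<in> J \<eta> \<Longrightarrow> borel_measure_on_unit (\<tau> i)"
    and C: "\<And>i. i \<in> J \<eta> \<Longrightarrow> emeasure (\<tau> i) {0..1} \<le> ennreal C"
  defines "t \<equiv> first_weights \<eta> lam"
  shows "has_vertex_measures \<eta> \<kappa> \<tau> lam \<longleftrightarrow>
     (\<forall>i\<in>J \<eta>. \<forall>n. branch_prod lam i n = unit_sequence (\<tau> i) n) \<and> weight_mass \<eta> t < \<infinity> \<and>
     (\<forall>j<\<kappa>. weight_inv_moment \<eta> \<tau> t (Suc j) + ennreal (1 / trunk_prod lam j) = weight_mass \<eta> t) \<and>
     weight_inv_moment \<eta> \<tau> t (Suc \<kappa>) + ennreal (1 / trunk_prod lam \<kappa>) \<le> weight_mass \<eta> t"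
proof
  let ?S = "weighted_shift \<eta> \<kappa> lam" and ?V = "tree_vertices \<eta> \<kappa>"
  assume L: "has_vertex_measures \<eta> \<kappa> \<tau> lam"
  hence CH: "completely_hyperexpansive ?V ?S" by (simp add: has_vertex_measures_def)
  hence S: "?S \<in> bounded_operators ?V" by (simp add: completely_hyperexpansive_def)
  from CH obtain D :: real where D: "\<And>u. u \<in> ?V \<Longrightarrow> power_mass \<eta> \<kappa> lam 1 u \<le> ennreal D"
    and CA: "\<And>u. u \<in> ?V \<Longrightarrow> completely_alternating (\<lambda>n. enn2real (power_mass \<eta> \<kappa> lam n u))"
    unfolding completely_hyperexpansive_weighted_shift_iff by blast
  have br: "branch_prod lam i n = unit_sequence (\<tau> i) n" if i: "i \<in> J \<eta>" for i n
  proof -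
    have v: "Branch i 1 \<in> ?V" using i by (simp add: Branch_tree_iff)
    have eq: "(\<lambda>n. enn2real (power_mass \<eta> \<kappa> lam n (Branch i 1))) = branch_prod lam i"
      using power_mass_Branch_1[OF i, of \<kappa> lam] by (simp add: fun_eq_iff)
    have "representing_measure (branch_prod lam i) = \<tau> i"
      using L i vertex_measure_weighted_shift[OF S v] by (simp only: has_vertex_measures_def eq)
    hence "is_representing_measure (branch_prod lam i) (\<tau> i)"
      using CA[OF v] is_representing_measure_representing_measure[of "branch_prod lam i"] by (simp only: eq)
    thus ?thesis
      by (cases "n = 0") (simp_all add: is_representing_measure_def unit_sequence_def branch_prod_def[of _ _ 0])
  qed
  have "Trunk 0 \<in> ?V" by (simp add: Trunk_tree_iff)
  hence fin: "weight_mass \<eta> t < \<infinity>"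
    using D[of "Trunk 0"] unfolding weight_mass_eq_power_mass t_def
    by (auto simp: less_top[symmetric] top_unique)
  have "Trunk (- int \<kappa>) \<in> ?V" by (simp add: Trunk_tree_iff)
  from CA[OF this] show "(\<forall>i\<in>J \<eta>. \<forall>n. branch_prod lam i n = unit_sequence (\<tau> i) n) \<and> weight_mass \<eta> t < \<infinity> \<and>
     (\<forall>j<\<kappa>. weight_inv_moment \<eta> \<tau> t (Suc j) + ennreal (1 / trunk_prod lam j) = weight_mass \<eta> t) \<and>
     weight_inv_moment \<eta> \<tau> t (Suc \<kappa>) + ennreal (1 / trunk_prod lam \<kappa>) \<le> weight_mass \<eta> t"
    using completely_alternating_trunk_end_iff[OF nz, where \<tau>=\<tau>, OF \<tau> C] br fin unfolding t_def by blast
next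
  let ?S = "weighted_shift \<eta> \<kappa> lam" and ?V = "tree_vertices \<eta> \<kappa>"
  assume R: "(\<forall>i\<in>J \<eta>. \<forall>n. branch_prod lam i n = unit_sequence (\<tau> i) n) \<and> weight_mass \<eta> t < \<infinity> \<and>
     (\<forall>j<\<kappa>. weight_inv_moment \<eta> \<tau> t (Suc j) + ennreal (1 / trunk_prod lam j) = weight_mass \<eta> t) \<and>
     weight_inv_moment \<eta> \<tau> t (Suc \<kappa>) + ennreal (1 / trunk_prod lam \<kappa>) \<le> weight_mass \<eta> t"
  hence br: "\<And>i n. i \<in> J \<eta> \<Longrightarrow> branch_prod lam i n = unit_sequence (\<tau> i) n"
    and fin: "weight_mass \<eta> t < \<infinity>" by auto
  have \<tau>fin: "finite_measure (\<tau> i)" if "i \<in> J \<eta>" for i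
    using \<tau>[OF that] C[OF that] by (rule finite_measure_if_bounded)
  have rep: "is_representing_measure (branch_prod lam i) (\<tau> i)" if "i \<in> J \<eta>" for i
  proof -
    have "branch_prod lam i = unit_sequence (\<tau> i)" using br[OF that] by (simp add: fun_eq_iff)
    thus ?thesis using is_representing_measure_unit_sequence[OF \<tau> \<tau>fin] that by simp
  qed
  have mass_branch: "enn2real (power_mass \<eta> \<kappa> lam n (Branch i (Suc j))) = 1 / branch_prod lam i j * branch_prod lam i (n + j)"
    and mass_branch': "power_mass \<eta> \<kappa> lam n (Branch i (Suc j)) = ennreal (branch_prod lam i (n + j) / branch_prod lam i j)"
    if i: "i \<in> J \<eta>" for i j n
  proof -
    have pos: "0 < branch_prod lam i j" using nz i by (rule branch_prod_pos)
    have "ennreal (branch_prod lam i (n + j) / branch_prod lam i j) =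
        ennreal (1 / branch_prod lam i j) * ennreal (branch_prod lam i (n + j))"
      using pos by (simp flip: ennreal_mult)
    also have "\<dots> = ennreal (1 / branch_prod lam i j) * ennreal (branch_prod lam i j) * power_mass \<eta> \<kappa> lam n (Branch i (Suc j))"
      by (simp only: mult.assoc power_mass_Branch[OF i])
    also have "ennreal (1 / branch_prod lam i j) * ennreal (branch_prod lam i j) = 1"
      using pos by (simp flip: ennreal_mult)
    finally show "power_mass \<eta> \<kappa> lam n (Branch i (Suc j)) = ennreal (branch_prod lam i (n + j) / branch_prod lam i j)" by simp
    thus "enn2real (power_mass \<eta> \<kappa> lam n (Branch i (Suc j))) = 1 / branch_prod lam i j * branch_prod lam i (n + j)"
      using pos by simp
  qed
  have end_CA: "completely_alternating (\<lambda>n. enn2real (power_mass \<eta> \<kappa> lam n (Trunk (- int \<kappa>))))"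
    using completely_alternating_trunk_end_iff[OF nz, where \<tau>=\<tau>, OF \<tau> C] R unfolding t_def by blast
  hence "completely_alternating (prepend (\<lambda>j. 1 / trunk_prod lam j)
       (\<lambda>n. enn2real (power_mass \<eta> \<kappa> lam (Suc n) (Trunk 0))) (Suc \<kappa>))"
    by (simp only: power_mass_Trunk[OF nz le_refl] completely_alternating_cmult_iff[OF trunk_prod_pos[OF nz le_refl]])
  hence trunk_CA: "completely_alternating (\<lambda>n. enn2real (power_mass \<eta> \<kappa> lam n (Trunk (- int k))))" if "k \<le> \<kappa>" for k
    using that completely_alternating_prepend_mono[of _ _ "Suc \<kappa>" "Suc k"]
    by (simp only: power_mass_Trunk[OF nz that] completely_alternating_cmult_iff[OF trunk_prod_pos[OF nz that]] Suc_le_mono)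
  have branch_CA: "completely_alternating (\<lambda>n. enn2real (power_mass \<eta> \<kappa> lam n (Branch i (Suc j))))" if i: "i \<in> J \<eta>" for i j
  proof -
    have "completely_alternating (branch_prod lam i)"
      using rep[OF i] completely_alternating_iff_representing_measure by blast
    thus ?thesis
      unfolding mass_branch[OF i] by (intro completely_alternating_cmult completely_alternating_shift) simp_all
  qed
  \<comment> \<open>One bound for each kind of vertex: 1 + max C 0 for branches, where consecutive
    terms of \<open>unit_sequence\<close> have ratio at most 1 + \<tau>_i([0,1]) because the terms
    are at least 1; \<open>weight_mass\<close> for the vertex 0; the sum for the rest of the
    trunk.\<close>
  define D where "D = 1 + max C 0 + enn2real (weight_mass \<eta> t) + (\<Sum>k<\<kappa>. sqmod lam (Trunk (- int k)))"
  have D_sum: "0 \<le> (\<Sum>k<\<kappa>. sqmod lam (Trunk (- int k)))" by (simp add: sum_nonneg)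
  have bound: "power_mass \<eta> \<kappa> lam 1 u \<le> ennreal D" if "u \<in> ?V" for u
    using that
  proof (cases rule: tree_vertex_cases)
    case (trunk k)
    show ?thesis
    proof (cases k)
      case 0
      have "power_mass \<eta> \<kappa> lam 1 u = weight_mass \<eta> t"
        using weight_mass_eq_power_mass[of \<eta> \<kappa> lam] trunk(2) 0 by (simp add: t_def)
      also have "\<dots> = ennreal (enn2real (weight_mass \<eta> t))" using fin by (simp add: ennreal_enn2real)
      also have "\<dots> \<le> ennreal D"
        using D_sum max.cobounded2[of 0 C] unfolding D_def by (intro ennreal_leI) linarith
      finally show ?thesis .
    next
      case (Suc l)
      hence l: "l < \<kappa>" using trunk(1) by simp
      have "power_mass \<eta> \<kappa> lam 1 u = ennreal (sqmod lam (Trunk (- int l)))"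
        using power_mass_Trunk_Suc[OF l, of \<eta> lam 0] trunk(2) Suc by (simp del: power_mass.simps(2))
      moreover have "sqmod lam (Trunk (- int l)) \<le> (\<Sum>k<\<kappa>. sqmod lam (Trunk (- int k)))"
        using l by (intro member_le_sum) auto
      hence "sqmod lam (Trunk (- int l)) \<le> D"
        using enn2real_nonneg[of "weight_mass \<eta> t"] max.cobounded2[of 0 C] unfolding D_def by linarith
      ultimately show ?thesis by (simp only: ennreal_leI)
    qed
  next
    case (branch i j)
    note i = \<tau>[OF branch(1)] \<tau>fin[OF branch(1)]
    have "ennreal (measure (\<tau> i) {0..1}) \<le> ennreal C"
      using C[OF branch(1)] by (simp add: finite_measure.emeasure_eq_measure[OF i(2)])
    hence "measure (\<tau> i) {0..1} \<le> max C 0"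
      by (cases "C \<ge> 0") (auto simp: ennreal_neg measure_nonneg max_def)
    moreover have ge: "1 \<le> unit_sequence (\<tau> i) j" by (rule unit_sequence_ge_1[OF i])
    moreover have "unit_sequence (\<tau> i) (Suc j) \<le> unit_sequence (\<tau> i) j + measure (\<tau> i) {0..1}"
      using unit_sequence_Suc[OF i, of j] integral_power_bounds(2)[OF i, of j] by simp
    ultimately have "unit_sequence (\<tau> i) (Suc j) \<le> unit_sequence (\<tau> i) j + max C 0 * 1" by simp
    also have "max C 0 * 1 \<le> max C 0 * unit_sequence (\<tau> i) j" using ge by (intro mult_left_mono) auto
    finally have "unit_sequence (\<tau> i) (Suc j) / unit_sequence (\<tau> i) j \<le> 1 + max C 0"
      using ge by (simp add: divide_le_eq algebra_simps)
    also have "\<dots> \<le> D" using D_sum enn2real_nonneg[of "weight_mass \<eta> t"] unfolding D_def by linarith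
    finally show ?thesis
      unfolding branch(2) mass_branch'[OF branch(1)] by (intro ennreal_leI) (simp add: br[OF branch(1)])
  qed
  have CH: "completely_hyperexpansive ?V ?S"
    unfolding completely_hyperexpansive_weighted_shift_iff
  proof (intro conjI exI ballI)
    fix u assume u: "u \<in> ?V"
    thus "power_mass \<eta> \<kappa> lam 1 u \<le> ennreal D" by (rule bound)
    from u show "completely_alternating (\<lambda>n. enn2real (power_mass \<eta> \<kappa> lam n u))"
      by (cases rule: tree_vertex_cases) (simp_all only: trunk_CA branch_CA)
  qed
  hence S: "?S \<in> bounded_operators ?V" by (simp add: completely_hyperexpansive_def)
  have "vertex_measure ?V ?S (Branch i 1) = \<tau> i" if i: "i \<in> J \<eta>" for i
  proof -
    have v: "Branch i 1 \<in> ?V" using i by (simp add: Branch_tree_iff)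
    have "(\<lambda>n. enn2real (power_mass \<eta> \<kappa> lam n (Branch i 1))) = branch_prod lam i"
      using power_mass_Branch_1[OF i, of \<kappa> lam] by (simp add: fun_eq_iff)
    thus ?thesis
      using representing_measure_eqI[OF rep[OF i]] by (simp only: vertex_measure_weighted_shift[OF S v])
  qed
  with CH show "has_vertex_measures \<eta> \<kappa> \<tau> lam" by (simp add: has_vertex_measures_def)
qed

section \<open>Parameters of completely hyperexpansive shifts\<close>

lemma inv_moment_mono: "k \<le> k' \<Longrightarrow> inv_moment M k \<le> inv_moment M k'"
  unfolding inv_moment_def by (intro nn_integral_mono sum_mono2) auto

lemma weight_inv_moment_mono: "k \<le> k' \<Longrightarrow> weight_inv_moment \<eta> \<tau> t k \<le> weight_inv_moment \<eta> \<tau> t k'"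
  unfolding weight_inv_moment_def by (intro nn_integral_mono mult_left_mono inv_moment_mono) auto

lemma U_set_iff:
  "t \<in> U_set \<eta> \<kappa> \<tau> \<longleftrightarrow> t \<in> (\<Pi>\<^sub>E i\<in>J \<eta>. {0<..}) \<and> weight_mass \<eta> t < \<infinity> \<and>
     (if \<kappa> = 0 then 1 + weight_inv_moment \<eta> \<tau> t 1 \<le> weight_mass \<eta> t
      else weight_mass \<eta> t = 1 + weight_inv_moment \<eta> \<tau> t 1) \<and>
     weight_inv_moment \<eta> \<tau> t (Suc \<kappa>) < weight_mass \<eta> t"
  by (simp add: U_set_def weight_mass_def weight_inv_moment_def nn_integral_count_space_nat_eq_infsum)

text \<open>Since t_i > 0, finiteness of the weighted sum makes every
  \<open>inv_moment (\<tau> i) k\<close> finite; \<open>enn2real\<close> then loses nothing and both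
  series converge separately.\<close>

lemma zeta_eq_diff:
  assumes pos: "\<And>i. i \<in> J \<eta> \<Longrightarrow> 0 < t i" and fin: "weight_mass \<eta> t < \<infinity>"
    and le: "weight_inv_moment \<eta> \<tau> t k \<le> weight_mass \<eta> t"
  shows "zeta \<eta> \<tau> t k = enn2real (weight_mass \<eta> t) - enn2real (weight_inv_moment \<eta> \<tau> t k)"
proof -
  let ?f = "\<lambda>i. (t i)\<^sup>2" and ?g = "\<lambda>i. (t i)\<^sup>2 * enn2real (inv_moment (\<tau> i) k)"
  have K: "weight_inv_moment \<eta> \<tau> t k < \<infinity>" using le fin by (rule order_le_less_trans)
  have g: "ennreal (?g i) = ennreal ((t i)\<^sup>2) * inv_moment (\<tau> i) k" if i: "i \<in> J \<eta>" for i
  proof -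
    have "ennreal ((t i)\<^sup>2) * inv_moment (\<tau> i) k \<le> weight_inv_moment \<eta> \<tau> t k"
      unfolding weight_inv_moment_def using i
      by (rule nn_integral_ge_point[where p="\<lambda>i. ennreal ((t i)\<^sup>2) * inv_moment (\<tau> i) k"])
    hence "ennreal ((t i)\<^sup>2) * inv_moment (\<tau> i) k \<noteq> \<top>" using K by (auto simp: top_unique)
    hence "inv_moment (\<tau> i) k \<noteq> \<top>" using pos[OF i] by (auto simp: ennreal_mult_eq_top_iff)
    thus ?thesis by (simp add: ennreal_mult ennreal_enn2real less_top)
  qed
  have int_f: "(\<integral>\<^sup>+ i. ennreal (?f i) \<partial>count_space (J \<eta>)) = weight_mass \<eta> t"
    by (simp add: weight_mass_def)
  have int_g: "(\<integral>\<^sup>+ i. ennreal (?g i) \<partial>count_space (J \<eta>)) = weight_inv_moment \<eta> \<tau> t k"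
    unfolding weight_inv_moment_def by (rule nn_integral_cong) (simp add: g)
  have sf: "?f summable_on J \<eta>"
    by (subst summable_on_iff_nn_integral_finite) (use fin int_f in simp_all)
  have sg: "?g summable_on J \<eta>"
    by (subst summable_on_iff_nn_integral_finite) (use K int_g in simp_all)
  have f: "enn2real (weight_mass \<eta> t) = (\<Sum>\<^sub>\<infinity>i\<in>J \<eta>. ?f i)"
    using ennreal_infsum_eq_nn_integral[OF _ sf] int_f by (metis enn2real_ennreal infsum_nonneg zero_le_power2)
  have "ennreal (\<Sum>\<^sub>\<infinity>i\<in>J \<eta>. ?g i) = weight_inv_moment \<eta> \<tau> t k"
    using ennreal_infsum_eq_nn_integral[OF _ sg] int_g by simp
  moreover have "0 \<le> (\<Sum>\<^sub>\<infinity>i\<in>J \<eta>. ?g i)" by (rule infsum_nonneg) simp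
  ultimately have g: "enn2real (weight_inv_moment \<eta> \<tau> t k) = (\<Sum>\<^sub>\<infinity>i\<in>J \<eta>. ?g i)"
    by (metis enn2real_ennreal)
  have "zeta \<eta> \<tau> t k = (\<Sum>\<^sub>\<infinity>i\<in>J \<eta>. ?f i + - ?g i)"
    unfolding zeta_def by (rule infsum_cong) (simp add: algebra_simps)
  also have "\<dots> = (\<Sum>\<^sub>\<infinity>i\<in>J \<eta>. ?f i) + (\<Sum>\<^sub>\<infinity>i\<in>J \<eta>. - ?g i)"
    using sf sg by (intro infsum_add) (simp_all add: summable_on_uminus)
  finally show ?thesis by (simp add: f g infsum_uminus)
qed

lemma zeta_comparisons:
  assumes pos: "\<And>i. i \<in> J \<eta> \<Longrightarrow> 0 < t i" and fin: "weight_mass \<eta> t < \<infinity>"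
    and le: "weight_inv_moment \<eta> \<tau> t k \<le> weight_mass \<eta> t" and "0 \<le> c"
  shows "weight_inv_moment \<eta> \<tau> t k + ennreal c = weight_mass \<eta> t \<longleftrightarrow> zeta \<eta> \<tau> t k = c"
    and "weight_inv_moment \<eta> \<tau> t k + ennreal c \<le> weight_mass \<eta> t \<longleftrightarrow> c \<le> zeta \<eta> \<tau> t k"
    and "weight_inv_moment \<eta> \<tau> t k < weight_mass \<eta> t \<longleftrightarrow> 0 < zeta \<eta> \<tau> t k"
proof -
  have K: "weight_inv_moment \<eta> \<tau> t k < \<infinity>" using le fin by (rule order_le_less_trans)
  obtain x where x: "weight_inv_moment \<eta> \<tau> t k = ennreal x" "0 \<le> x" using K by (cases rule: ennreal_cases) auto
  obtain y where y: "weight_mass \<eta> t = ennreal y" "0 \<le> y" using fin by (cases rule: ennreal_cases) auto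
  have z: "zeta \<eta> \<tau> t k = y - x" using zeta_eq_diff[OF pos fin le] x y by simp
  show "weight_inv_moment \<eta> \<tau> t k + ennreal c = weight_mass \<eta> t \<longleftrightarrow> zeta \<eta> \<tau> t k = c"
    and "weight_inv_moment \<eta> \<tau> t k + ennreal c \<le> weight_mass \<eta> t \<longleftrightarrow> c \<le> zeta \<eta> \<tau> t k"
    and "weight_inv_moment \<eta> \<tau> t k < weight_mass \<eta> t \<longleftrightarrow> 0 < zeta \<eta> \<tau> t k"
    using x y z \<open>0 \<le> c\<close> by (auto simp: ennreal_less_iff simp flip: ennreal_plus)
qed

text \<open>The strict inequality is implicit on the left in \<open>0 < c \<kappa>\<close>; stated
  separately, it is the last condition of \<open>U_set\<close>. If even the weak inequality fails,
  both sides are false, so \<open>zeta\<close> is compared only where the integrals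
  converge.\<close>

lemma trunk_conditions_iff_zeta:
  assumes pos: "\<And>i. i \<in> J \<eta> \<Longrightarrow> 0 < t i" and fin: "weight_mass \<eta> t < \<infinity>"
    and c: "\<And>j. j \<le> \<kappa> \<Longrightarrow> 0 < c j"
  shows "(\<forall>j<\<kappa>. weight_inv_moment \<eta> \<tau> t (Suc j) + ennreal (c j) = weight_mass \<eta> t) \<and>
      weight_inv_moment \<eta> \<tau> t (Suc \<kappa>) + ennreal (c \<kappa>) \<le> weight_mass \<eta> t \<longleftrightarrow>
    weight_inv_moment \<eta> \<tau> t (Suc \<kappa>) < weight_mass \<eta> t \<and>
      (\<forall>j<\<kappa>. zeta \<eta> \<tau> t (Suc j) = c j) \<and> c \<kappa> \<le> zeta \<eta> \<tau> t (Suc \<kappa>)"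
proof (cases "weight_inv_moment \<eta> \<tau> t (Suc \<kappa>) \<le> weight_mass \<eta> t")
  case True
  have "weight_inv_moment \<eta> \<tau> t (Suc j) \<le> weight_mass \<eta> t" if "j \<le> \<kappa>" for j
    using weight_inv_moment_mono[of "Suc j" "Suc \<kappa>" \<eta> \<tau> t] True that by auto
  hence "weight_inv_moment \<eta> \<tau> t (Suc j) + ennreal (c j) = weight_mass \<eta> t \<longleftrightarrow> zeta \<eta> \<tau> t (Suc j) = c j"
    if "j < \<kappa>" for j
    using that c[of j] by (intro zeta_comparisons(1)[OF pos fin]) auto
  moreover have "weight_inv_moment \<eta> \<tau> t (Suc \<kappa>) + ennreal (c \<kappa>) \<le> weight_mass \<eta> t \<longleftrightarrow> c \<kappa> \<le> zeta \<eta> \<tau> t (Suc \<kappa>)"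
    using c[of \<kappa>] by (intro zeta_comparisons(2)[OF pos fin True]) auto
  moreover have "weight_inv_moment \<eta> \<tau> t (Suc \<kappa>) < weight_mass \<eta> t \<longleftrightarrow> 0 < zeta \<eta> \<tau> t (Suc \<kappa>)"
    by (rule zeta_comparisons(3)[OF pos fin True order_refl])
  ultimately show ?thesis using c[of \<kappa>] by auto
next
  case False
  have "weight_inv_moment \<eta> \<tau> t (Suc \<kappa>) \<le> weight_inv_moment \<eta> \<tau> t (Suc \<kappa>) + ennreal (c \<kappa>)" by simp
  with False show ?thesis by (metis less_imp_le order_trans)
qed

lemma U_set_zeta:
  assumes "t \<in> U_set \<eta> \<kappa> \<tau>"
  shows "k \<le> Suc \<kappa> \<Longrightarrow> 0 < zeta \<eta> \<tau> t k" and "0 < \<kappa> \<Longrightarrow> zeta \<eta> \<tau> t 1 = 1"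
proof -
  have pos: "\<And>i. i \<in> J \<eta> \<Longrightarrow> 0 < t i" using assms by (auto simp: U_set_iff)
  have fin: "weight_mass \<eta> t < \<infinity>" using assms by (simp add: U_set_iff)
  have less: "weight_inv_moment \<eta> \<tau> t k < weight_mass \<eta> t" if "k \<le> Suc \<kappa>" for k
    using weight_inv_moment_mono[OF that, of \<eta> \<tau> t] assms by (auto simp: U_set_iff)
  show "0 < zeta \<eta> \<tau> t k" if "k \<le> Suc \<kappa>"
    using zeta_comparisons(3)[OF pos fin less_imp_le[OF less[OF that]] order_refl] less[OF that] by simp
  show "zeta \<eta> \<tau> t 1 = 1" if "0 < \<kappa>"
    using zeta_comparisons(1)[OF pos fin less_imp_le[OF less], of 1 1] assms that
    by (simp add: U_set_iff add.commute)
qed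

lemma U_set_iff_zeta:
  assumes pos: "t \<in> (\<Pi>\<^sub>E i\<in>J \<eta>. {0<..})" and fin: "weight_mass \<eta> t < \<infinity>"
    and less: "weight_inv_moment \<eta> \<tau> t (Suc \<kappa>) < weight_mass \<eta> t"
  shows "t \<in> U_set \<eta> \<kappa> \<tau> \<longleftrightarrow> (if \<kappa> = 0 then 1 \<le> zeta \<eta> \<tau> t 1 else zeta \<eta> \<tau> t 1 = 1)"
proof -
  have pos': "\<And>i. i \<in> J \<eta> \<Longrightarrow> 0 < t i" using pos by auto
  have "weight_inv_moment \<eta> \<tau> t 1 \<le> weight_mass \<eta> t"
    using weight_inv_moment_mono[of 1 "Suc \<kappa>" \<eta> \<tau> t] less by auto
  from zeta_comparisons(1,2)[OF pos' fin this, of 1] show ?thesis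
    using assms by (auto simp: U_set_iff add.commute)
qed

section \<open>Solving the equations for the weights\<close>

lemma branch_weight_eq:
  assumes "borel_measure_on_unit (\<tau> i)" "finite_measure (\<tau> i)"
  shows "branch_weight \<tau> t i (Suc (Suc j)) = sqrt (unit_sequence (\<tau> i) (Suc j) / unit_sequence (\<tau> i) j)"
proof (cases j)
  case 0
  thus ?thesis by (simp add: branch_weight_def unit_sequence_def space_unit_measure[OF assms(1)])
next
  case (Suc l)
  have "{0..n} = {..<Suc n}" for n :: nat by auto
  thus ?thesis using Suc by (simp add: branch_weight_def unit_sequence_def)
qed

lemma branch_prod_eq_unit_sequence_iff:
  assumes \<tau>: "borel_measure_on_unit (\<tau> i)" "finite_measure (\<tau> i)"
  shows "(\<forall>n. branch_prod lam i n = unit_sequence (\<tau> i) n) \<longleftrightarrow>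
     (\<forall>j. cmod (lam (Branch i (Suc (Suc j)))) = branch_weight \<tau> t i (Suc (Suc j)))"
proof -
  let ?u = "unit_sequence (\<tau> i)"
  have u: "?u n > 0" for n using unit_sequence_ge_1[OF \<tau>, of n] by simp
  have sq: "cmod (lam (Branch i (Suc (Suc j)))) = branch_weight \<tau> t i (Suc (Suc j)) \<longleftrightarrow>
      sqmod lam (Branch i (Suc (Suc j))) = ?u (Suc j) / ?u j" for j
    unfolding branch_weight_eq[where \<tau>=\<tau> and i=i, OF \<tau>] sqmod_def using u[of j] u[of "Suc j"]
    by (metis divide_pos_pos less_imp_le norm_ge_zero real_sqrt_pow2 real_sqrt_unique)
  have step: "branch_prod lam i (Suc n) = branch_prod lam i n * sqmod lam (Branch i (Suc (Suc n)))" for n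
    by (simp add: branch_prod_def)
  show ?thesis
    unfolding sq
  proof
    assume eq: "\<forall>n. branch_prod lam i n = ?u n"
    show "\<forall>j. sqmod lam (Branch i (Suc (Suc j))) = ?u (Suc j) / ?u j"
    proof
      fix j
      have "?u (Suc j) = ?u j * sqmod lam (Branch i (Suc (Suc j)))" using step[of j] eq by simp
      thus "sqmod lam (Branch i (Suc (Suc j))) = ?u (Suc j) / ?u j" using u[of j] by simp
    qed
  next
    assume eq: "\<forall>j. sqmod lam (Branch i (Suc (Suc j))) = ?u (Suc j) / ?u j"
    show "\<forall>n. branch_prod lam i n = ?u n"
    proof
      fix n
      show "branch_prod lam i n = ?u n"
      proof (induction n)
        case 0
        show ?case by (simp add: branch_prod_def unit_sequence_def)
      next
        case (Suc n)
        thus ?case using eq u[of n] by (simp add: step)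
      qed
    qed
  qed
qed

text \<open>To be used with z = \<open>zeta\<close> and q j the squared weight at -j: dividing
  consecutive equations isolates q j, and the empty product at j = 0 gives z 1 = 1.\<close>

lemma reciprocal_prod_iff_ratio:
  fixes z q :: "nat \<Rightarrow> real"
  assumes "\<And>j. j \<le> m \<Longrightarrow> 0 < z (Suc j)" "\<And>j. j < m \<Longrightarrow> 0 < q j"
  shows "(\<forall>j\<le>m. z (Suc j) = 1 / (\<Prod>l<j. q l)) \<longleftrightarrow>
     z 1 = 1 \<and> (\<forall>j<m. q j = z (Suc j) / z (Suc (Suc j)))"
  using assms
proof (induction m)
  case 0
  show ?case by simp
next
  case (Suc m)
  have p: "0 < (\<Prod>l<m. q l)" using Suc.prems(2) by (intro prod_pos) auto
  have last: "z (Suc (Suc m)) = 1 / (\<Prod>l<Suc m. q l) \<longleftrightarrow> q m = z (Suc m) / z (Suc (Suc m))"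
    if "z (Suc m) = 1 / (\<Prod>l<m. q l)"
  proof -
    define P where "P = (\<Prod>l<m. q l)"
    have "P > 0" using p by (simp add: P_def)
    moreover have "(\<Prod>l<Suc m. q l) = P * q m" by (simp add: P_def)
    ultimately show ?thesis
      unfolding that P_def[symmetric] using Suc.prems(1)[of "Suc m"] Suc.prems(2)[of m]
      by (auto simp: field_simps)
  qed
  let ?P = "\<lambda>j. z (Suc j) = 1 / (\<Prod>l<j. q l)" and ?Q = "\<lambda>j. q j = z (Suc j) / z (Suc (Suc j))"
  have IH: "(\<forall>j\<le>m. ?P j) \<longleftrightarrow> z 1 = 1 \<and> (\<forall>j<m. ?Q j)"
    using Suc.prems by (intro Suc.IH) auto
  have "(\<forall>j\<le>Suc m. ?P j) \<longleftrightarrow> (\<forall>j\<le>m. ?P j) \<and> ?P (Suc m)"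
    using le_Suc_eq by metis
  also have "\<dots> \<longleftrightarrow> (\<forall>j\<le>m. ?P j) \<and> ?Q m" using last by blast
  also have "\<dots> \<longleftrightarrow> z 1 = 1 \<and> (\<forall>j<Suc m. ?Q j)" unfolding IH using less_Suc_eq by metis
  finally show ?case .
qed

text \<open>With \<zeta>_1 = 1 the separate formula for k = 0 becomes the general one.\<close>

lemma trunk_weight_eq:
  assumes "zeta \<eta> \<tau> t 1 = 1"
  shows "trunk_weight \<eta> \<tau> t k = sqrt (zeta \<eta> \<tau> t (Suc k) / zeta \<eta> \<tau> t (Suc (Suc k)))"
  using assms by (simp add: trunk_weight_def real_sqrt_divide numeral_2_eq_2)

text \<open>Here \<kappa> = m + 1. The equations fix the weights at 0, ..., -m + 1; the inequality
  says that \<zeta>_(m+1) divided by the squared weight at -m, the child of the root, is at most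
  \<zeta>_(m+2).\<close>

lemma trunk_prod_zeta_iff:
  assumes nz: "nonzero_weights \<eta> (Suc m) lam" and z: "\<And>j. j \<le> Suc m \<Longrightarrow> 0 < zeta \<eta> \<tau> t (Suc j)"
  shows "(\<forall>j<Suc m. zeta \<eta> \<tau> t (Suc j) = 1 / trunk_prod lam j) \<and> 1 / trunk_prod lam (Suc m) \<le> zeta \<eta> \<tau> t (Suc (Suc m)) \<longleftrightarrow>
     zeta \<eta> \<tau> t 1 = 1 \<and> (\<forall>j<m. cmod (lam (Trunk (- int j))) = trunk_weight \<eta> \<tau> t j) \<and>
     sqrt (zeta \<eta> \<tau> t (Suc m) / zeta \<eta> \<tau> t (Suc (Suc m))) \<le> cmod (lam (Trunk (- int m)))"
proof -
  let ?z = "zeta \<eta> \<tau> t" and ?q = "\<lambda>j. sqmod lam (Trunk (- int j))"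
  have q: "0 < ?q j" if "j \<le> m" for j
    using nz that by (simp add: nonzero_weights_def sqmod_def Trunk_nonroot_iff)
  have chain: "(\<forall>j<Suc m. ?z (Suc j) = 1 / trunk_prod lam j) \<longleftrightarrow>
      ?z 1 = 1 \<and> (\<forall>j<m. ?q j = ?z (Suc j) / ?z (Suc (Suc j)))"
    unfolding trunk_prod_def less_Suc_eq_le
    by (rule reciprocal_prod_iff_ratio) (use z q in auto)
  have eq: "?q j = ?z (Suc j) / ?z (Suc (Suc j)) \<longleftrightarrow> cmod (lam (Trunk (- int j))) = trunk_weight \<eta> \<tau> t j"
    if "?z 1 = 1" "j < m" for j
    unfolding trunk_weight_eq[OF that(1)] sqmod_def using z[of j] z[of "Suc j"] that(2)
    by (metis Suc_leI Suc_lessD divide_pos_pos less_SucI less_imp_le norm_ge_zero real_sqrt_pow2 real_sqrt_unique)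
  have last: "1 / trunk_prod lam (Suc m) \<le> ?z (Suc (Suc m)) \<longleftrightarrow>
      sqrt (?z (Suc m) / ?z (Suc (Suc m))) \<le> cmod (lam (Trunk (- int m)))"
    if "?z (Suc m) = 1 / trunk_prod lam m"
  proof -
    have "1 / trunk_prod lam (Suc m) = ?z (Suc m) / ?q m"
      using that by (simp add: trunk_prod_def)
    moreover have "?z (Suc m) / ?q m \<le> ?z (Suc (Suc m)) \<longleftrightarrow> ?z (Suc m) / ?z (Suc (Suc m)) \<le> ?q m"
      using q[of m] z[of "Suc m"] by (simp add: field_simps)
    ultimately have "1 / trunk_prod lam (Suc m) \<le> ?z (Suc (Suc m)) \<longleftrightarrow> ?z (Suc m) / ?z (Suc (Suc m)) \<le> ?q m" by simp
    also have "\<dots> \<longleftrightarrow> sqrt (?z (Suc m) / ?z (Suc (Suc m))) \<le> sqrt (?q m)" by simp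
    finally show ?thesis by (simp add: sqmod_def)
  qed
  have "(\<forall>j<Suc m. ?z (Suc j) = 1 / trunk_prod lam j) \<and> 1 / trunk_prod lam (Suc m) \<le> ?z (Suc (Suc m)) \<longleftrightarrow>
      (\<forall>j<Suc m. ?z (Suc j) = 1 / trunk_prod lam j) \<and>
      sqrt (?z (Suc m) / ?z (Suc (Suc m))) \<le> cmod (lam (Trunk (- int m)))"
    using last by blast
  thus ?thesis using chain eq by auto
qed

text \<open>For \<kappa> = 0 the exempted vertex is \<open>Trunk 1\<close>, which lies outside the
  tree, so one formulation serves all \<kappa>.\<close>

lemma nonroot_conditions_iff:
  "(\<forall>v\<in>nonroot_vertices \<eta> \<kappa>. v \<noteq> Trunk (- int \<kappa> + 1) \<longrightarrow> P v) \<longleftrightarrow>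
     (\<forall>i\<in>J \<eta>. P (Branch i 1)) \<and> (\<forall>i\<in>J \<eta>. \<forall>j. P (Branch i (Suc (Suc j)))) \<and>
     (\<forall>j. Suc j < \<kappa> \<longrightarrow> P (Trunk (- int j)))"
proof
  assume "\<forall>v\<in>nonroot_vertices \<eta> \<kappa>. v \<noteq> Trunk (- int \<kappa> + 1) \<longrightarrow> P v"
  thus "(\<forall>i\<in>J \<eta>. P (Branch i 1)) \<and> (\<forall>i\<in>J \<eta>. \<forall>j. P (Branch i (Suc (Suc j)))) \<and>
     (\<forall>j. Suc j < \<kappa> \<longrightarrow> P (Trunk (- int j)))"
    by (auto simp: Branch_nonroot_iff Trunk_nonroot_iff)
next
  assume R: "(\<forall>i\<in>J \<eta>. P (Branch i 1)) \<and> (\<forall>i\<in>J \<eta>. \<forall>j. P (Branch i (Suc (Suc j)))) \<and>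
     (\<forall>j. Suc j < \<kappa> \<longrightarrow> P (Trunk (- int j)))"
  show "\<forall>v\<in>nonroot_vertices \<eta> \<kappa>. v \<noteq> Trunk (- int \<kappa> + 1) \<longrightarrow> P v"
  proof (intro ballI impI)
    fix v assume v: "v \<in> nonroot_vertices \<eta> \<kappa>" "v \<noteq> Trunk (- int \<kappa> + 1)"
    from v(1) show "P v"
    proof (cases rule: parent_cases)
      case (trunk k)
      hence "Suc k < \<kappa>" using v(2) by (cases "Suc k = \<kappa>") auto
      thus ?thesis using R trunk(2) by blast
    qed (use R in auto)
  qed
qed

text \<open>The common criterion from which bijectivity, the bound next to the root and extremality
  are read off. It involves only moduli of weights.\<close>

theorem has_vertex_measures_iff_U_set:
  assumes nz: "nonzero_weights \<eta> \<kappa> lam"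
    and bounded: "\<forall>i\<in>J \<eta>. borel_measure_on_unit (\<tau> i) \<and> emeasure (\<tau> i) {0..1} \<le> ennreal C"
  defines "t \<equiv> first_weights \<eta> lam"
  shows "has_vertex_measures \<eta> \<kappa> \<tau> lam \<longleftrightarrow> t \<in> U_set \<eta> \<kappa> \<tau> \<and>
     (\<forall>v\<in>nonroot_vertices \<eta> \<kappa>. v \<noteq> Trunk (- int \<kappa> + 1) \<longrightarrow> cmod (lam v) = Phi_weights \<eta> \<tau> t v) \<and>
     (1 \<le> \<kappa> \<longrightarrow> sqrt (zeta \<eta> \<tau> t \<kappa> / zeta \<eta> \<tau> t (\<kappa> + 1)) \<le> cmod (lam (Trunk (- int \<kappa> + 1))))"
proof -
  have \<tau>: "borel_measure_on_unit (\<tau> i)" and C: "emeasure (\<tau> i) {0..1} \<le> ennreal C" if "i \<in> J \<eta>" for i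
    using bounded that by auto
  have \<tau>fin: "finite_measure (\<tau> i)" if "i \<in> J \<eta>" for i
    using \<tau>[OF that] C[OF that] by (rule finite_measure_if_bounded)
  have pos: "t \<in> (\<Pi>\<^sub>E i\<in>J \<eta>. {0<..})"
    using nz by (auto simp: t_def first_weights_def nonzero_weights_def Branch_nonroot_iff)
  hence pos': "\<And>i. i \<in> J \<eta> \<Longrightarrow> 0 < t i" by auto
  have branches: "(\<forall>i\<in>J \<eta>. \<forall>n. branch_prod lam i n = unit_sequence (\<tau> i) n) \<longleftrightarrow>
      (\<forall>i\<in>J \<eta>. \<forall>j. cmod (lam (Branch i (Suc (Suc j)))) = Phi_weights \<eta> \<tau> t (Branch i (Suc (Suc j))))"
    using branch_prod_eq_unit_sequence_iff[where \<tau>=\<tau> and lam=lam and t=t, OF \<tau> \<tau>fin] by (simp add: Phi_weights_def)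
  have first: "cmod (lam (Branch i 1)) = Phi_weights \<eta> \<tau> t (Branch i 1)" if "i \<in> J \<eta>" for i
    using that by (simp add: Phi_weights_def branch_weight_def t_def first_weights_def)
  have trunk: "weight_mass \<eta> t < \<infinity> \<and>
     (\<forall>j<\<kappa>. weight_inv_moment \<eta> \<tau> t (Suc j) + ennreal (1 / trunk_prod lam j) = weight_mass \<eta> t) \<and>
     weight_inv_moment \<eta> \<tau> t (Suc \<kappa>) + ennreal (1 / trunk_prod lam \<kappa>) \<le> weight_mass \<eta> t \<longleftrightarrow>
     t \<in> U_set \<eta> \<kappa> \<tau> \<and>
     (\<forall>j. Suc j < \<kappa> \<longrightarrow> cmod (lam (Trunk (- int j))) = Phi_weights \<eta> \<tau> t (Trunk (- int j))) \<and>
     (1 \<le> \<kappa> \<longrightarrow> sqrt (zeta \<eta> \<tau> t \<kappa> / zeta \<eta> \<tau> t (\<kappa> + 1)) \<le> cmod (lam (Trunk (- int \<kappa> + 1))))"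
    (is "?L \<longleftrightarrow> ?R")
  \<comment> \<open>If either condition fails, both sides are false; if both hold, the
    \<open>zeta\<close> values at 1, ..., \<open>Suc \<kappa>\<close> are positive and the equations
    can be solved.\<close>
  proof (cases "weight_mass \<eta> t < \<infinity> \<and> weight_inv_moment \<eta> \<tau> t (Suc \<kappa>) < weight_mass \<eta> t")
    case False
    have "weight_mass \<eta> t < \<infinity> \<Longrightarrow> ?L \<Longrightarrow> weight_inv_moment \<eta> \<tau> t (Suc \<kappa>) < weight_mass \<eta> t"
      using trunk_conditions_iff_zeta[where c="\<lambda>j. 1 / trunk_prod lam j" and \<kappa>=\<kappa> and \<tau>=\<tau>, OF pos'] trunk_prod_pos[OF nz]
      by simp
    with False show ?thesis by (auto simp: U_set_iff)
  next
    case True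
    hence fin: "weight_mass \<eta> t < \<infinity>" and less: "weight_inv_moment \<eta> \<tau> t (Suc \<kappa>) < weight_mass \<eta> t" by auto
    have z: "0 < zeta \<eta> \<tau> t (Suc j)" if "j \<le> \<kappa>" for j
    proof -
      have l: "weight_inv_moment \<eta> \<tau> t (Suc j) < weight_mass \<eta> t"
        using weight_inv_moment_mono[of "Suc j" "Suc \<kappa>" \<eta> \<tau> t] less that by auto
      thus ?thesis using zeta_comparisons(3)[OF pos' fin less_imp_le[OF l] order_refl] by simp
    qed
    have "?L \<longleftrightarrow> (\<forall>j<\<kappa>. zeta \<eta> \<tau> t (Suc j) = 1 / trunk_prod lam j) \<and> 1 / trunk_prod lam \<kappa> \<le> zeta \<eta> \<tau> t (Suc \<kappa>)"
      using trunk_conditions_iff_zeta[where c="\<lambda>j. 1 / trunk_prod lam j" and \<kappa>=\<kappa> and \<tau>=\<tau>, OF pos' fin] trunk_prod_pos[OF nz]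
        less fin by simp
    also have "\<dots> \<longleftrightarrow> ?R"
    proof (cases \<kappa>)
      case 0
      thus ?thesis using U_set_iff_zeta[OF pos fin less] by (simp add: trunk_prod_def)
    next
      case (Suc m)
      have "- int \<kappa> + 1 = - int m" using Suc by simp
      thus ?thesis
        using U_set_iff_zeta[OF pos fin less] trunk_prod_zeta_iff[of \<eta> m lam \<tau> t] nz z Suc
        by (auto simp: Phi_weights_def)
    qed
    finally show ?thesis .
  qed
  have "has_vertex_measures \<eta> \<kappa> \<tau> lam \<longleftrightarrow>
     (\<forall>i\<in>J \<eta>. \<forall>n. branch_prod lam i n = unit_sequence (\<tau> i) n) \<and> weight_mass \<eta> t < \<infinity> \<and>
     (\<forall>j<\<kappa>. weight_inv_moment \<eta> \<tau> t (Suc j) + ennreal (1 / trunk_prod lam j) = weight_mass \<eta> t) \<and>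
     weight_inv_moment \<eta> \<tau> t (Suc \<kappa>) + ennreal (1 / trunk_prod lam \<kappa>) \<le> weight_mass \<eta> t"
    unfolding t_def by (rule has_vertex_measures_iff[OF nz \<tau> C])
  also have "\<dots> \<longleftrightarrow> (\<forall>i\<in>J \<eta>. \<forall>j. cmod (lam (Branch i (Suc (Suc j)))) = Phi_weights \<eta> \<tau> t (Branch i (Suc (Suc j)))) \<and>
     t \<in> U_set \<eta> \<kappa> \<tau> \<and>
     (\<forall>j. Suc j < \<kappa> \<longrightarrow> cmod (lam (Trunk (- int j))) = Phi_weights \<eta> \<tau> t (Trunk (- int j))) \<and>
     (1 \<le> \<kappa> \<longrightarrow> sqrt (zeta \<eta> \<tau> t \<kappa> / zeta \<eta> \<tau> t (\<kappa> + 1)) \<le> cmod (lam (Trunk (- int \<kappa> + 1))))"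
    by (simp only: branches trunk)
  finally show ?thesis
    unfolding nonroot_conditions_iff using first by blast
qed

section \<open>Operators, their weights and extremality\<close>

lemma weighted_shift_cong:
  "(\<And>v. v \<in> nonroot_vertices \<eta> \<kappa> \<Longrightarrow> lam v = lam' v) \<Longrightarrow> weighted_shift \<eta> \<kappa> lam = weighted_shift \<eta> \<kappa> lam'"
proof -
  assume "\<And>v. v \<in> nonroot_vertices \<eta> \<kappa> \<Longrightarrow> lam v = lam' v"
  hence "wshift_fun \<eta> \<kappa> lam = wshift_fun \<eta> \<kappa> lam'" by (auto simp: wshift_fun_def fun_eq_iff)
  thus ?thesis by (simp only: weighted_shift_def)
qed

text \<open>The weight at v is the value at v of the image of the basis vector of its parent;
  boundedness puts that vector into the domain.\<close>

lemma weighted_shift_eq_imp_weights_eq: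
  assumes eq: "weighted_shift \<eta> \<kappa> lam = weighted_shift \<eta> \<kappa> lam'"
    and S: "weighted_shift \<eta> \<kappa> lam \<in> bounded_operators (tree_vertices \<eta> \<kappa>)"
    and v: "v \<in> nonroot_vertices \<eta> \<kappa>"
  shows "lam v = lam' v"
proof -
  have "parent \<eta> \<kappa> v \<in> tree_vertices \<eta> \<kappa>"
    using v by (cases rule: parent_cases) (simp_all add: Trunk_tree_iff Branch_tree_iff)
  hence "basis_vec (parent \<eta> \<kappa> v) \<in> ell2 (tree_vertices \<eta> \<kappa>)" by (rule basis_vec_ell2)
  hence "wshift_fun \<eta> \<kappa> lam (basis_vec (parent \<eta> \<kappa> v)) = wshift_fun \<eta> \<kappa> lam' (basis_vec (parent \<eta> \<kappa> v))"
    using wshift_fun_ell2(2)[OF S] wshift_fun_ell2(2)[of \<eta> \<kappa> lam'] S eq by metis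
  hence "wshift_fun \<eta> \<kappa> lam (basis_vec (parent \<eta> \<kappa> v)) v = wshift_fun \<eta> \<kappa> lam' (basis_vec (parent \<eta> \<kappa> v)) v"
    by simp
  thus ?thesis using v by (simp add: wshift_fun_def basis_vec_def)
qed

lemma root_norm_eq:
  assumes S: "weighted_shift \<eta> (Suc m) lam \<in> bounded_operators (tree_vertices \<eta> (Suc m))"
  shows "root_norm \<eta> (Suc m) lam = cmod (lam (Trunk (- int m)))"
proof -
  let ?V = "tree_vertices \<eta> (Suc m)"
  have r: "tree_root (Suc m) \<in> ?V" unfolding tree_root_def by (simp add: Trunk_tree_iff)
  have "ennreal ((root_norm \<eta> (Suc m) lam)\<^sup>2) = power_mass \<eta> (Suc m) lam 1 (tree_root (Suc m))"
    using ennreal_l2norm_op_pow_basis_vec[OF S r, of 1] by (simp add: root_norm_def op_pow_apply_def)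
  also have "\<dots> = ennreal ((cmod (lam (Trunk (- int m))))\<^sup>2)"
    using power_mass_Trunk_Suc[of m "Suc m" \<eta> lam 0]
    unfolding tree_root_def by (simp add: sqmod_def del: power_mass.simps(2) of_nat_Suc)
  finally have "(root_norm \<eta> (Suc m) lam)\<^sup>2 = (cmod (lam (Trunk (- int m))))\<^sup>2" by simp
  thus ?thesis by (simp add: root_norm_def l2norm_nonneg)
qed

text \<open>The measure at \<open>Branch i 1\<close> depends only on weights further down that
  branch, so competitors in \<open>extremal\<close> inherit it and fall under the same
  criterion.\<close>

lemma has_vertex_measures_if_agree:
  assumes h: "has_vertex_measures \<eta> \<kappa> \<tau> lam"
    and CH: "completely_hyperexpansive (tree_vertices \<eta> \<kappa>) (weighted_shift \<eta> \<kappa> lam')"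
    and agree: "\<And>v. v \<in> nonroot_vertices \<eta> \<kappa> \<Longrightarrow> v \<noteq> Trunk (- int \<kappa> + 1) \<Longrightarrow> lam' v = lam v"
  shows "has_vertex_measures \<eta> \<kappa> \<tau> lam'"
proof -
  let ?V = "tree_vertices \<eta> \<kappa>"
  have S: "weighted_shift \<eta> \<kappa> lam \<in> bounded_operators ?V" "weighted_shift \<eta> \<kappa> lam' \<in> bounded_operators ?V"
    using h CH by (auto simp: has_vertex_measures_def completely_hyperexpansive_def)
  have "vertex_measure ?V (weighted_shift \<eta> \<kappa> lam') (Branch i 1) = vertex_measure ?V (weighted_shift \<eta> \<kappa> lam) (Branch i 1)"
    if i: "i \<in> J \<eta>" for i
  proof -
    have v: "Branch i 1 \<in> ?V" using i by (simp add: Branch_tree_iff)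
    have "branch_prod lam' i n = branch_prod lam i n" for n
      unfolding branch_prod_def sqmod_def using i by (intro prod.cong) (auto simp: agree Branch_nonroot_iff)
    hence "power_mass \<eta> \<kappa> lam' n (Branch i 1) = power_mass \<eta> \<kappa> lam n (Branch i 1)" for n
      using power_mass_Branch_1[OF i] by simp
    thus ?thesis by (simp only: vertex_measure_weighted_shift[OF S(1) v] vertex_measure_weighted_shift[OF S(2) v])
  qed
  thus ?thesis using h CH by (simp add: has_vertex_measures_def)
qed

lemma first_weights_agree:
  assumes "\<And>v. v \<in> nonroot_vertices \<eta> \<kappa> \<Longrightarrow> v \<noteq> Trunk (- int \<kappa> + 1) \<Longrightarrow> lam' v = lam v"
  shows "first_weights \<eta> lam' = first_weights \<eta> lam"
  using assms by (auto simp: first_weights_def Branch_nonroot_iff fun_eq_iff restrict_def)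

lemma mem_V_set_iff:
  assumes "positive_weights \<eta> \<kappa> lam"
  shows "weighted_shift_real \<eta> \<kappa> lam \<in> V_set \<eta> \<kappa> \<tau> \<longleftrightarrow>
     has_vertex_measures \<eta> \<kappa> \<tau> (\<lambda>v. complex_of_real (lam v))"
  using assms by (auto simp: V_set_def has_vertex_measures_def weighted_shift_real_def)

lemma first_weights_of_real:
  assumes "positive_weights \<eta> \<kappa> lam"
  shows "first_weights \<eta> (\<lambda>v. complex_of_real (lam v)) = restrict (\<lambda>i. lam (Branch i 1)) (J \<eta>)"
proof -
  have "\<bar>lam (Branch i 1)\<bar> = lam (Branch i 1)" if "i \<in> J \<eta>" for i
    using assms that by (simp add: positive_weights_def Branch_nonroot_iff less_imp_le)
  thus ?thesis by (auto simp: first_weights_def fun_eq_iff restrict_def)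
qed

lemma nonzero_weights_of_real:
  "positive_weights \<eta> \<kappa> lam \<Longrightarrow> nonzero_weights \<eta> \<kappa> (\<lambda>v. complex_of_real (lam v))"
  by (force simp: positive_weights_def nonzero_weights_def)

lemma mem_V_set_iff_U_set:
  fixes lam :: "vertex \<Rightarrow> real"
  assumes pos: "positive_weights \<eta> \<kappa> lam"
    and \<tau>: "\<forall>i\<in>J \<eta>. borel_measure_on_unit (\<tau> i) \<and> emeasure (\<tau> i) {0..1} \<le> ennreal C"
  defines "t \<equiv> restrict (\<lambda>i. lam (Branch i 1)) (J \<eta>)"
  shows "weighted_shift_real \<eta> \<kappa> lam \<in> V_set \<eta> \<kappa> \<tau> \<longleftrightarrow> t \<in> U_set \<eta> \<kappa> \<tau> \<and>
     (\<forall>v\<in>nonroot_vertices \<eta> \<kappa>. v \<noteq> Trunk (- int \<kappa> + 1) \<longrightarrow> lam v = Phi_weights \<eta> \<tau> t v) \<and>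
     (1 \<le> \<kappa> \<longrightarrow> sqrt (zeta \<eta> \<tau> t \<kappa> / zeta \<eta> \<tau> t (\<kappa> + 1)) \<le> lam (Trunk (- int \<kappa> + 1)))"
proof -
  have c: "cmod (complex_of_real (lam v)) = lam v" if "v \<in> nonroot_vertices \<eta> \<kappa>" for v
    using pos that by (simp add: positive_weights_def less_imp_le)
  have "Trunk (- int \<kappa> + 1) \<in> nonroot_vertices \<eta> \<kappa>" if "1 \<le> \<kappa>"
    using that by (simp add: Trunk_nonroot_iff)
  note c' = c[OF this]
  have "weighted_shift_real \<eta> \<kappa> lam \<in> V_set \<eta> \<kappa> \<tau> \<longleftrightarrow> t \<in> U_set \<eta> \<kappa> \<tau> \<and>
     (\<forall>v\<in>nonroot_vertices \<eta> \<kappa>. v \<noteq> Trunk (- int \<kappa> + 1) \<longrightarrow> cmod (complex_of_real (lam v)) = Phi_weights \<eta> \<tau> t v) \<and>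
     (1 \<le> \<kappa> \<longrightarrow> sqrt (zeta \<eta> \<tau> t \<kappa> / zeta \<eta> \<tau> t (\<kappa> + 1)) \<le> cmod (complex_of_real (lam (Trunk (- int \<kappa> + 1)))))"
    unfolding mem_V_set_iff[OF pos] t_def first_weights_of_real[OF pos, symmetric]
    by (rule has_vertex_measures_iff_U_set[OF nonzero_weights_of_real[OF pos] \<tau>])
  thus ?thesis using c c' by (simp only: cong: conj_cong ball_cong imp_cong)
qed

lemma Phi_weights_pos:
  assumes t: "t \<in> U_set \<eta> \<kappa> \<tau>"
    and \<tau>: "\<forall>i\<in>J \<eta>. borel_measure_on_unit (\<tau> i) \<and> emeasure (\<tau> i) {0..1} \<le> ennreal C"
  shows "positive_weights \<eta> \<kappa> (Phi_weights \<eta> \<tau> t)"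
  unfolding positive_weights_def
proof
  fix v assume "v \<in> nonroot_vertices \<eta> \<kappa>"
  thus "0 < Phi_weights \<eta> \<tau> t v"
  proof (cases rule: parent_cases)
    case (trunk k)
    have "0 < zeta \<eta> \<tau> t (Suc k)" "0 < zeta \<eta> \<tau> t (Suc (Suc k))"
      using trunk(1) by (auto intro!: U_set_zeta(1)[OF t])
    thus ?thesis
      using trunk U_set_zeta(2)[OF t] by (simp add: Phi_weights_def trunk_weight_eq)
  next
    case (first i)
    thus ?thesis using t by (auto simp: Phi_weights_def branch_weight_def U_set_iff)
  next
    case (branch i j)
    have i: "borel_measure_on_unit (\<tau> i)" "finite_measure (\<tau> i)"
      using \<tau> branch(1) finite_measure_if_bounded[of "\<tau> i" C] by auto
    have "0 < unit_sequence (\<tau> i) n" for n using unit_sequence_ge_1[OF i, of n] by simp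
    thus ?thesis using branch(2) by (simp add: Phi_weights_def branch_weight_eq[where \<tau>=\<tau>, OF i])
  qed
qed

text \<open>Thus \<open>Phi\<close> takes the least weight next to the root that the criterion
  admits.\<close>

lemma Phi_weights_root_child:
  assumes "t \<in> U_set \<eta> \<kappa> \<tau>" "1 \<le> \<kappa>"
  shows "Phi_weights \<eta> \<tau> t (Trunk (- int \<kappa> + 1)) = sqrt (zeta \<eta> \<tau> t \<kappa> / zeta \<eta> \<tau> t (\<kappa> + 1))"
proof -
  obtain m where m: "\<kappa> = Suc m" using assms(2) by (cases \<kappa>) auto
  have "- int \<kappa> + 1 = - int m" using m by simp
  thus ?thesis using U_set_zeta(2)[OF assms(1)] m by (simp add: Phi_weights_def trunk_weight_eq)
qed

lemma restrict_Phi_weights: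
  "t \<in> U_set \<eta> \<kappa> \<tau> \<Longrightarrow> restrict (\<lambda>i. Phi_weights \<eta> \<tau> t (Branch i 1)) (J \<eta>) = t"
  by (auto simp: U_set_iff Phi_weights_def branch_weight_def fun_eq_iff restrict_def PiE_def extensional_def)

lemma updated_Phi_in_V_set:
  assumes t: "t \<in> U_set \<eta> \<kappa> \<tau>" and \<kappa>: "1 \<le> \<kappa>"
    and \<tau>: "\<forall>i\<in>J \<eta>. borel_measure_on_unit (\<tau> i) \<and> emeasure (\<tau> i) {0..1} \<le> ennreal C"
    and \<theta>: "sqrt (zeta \<eta> \<tau> t \<kappa> / zeta \<eta> \<tau> t (\<kappa> + 1)) \<le> \<theta>"
  shows "weighted_shift_real \<eta> \<kappa> ((Phi_weights \<eta> \<tau> t)(Trunk (- int \<kappa> + 1) := \<theta>)) \<in> V_set \<eta> \<kappa> \<tau>"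
proof -
  let ?lam = "(Phi_weights \<eta> \<tau> t)(Trunk (- int \<kappa> + 1) := \<theta>)"
  have "0 < sqrt (zeta \<eta> \<tau> t \<kappa> / zeta \<eta> \<tau> t (\<kappa> + 1))"
    using U_set_zeta(1)[OF t, of \<kappa>] U_set_zeta(1)[OF t, of "\<kappa> + 1"] by simp
  hence "0 < \<theta>" using \<theta> by linarith
  hence pos: "positive_weights \<eta> \<kappa> ?lam"
    using Phi_weights_pos[OF t \<tau>] by (auto simp: positive_weights_def)
  have "restrict (\<lambda>i. ?lam (Branch i 1)) (J \<eta>) = t"
    using restrict_Phi_weights[OF t] by simp
  thus ?thesis
    unfolding mem_V_set_iff_U_set[OF pos, OF \<tau>] using t \<theta> by simp
qed

lemma Phi_in_V_set:
  assumes t: "t \<in> U_set \<eta> \<kappa> \<tau>"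
    and \<tau>: "\<forall>i\<in>J \<eta>. borel_measure_on_unit (\<tau> i) \<and> emeasure (\<tau> i) {0..1} \<le> ennreal C"
  shows "Phi \<eta> \<kappa> \<tau> t \<in> V_set \<eta> \<kappa> \<tau>"
  unfolding Phi_def mem_V_set_iff_U_set[OF Phi_weights_pos[OF t \<tau>], OF \<tau>] restrict_Phi_weights[OF t]
  using t Phi_weights_root_child[OF t] by simp

lemma V_set_bounded: "A \<in> V_set \<eta> \<kappa> \<tau> \<Longrightarrow> A \<in> bounded_operators (tree_vertices \<eta> \<kappa>)"
  by (simp add: V_set_def completely_hyperexpansive_def)

lemma Phi_inj_on:
  assumes \<tau>: "\<forall>i\<in>J \<eta>. borel_measure_on_unit (\<tau> i) \<and> emeasure (\<tau> i) {0..1} \<le> ennreal C"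
  shows "inj_on (Phi \<eta> \<kappa> \<tau>) (U_set \<eta> \<kappa> \<tau>)"
proof
  fix t t' assume t: "t \<in> U_set \<eta> \<kappa> \<tau>" and t': "t' \<in> U_set \<eta> \<kappa> \<tau>" and eq: "Phi \<eta> \<kappa> \<tau> t = Phi \<eta> \<kappa> \<tau> t'"
  have S: "Phi \<eta> \<kappa> \<tau> t \<in> bounded_operators (tree_vertices \<eta> \<kappa>)"
    by (rule V_set_bounded[OF Phi_in_V_set[OF t \<tau>]])
  have "Phi_weights \<eta> \<tau> t (Branch i 1) = Phi_weights \<eta> \<tau> t' (Branch i 1)" if "i \<in> J \<eta>" for i
    using weighted_shift_eq_imp_weights_eq[OF eq[unfolded Phi_def weighted_shift_real_def]
        S[unfolded Phi_def weighted_shift_real_def], of "Branch i 1"] that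
    by (simp add: Branch_nonroot_iff)
  thus "t = t'"
    using restrict_Phi_weights[OF t] restrict_Phi_weights[OF t'] by (metis (no_types, lifting) restrict_ext)
qed

text \<open>Competitors satisfy the same criterion with the same t, so their norms at the root are
  at least the bound; the weights of \<open>Phi\<close> form a competitor that attains it.\<close>

lemma extremal_iff:
  fixes lam :: "vertex \<Rightarrow> real"
  assumes pos: "positive_weights \<eta> \<kappa> lam" and \<kappa>: "1 \<le> \<kappa>"
    and \<tau>: "\<forall>i\<in>J \<eta>. borel_measure_on_unit (\<tau> i) \<and> emeasure (\<tau> i) {0..1} \<le> ennreal C"
    and V: "weighted_shift_real \<eta> \<kappa> lam \<in> V_set \<eta> \<kappa> \<tau>"
  defines "t \<equiv> restrict (\<lambda>i. lam (Branch i 1)) (J \<eta>)"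
  shows "extremal \<eta> \<kappa> (weighted_shift_real \<eta> \<kappa> lam) \<longleftrightarrow>
     lam (Trunk (- int \<kappa> + 1)) = sqrt (zeta \<eta> \<tau> t \<kappa> / zeta \<eta> \<tau> t (\<kappa> + 1))"
proof -
  obtain m where m: "\<kappa> = Suc m" using \<kappa> by (cases \<kappa>) auto
  define r where "r = Trunk (- int \<kappa> + 1)"
  define \<mu> where "\<mu> = sqrt (zeta \<eta> \<tau> t \<kappa> / zeta \<eta> \<tau> t (\<kappa> + 1))"
  let ?lamc = "\<lambda>v. complex_of_real (lam v)" and ?V = "tree_vertices \<eta> \<kappa>"
  have r: "r \<in> nonroot_vertices \<eta> \<kappa>" "r = Trunk (- int m)"
    using m by (auto simp: r_def Trunk_nonroot_iff)
  have lam_r: "0 < lam r" using pos r(1) by (simp add: positive_weights_def)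
  have tc: "first_weights \<eta> ?lamc = t" using first_weights_of_real[OF pos] by (simp add: t_def)
  have crit: "t \<in> U_set \<eta> \<kappa> \<tau>"
    "\<And>v. v \<in> nonroot_vertices \<eta> \<kappa> \<Longrightarrow> v \<noteq> r \<Longrightarrow> lam v = Phi_weights \<eta> \<tau> t v" "\<mu> \<le> lam r"
    using V \<kappa> unfolding mem_V_set_iff_U_set[OF pos, OF \<tau>] t_def[symmetric] r_def \<mu>_def by auto
  have h: "has_vertex_measures \<eta> \<kappa> \<tau> ?lamc" using V unfolding mem_V_set_iff[OF pos] .
  have rn: "root_norm \<eta> \<kappa> l = cmod (l r)" if "completely_hyperexpansive ?V (weighted_shift \<eta> \<kappa> l)" for l
    using that root_norm_eq[of \<eta> m l] unfolding r(2) m by (simp add: completely_hyperexpansive_def)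
  have bound: "\<mu> \<le> root_norm \<eta> \<kappa> l" if l: "l \<in> extremal_competitors \<eta> \<kappa> ?lamc" for l
  proof -
    have nz: "nonzero_weights \<eta> \<kappa> l" and CH: "completely_hyperexpansive ?V (weighted_shift \<eta> \<kappa> l)"
      and agree: "\<And>v. v \<in> nonroot_vertices \<eta> \<kappa> \<Longrightarrow> v \<noteq> Trunk (- int \<kappa> + 1) \<Longrightarrow> l v = ?lamc v"
      using l by (auto simp: extremal_competitors_def)
    have "has_vertex_measures \<eta> \<kappa> \<tau> l" using h CH agree by (rule has_vertex_measures_if_agree)
    moreover have "first_weights \<eta> l = t" using first_weights_agree[of \<eta> \<kappa> l ?lamc] agree tc by simp
    ultimately show ?thesis
      using has_vertex_measures_iff_U_set[OF nz, OF \<tau>] \<kappa> by (simp add: rn[OF CH] \<mu>_def r_def)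
  qed
  have "extremal \<eta> \<kappa> (weighted_shift_real \<eta> \<kappa> lam) \<longleftrightarrow> lam r = \<mu>"
  proof
    assume "lam r = \<mu>"
    hence "root_norm \<eta> \<kappa> ?lamc = \<mu>"
      using rn[of ?lamc] h lam_r by (simp add: has_vertex_measures_def)
    thus "extremal \<eta> \<kappa> (weighted_shift_real \<eta> \<kappa> lam)"
      unfolding extremal_def weighted_shift_real_def
      using bound h nonzero_weights_of_real[OF pos] by (intro exI[of _ ?lamc]) (simp add: has_vertex_measures_def)
  next
    assume "extremal \<eta> \<kappa> (weighted_shift_real \<eta> \<kappa> lam)"
    \<comment> \<open>The weight function supplied by the definition need not be \<open>lam\<close>,
      but equal operators have equal weights at nonroot vertices, so the competitors are subject to
      the same conditions.\<close>
    then obtain l0 where l0: "weighted_shift \<eta> \<kappa> ?lamc = weighted_shift \<eta> \<kappa> l0"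
      "\<And>l. l \<in> extremal_competitors \<eta> \<kappa> l0 \<Longrightarrow> root_norm \<eta> \<kappa> l0 \<le> root_norm \<eta> \<kappa> l"
      by (auto simp: extremal_def weighted_shift_real_def)
    have CH: "completely_hyperexpansive ?V (weighted_shift \<eta> \<kappa> ?lamc)" using h by (simp add: has_vertex_measures_def)
    have S: "weighted_shift \<eta> \<kappa> ?lamc \<in> bounded_operators ?V" using CH by (simp add: completely_hyperexpansive_def)
    have eq0: "l0 v = ?lamc v" if "v \<in> nonroot_vertices \<eta> \<kappa>" for v
      using weighted_shift_eq_imp_weights_eq[OF l0(1) S that] by simp
    \<comment> \<open>On nonroot vertices this is \<open>lam\<close> with the weight at r lowered to
      \<mu>, since the criterion identifies all other weights with those of
      \<open>Phi\<close>.\<close>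
    let ?min = "(Phi_weights \<eta> \<tau> t)(Trunk (- int \<kappa> + 1) := \<mu>)"
    let ?minc = "\<lambda>v. complex_of_real (?min v)"
    have "0 < zeta \<eta> \<tau> t \<kappa>" "0 < zeta \<eta> \<tau> t (\<kappa> + 1)" by (auto intro!: U_set_zeta(1)[OF crit(1)])
    hence \<mu>: "0 < \<mu>" by (simp add: \<mu>_def)
    have pos': "positive_weights \<eta> \<kappa> ?min"
      using Phi_weights_pos[OF crit(1) \<tau>] \<mu> by (auto simp: positive_weights_def)
    have "weighted_shift_real \<eta> \<kappa> ?min \<in> V_set \<eta> \<kappa> \<tau>"
      by (rule updated_Phi_in_V_set[OF crit(1) \<kappa> \<tau>]) (simp_all add: \<mu>_def)
    hence CHm: "completely_hyperexpansive ?V (weighted_shift \<eta> \<kappa> ?minc)"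
      unfolding mem_V_set_iff[OF pos'] by (simp add: has_vertex_measures_def)
    have "?minc \<in> extremal_competitors \<eta> \<kappa> l0"
      unfolding extremal_competitors_def
      using nonzero_weights_of_real[OF pos'] CHm eq0 crit(2) by (auto simp: r_def)
    from l0(2)[OF this] have "root_norm \<eta> \<kappa> l0 \<le> \<mu>"
      using rn[OF CHm] \<mu> by (simp add: r_def)
    moreover have "root_norm \<eta> \<kappa> l0 = lam r"
      using rn[of l0] CH l0(1) eq0[OF r(1)] lam_r by simp
    ultimately show "lam r = \<mu>" using crit(3) by simp
  qed
  thus ?thesis by (simp only: r_def \<mu>_def)
qed

text \<open>With an empty trunk the criterion exempts no weight, so t determines the whole
  shift.\<close>

lemma Phi_bij_V_set:
  assumes \<tau>: "\<forall>i\<in>J \<eta>. borel_measure_on_unit (\<tau> i) \<and> emeasure (\<tau> i) {0..1} \<le> ennreal C"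
  shows "bij_betw (Phi \<eta> 0 \<tau>) (U_set \<eta> 0 \<tau>) (V_set \<eta> 0 \<tau>)"
  unfolding bij_betw_def
proof (intro conjI equalityI subsetI Phi_inj_on[OF \<tau>])
  fix A assume "A \<in> Phi \<eta> 0 \<tau> ` U_set \<eta> 0 \<tau>"
  thus "A \<in> V_set \<eta> 0 \<tau>" using Phi_in_V_set[OF _ \<tau>] by auto
next
  fix A assume A: "A \<in> V_set \<eta> 0 \<tau>"
  then obtain lam where pos: "positive_weights \<eta> 0 lam" and lam: "A = weighted_shift_real \<eta> 0 lam"
    by (auto simp: V_set_def)
  let ?t = "restrict (\<lambda>i. lam (Branch i 1)) (J \<eta>)"
  have t: "?t \<in> U_set \<eta> 0 \<tau>"
    and w: "\<forall>v\<in>nonroot_vertices \<eta> 0. v \<noteq> Trunk (- int 0 + 1) \<longrightarrow> lam v = Phi_weights \<eta> \<tau> ?t v"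
    using A unfolding lam mem_V_set_iff_U_set[OF pos, OF \<tau>] by auto
  have "A = Phi \<eta> 0 \<tau> ?t"
    unfolding lam Phi_def weighted_shift_real_def
    by (rule weighted_shift_cong) (use w in \<open>auto simp: Trunk_nonroot_iff\<close>)
  thus "A \<in> Phi \<eta> 0 \<tau> ` U_set \<eta> 0 \<tau>" using t by blast
qed

text \<open>The criterion leaves one weight open; extremality pins it to the lower bound, the value
  prescribed by \<open>Phi\<close>.\<close>

lemma Phi_bij_W_set:
  assumes \<kappa>: "1 \<le> \<kappa>"
    and \<tau>: "\<forall>i\<in>J \<eta>. borel_measure_on_unit (\<tau> i) \<and> emeasure (\<tau> i) {0..1} \<le> ennreal C"
  shows "bij_betw (Phi \<eta> \<kappa> \<tau>) (U_set \<eta> \<kappa> \<tau>) (W_set \<eta> \<kappa> \<tau>)"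
  unfolding bij_betw_def
proof (intro conjI equalityI subsetI Phi_inj_on[OF \<tau>])
  fix A assume "A \<in> Phi \<eta> \<kappa> \<tau> ` U_set \<eta> \<kappa> \<tau>"
  then obtain t where t: "t \<in> U_set \<eta> \<kappa> \<tau>" and A: "A = Phi \<eta> \<kappa> \<tau> t" by blast
  have V: "Phi \<eta> \<kappa> \<tau> t \<in> V_set \<eta> \<kappa> \<tau>" by (rule Phi_in_V_set[OF t \<tau>])
  have "extremal \<eta> \<kappa> (Phi \<eta> \<kappa> \<tau> t)"
    unfolding Phi_def extremal_iff[OF Phi_weights_pos[OF t \<tau>] \<kappa>, where \<tau>=\<tau>, OF \<tau> V[unfolded Phi_def]]
      restrict_Phi_weights[OF t]
    by (rule Phi_weights_root_child[OF t \<kappa>])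
  with V show "A \<in> W_set \<eta> \<kappa> \<tau>" by (simp add: A W_set_def)
next
  fix A assume A: "A \<in> W_set \<eta> \<kappa> \<tau>"
  then obtain lam where pos: "positive_weights \<eta> \<kappa> lam" and lam: "A = weighted_shift_real \<eta> \<kappa> lam"
    by (auto simp: W_set_def V_set_def)
  let ?t = "restrict (\<lambda>i. lam (Branch i 1)) (J \<eta>)"
  have V: "weighted_shift_real \<eta> \<kappa> lam \<in> V_set \<eta> \<kappa> \<tau>" and ext: "extremal \<eta> \<kappa> (weighted_shift_real \<eta> \<kappa> lam)"
    using A by (auto simp: W_set_def lam)
  have t: "?t \<in> U_set \<eta> \<kappa> \<tau>"
    and w: "\<forall>v\<in>nonroot_vertices \<eta> \<kappa>. v \<noteq> Trunk (- int \<kappa> + 1) \<longrightarrow> lam v = Phi_weights \<eta> \<tau> ?t v"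
    using V unfolding mem_V_set_iff_U_set[OF pos, OF \<tau>] by auto
  have "lam (Trunk (- int \<kappa> + 1)) = Phi_weights \<eta> \<tau> ?t (Trunk (- int \<kappa> + 1))"
    using ext unfolding extremal_iff[OF pos \<kappa>, where \<tau>=\<tau>, OF \<tau> V] Phi_weights_root_child[OF t \<kappa>] .
  with w have w': "lam v = Phi_weights \<eta> \<tau> ?t v" if "v \<in> nonroot_vertices \<eta> \<kappa>" for v
    using that by metis
  have "A = Phi \<eta> \<kappa> \<tau> ?t"
    unfolding lam Phi_def weighted_shift_real_def
    by (rule weighted_shift_cong) (use w' in simp)
  thus "A \<in> Phi \<eta> \<kappa> \<tau> ` U_set \<eta> \<kappa> \<tau>" using t by blast
qed

theorem theorem7p3p4:
  fixes \<eta> :: enat and \<kappa> :: nat and \<tau> :: "nat \<Rightarrow> real measure"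
  assumes "2 \<le> \<eta>"
    and "\<And>i. i \<in> J \<eta> \<Longrightarrow> borel_measure_on_unit (\<tau> i)"
    and "(SUP i\<in>J \<eta>. emeasure (\<tau> i) {0..1}) < \<infinity>"
  shows "(\<kappa> = 0 \<longrightarrow> bij_betw (Phi \<eta> 0 \<tau>) (U_set \<eta> 0 \<tau>) (V_set \<eta> 0 \<tau>)) \<and>
    (1 \<le> \<kappa> \<longrightarrow>
       bij_betw (Phi \<eta> \<kappa> \<tau>) (U_set \<eta> \<kappa> \<tau>) (W_set \<eta> \<kappa> \<tau>) \<and>
       (\<forall>lam :: vertex \<Rightarrow> real.
          positive_weights \<eta> \<kappa> lam \<and> weighted_shift_real \<eta> \<kappa> lam \<in> V_set \<eta> \<kappa> \<tau> \<longrightarrow>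
          (let t = restrict (\<lambda>i. lam (Branch i 1)) (J \<eta>) in
             t \<in> U_set \<eta> \<kappa> \<tau> \<and>
             lam (Trunk (- int \<kappa> + 1)) \<in> {sqrt (zeta \<eta> \<tau> t \<kappa> / zeta \<eta> \<tau> t (\<kappa> + 1))..} \<and>
             (\<forall>v\<in>nonroot_vertices \<eta> \<kappa>. v \<noteq> Trunk (- int \<kappa> + 1) \<longrightarrow> lam v = Phi_weights \<eta> \<tau> t v))) \<and>
       (\<forall>t\<in>U_set \<eta> \<kappa> \<tau>. \<forall>\<theta>\<in>{sqrt (zeta \<eta> \<tau> t \<kappa> / zeta \<eta> \<tau> t (\<kappa> + 1))..}.
          weighted_shift_real \<eta> \<kappa> ((Phi_weights \<eta> \<tau> t)(Trunk (- int \<kappa> + 1) := \<theta>)) \<in> V_set \<eta> \<kappa> \<tau>))"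
proof -
  obtain C where C: "\<And>i. i \<in> J \<eta> \<Longrightarrow> emeasure (\<tau> i) {0..1} \<le> ennreal C"
  proof -
    have "ennreal (enn2real (SUP i\<in>J \<eta>. emeasure (\<tau> i) {0..1})) = (SUP i\<in>J \<eta>. emeasure (\<tau> i) {0..1})"
      using assms(3) by (simp add: ennreal_enn2real)
    thus ?thesis using that SUP_upper by metis
  qed
  have bounded: "\<forall>i\<in>J \<eta>. borel_measure_on_unit (\<tau> i) \<and> emeasure (\<tau> i) {0..1} \<le> ennreal C"
    using assms(2) C by blast
  show ?thesis
  proof (intro conjI impI allI ballI)
    assume "\<kappa> = 0"
    show "bij_betw (Phi \<eta> 0 \<tau>) (U_set \<eta> 0 \<tau>) (V_set \<eta> 0 \<tau>)" by (rule Phi_bij_V_set[OF bounded])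
  next
    assume "1 \<le> \<kappa>"
    thus "bij_betw (Phi \<eta> \<kappa> \<tau>) (U_set \<eta> \<kappa> \<tau>) (W_set \<eta> \<kappa> \<tau>)" by (rule Phi_bij_W_set[OF _ bounded])
  next
    fix lam :: "vertex \<Rightarrow> real"
    assume "1 \<le> \<kappa>" and "positive_weights \<eta> \<kappa> lam \<and> weighted_shift_real \<eta> \<kappa> lam \<in> V_set \<eta> \<kappa> \<tau>"
    thus "let t = restrict (\<lambda>i. lam (Branch i 1)) (J \<eta>) in
             t \<in> U_set \<eta> \<kappa> \<tau> \<and>
             lam (Trunk (- int \<kappa> + 1)) \<in> {sqrt (zeta \<eta> \<tau> t \<kappa> / zeta \<eta> \<tau> t (\<kappa> + 1))..} \<and>
             (\<forall>v\<in>nonroot_vertices \<eta> \<kappa>. v \<noteq> Trunk (- int \<kappa> + 1) \<longrightarrow> lam v = Phi_weights \<eta> \<tau> t v)"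
      using mem_V_set_iff_U_set[where \<eta>=\<eta> and \<kappa>=\<kappa> and lam=lam and \<tau>=\<tau>, OF _ bounded]
      unfolding Let_def atLeast_iff by blast
  next
    fix t \<theta>
    assume "1 \<le> \<kappa>" "t \<in> U_set \<eta> \<kappa> \<tau>" "\<theta> \<in> {sqrt (zeta \<eta> \<tau> t \<kappa> / zeta \<eta> \<tau> t (\<kappa> + 1))..}"
    thus "weighted_shift_real \<eta> \<kappa> ((Phi_weights \<eta> \<tau> t)(Trunk (- int \<kappa> + 1) := \<theta>)) \<in> V_set \<eta> \<kappa> \<tau>"
      by (intro updated_Phi_in_V_set[OF _ _ bounded]) auto
  qed
qed

end
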